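(* Let $\Bbbk$ be a field with $\operatorname{char}\Bbbk\neq 2$, let $n\ge 2$ be an integer and $v$ a positive integer, and let $A=\Bbbk_{-1}[x_1,\dots,x_n]^{(v)}$. If $n$ and $v$ have different parity, then $\operatorname{Aut}(A)\cong S_n\ltimes(\Bbbk^\times)^n$.
   Context: $\operatorname{Aut}(A)$ is the group of $\Bbbk$-algebra automorphisms of $A$. For $q\in\Bbbk^\times$, $\Bbbk_q[x_1,\dots,x_n]$ is the $\Bbbk$-algebra generated by $x_1,\dots,x_n$ subject to $x_jx_i=q\,x_ix_j$ for all $1\le i<j\le n$; it is $\mathbb{N}$-graded with $\deg x_i=1$. For a $\mathbb{Z}$-graded algebra $C=\bigoplus_i C_i$ and a positive integer $v$, the $v$th Veronese subring is $C^{(v)}=\bigoplus_i C_{vi}$. The action of $S_n$ on $(\Bbbk^\times)^n$ in the semidirect product is in general not the coordinate permutation $\sigma:(a_1,\dots,a_n)\mapsto(a_{\sigma^{-1}(1)},\dots,a_{\sigma^{-1}(n)})$. It is the conjugation action inside $\operatorname{Aut}(A)$, where $\sigma\in S_n$ is identified with the restriction to $A$ of the automorphism $x_i\mapsto x_{\sigma(i)}$ of $\Bbbk_{-1}[x_1,\dots,x_n]$, and $(c,k_2,\dots,k_n)\in(\Bbbk^\times)^n$ is identified with the automorphism of $A$ sending each monomial $x_1^{s_1}\cdots x_n^{s_n}$ of total degree $Nv$ to $c^Nk_2^{s_2}\cdots k_n^{s_n}\,x_1^{s_1}\cdots x_n^{s_n}$. *)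

theory Defs
  imports
    "HOL-Algebra.Algebra"
    "HOL-Algebra.Algebraic_Closure_Type"
    "HOL-Library.Poly_Mapping"
begin

section \<open>Free algebras\<close>

text \<open>
  A copy of the list type that carries the free monoid structure, written additively because
  that is the convention under which \<open>Poly_Mapping\<close> provides monoid algebras:
  \<open>'i word \<Rightarrow>\<^sub>0 'k\<close> is the free associative algebra on the type \<open>'i\<close>.
\<close>

datatype 'i word = Word (letters: "'i list")

instantiation word :: (type) monoid_add
begin

definition zero_word :: "'a word" where
  "0 = Word []"

definition plus_word :: "'a word \<Rightarrow> 'a word \<Rightarrow> 'a word" where
  "u + w = Word (letters u @ letters w)"

instance
  by standard (simp_all add: zero_word_def plus_word_def)

end

definition indet :: "'i \<Rightarrow> 'i word \<Rightarrow>\<^sub>0 'k::field" where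
  "indet i = Poly_Mapping.single (Word [i]) 1"

definition scalar :: "'k \<Rightarrow> 'i word \<Rightarrow>\<^sub>0 'k::field" where
  "scalar c = Poly_Mapping.single 0 c"

definition free_algebra :: "'i set \<Rightarrow> ('k::field, 'i word \<Rightarrow>\<^sub>0 'k) module" where
  "free_algebra S =
    \<lparr>carrier = {f. \<forall>w\<in>Poly_Mapping.keys f. set (letters w) \<subseteq> S},
     monoid.mult = (*), one = 1, ring.zero = 0, ring.add = (+), module.smult = (\<lambda>c f. scalar c * f)\<rparr>"


section \<open>Quotient algebras, automorphism groups, Veronese subrings\<close>

text \<open>
  The ring structure is that of \<open>R Quot I\<close>. All the cosets in the union defining the scalar
  multiplication coincide when \<open>I\<close> is closed under scalar multiplication.
\<close>

definition quotient_algebra :: "('k, 'a) module \<Rightarrow> 'a set \<Rightarrow> ('k, 'a set) module" where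
  "quotient_algebra R I =
    \<lparr>carrier = carrier (R Quot I), monoid.mult = monoid.mult (R Quot I), one = one (R Quot I),
     ring.zero = ring.zero (R Quot I), ring.add = ring.add (R Quot I),
     module.smult = (\<lambda>c Y. \<Union>f\<in>Y. I +>\<^bsub>R\<^esub> (c \<odot>\<^bsub>R\<^esub> f))\<rparr>"

definition algebra_auto :: "('k, 'a) module \<Rightarrow> ('a \<Rightarrow> 'a) set" where
  "algebra_auto A =
    {\<phi> \<in> ring_hom A A \<inter> Bij (carrier A).
       \<forall>c. \<forall>a\<in>carrier A. \<phi> (c \<odot>\<^bsub>A\<^esub> a) = c \<odot>\<^bsub>A\<^esub> \<phi> a}"

definition Algebra_Aut :: "('k, 'a) module \<Rightarrow> ('a \<Rightarrow> 'a) monoid" where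
  "Algebra_Aut A = BijGroup (carrier A) \<lparr>carrier := algebra_auto A\<rparr>"

text \<open>
  The grading is given by its components \<open>gr d\<close> for \<open>d \<ge> 0\<close>; components of negative degree are zero.
\<close>

definition veronese :: "nat \<Rightarrow> ('k, 'a) module \<Rightarrow> (nat \<Rightarrow> 'a set) \<Rightarrow> ('k, 'a) module" where
  "veronese v C gr =
    C \<lparr>carrier := {(\<Oplus>\<^bsub>C\<^esub>i\<in>{..m}. c i) | m c. \<forall>i. c i \<in> gr (v * i)}\<rparr>"


section \<open>Skew polynomial algebras\<close>

definition skew_relators :: "'k::field \<Rightarrow> nat \<Rightarrow> (nat word \<Rightarrow>\<^sub>0 'k) set" where
  "skew_relators q n =
    {indet j * indet i - scalar q * (indet i * indet j) | i j. 1 \<le> i \<and> i < j \<and> j \<le> n}"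

definition skew_ideal :: "'k::field \<Rightarrow> nat \<Rightarrow> (nat word \<Rightarrow>\<^sub>0 'k) set" where
  "skew_ideal q n = Idl\<^bsub>free_algebra {1..n}\<^esub> (skew_relators q n)"

definition skew_poly :: "'k::field \<Rightarrow> nat \<Rightarrow> ('k, (nat word \<Rightarrow>\<^sub>0 'k) set) module" where
  "skew_poly q n = quotient_algebra (free_algebra {1..n}) (skew_ideal q n)"

definition skew_class :: "'k::field \<Rightarrow> nat \<Rightarrow> (nat word \<Rightarrow>\<^sub>0 'k) \<Rightarrow> (nat word \<Rightarrow>\<^sub>0 'k) set" where
  "skew_class q n f = skew_ideal q n +>\<^bsub>free_algebra {1..n}\<^esub> f"

definition skew_gen :: "'k::field \<Rightarrow> nat \<Rightarrow> nat \<Rightarrow> (nat word \<Rightarrow>\<^sub>0 'k) set" where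
  "skew_gen q n i = skew_class q n (indet i)"

definition skew_grade :: "'k::field \<Rightarrow> nat \<Rightarrow> nat \<Rightarrow> (nat word \<Rightarrow>\<^sub>0 'k) set set" where
  "skew_grade q n d =
    skew_class q n `
      {f \<in> carrier (free_algebra {1..n}). \<forall>w\<in>Poly_Mapping.keys f. length (letters w) = d}"

definition skew_monomial :: "'k::field \<Rightarrow> nat \<Rightarrow> (nat \<Rightarrow> nat) \<Rightarrow> (nat word \<Rightarrow>\<^sub>0 'k) set" where
  "skew_monomial q n s =
    foldr (\<lambda>i y. (skew_gen q n i [^]\<^bsub>skew_poly q n\<^esub> s i) \<otimes>\<^bsub>skew_poly q n\<^esub> y)
      [1..<Suc n] \<one>\<^bsub>skew_poly q n\<^esub>"

definition skew_veronese :: "'k::field \<Rightarrow> nat \<Rightarrow> nat \<Rightarrow> ('k, (nat word \<Rightarrow>\<^sub>0 'k) set) module" where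
  "skew_veronese q n v = veronese v (skew_poly q n) (skew_grade q n)"


section \<open>The semidirect product\<close>

definition semidirect ::
  "('h, 'x) monoid_scheme \<Rightarrow> ('a, 'y) monoid_scheme \<Rightarrow> ('h \<Rightarrow> 'a \<Rightarrow> 'a) \<Rightarrow> ('h \<times> 'a) monoid" where
  "semidirect H N \<theta> =
    \<lparr>carrier = carrier H \<times> carrier N,
     monoid.mult = (\<lambda>(h, a) (h', a'). (h \<otimes>\<^bsub>H\<^esub> h', a \<otimes>\<^bsub>N\<^esub> \<theta> h a')),
     one = (\<one>\<^bsub>H\<^esub>, \<one>\<^bsub>N\<^esub>)\<rparr>"

definition torus :: "nat \<Rightarrow> (nat \<Rightarrow> 'k::field) monoid" where
  "torus n = product_group {1..n} (\<lambda>_. mult_of ring_of_type_algebra)"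

text \<open>
  An element \<open>t\<close> of the torus encodes the tuple \<open>(c, k\<^sub>2, \<dots>, k\<^sub>n)\<close> by \<open>t 1 = c\<close> and \<open>t i = k\<^sub>i\<close> for
  \<open>i \<ge> 2\<close>. The automorphism below is unique because the monomials span the Veronese subring.
\<close>

definition torus_aut ::
  "nat \<Rightarrow> nat \<Rightarrow> (nat \<Rightarrow> 'k::field) \<Rightarrow> (nat word \<Rightarrow>\<^sub>0 'k) set \<Rightarrow> (nat word \<Rightarrow>\<^sub>0 'k) set" where
  "torus_aut n v t =
    (THE \<phi>. \<phi> \<in> algebra_auto (skew_veronese (-1) n v) \<and>
      (\<forall>N s. (\<Sum>i=1..n. s i) = N * v \<longrightarrow>
        \<phi> (skew_monomial (-1) n s) =
          (t 1 ^ N * (\<Prod>i=2..n. t i ^ s i)) \<odot>\<^bsub>skew_veronese (-1) n v\<^esub> skew_monomial (-1) n s))"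

definition perm_aut ::
  "nat \<Rightarrow> nat \<Rightarrow> (nat \<Rightarrow> nat) \<Rightarrow> (nat word \<Rightarrow>\<^sub>0 'k::field) set \<Rightarrow> (nat word \<Rightarrow>\<^sub>0 'k) set" where
  "perm_aut n v \<sigma> =
    restrict
      (THE \<psi>. \<psi> \<in> algebra_auto (skew_poly (-1) n) \<and>
        (\<forall>i\<in>{1..n}. \<psi> (skew_gen (-1) n i) = skew_gen (-1) n (\<sigma> i)))
      (carrier (skew_veronese (-1) n v))"

text \<open>
  The conjugation action of \<open>sym_group n\<close> on \<open>torus n\<close> inside the automorphism group. Explicitly,
  with \<open>\<tau> = \<sigma>\<inverse>\<close> and the convention \<open>k\<^sub>1 = 1\<close>, it sends \<open>(c, k\<^sub>2, \<dots>, k\<^sub>n)\<close> to the tuple with first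
  entry \<open>c k\<^bsub>\<tau>(1)\<^esub>\<^sup>v\<close> and \<open>j\<close>-th entry \<open>k\<^bsub>\<tau>(j)\<^esub> / k\<^bsub>\<tau>(1)\<^esub>\<close> for \<open>j \<ge> 2\<close>.
  The element \<open>t'\<close> is unique for \<open>v > 0\<close>: evaluate on \<open>x\<^sub>1\<^sup>v\<close> and on \<open>x\<^sub>1\<^sup>v\<^sup>-\<^sup>1 x\<^sub>j\<close>.
\<close>

definition conj_action ::
  "nat \<Rightarrow> nat \<Rightarrow> (nat \<Rightarrow> nat) \<Rightarrow> (nat \<Rightarrow> 'k::field) \<Rightarrow> nat \<Rightarrow> 'k" where
  "conj_action n v \<sigma> t =
    (let G = Algebra_Aut (skew_veronese (-1 :: 'k) n v)
     in THE t'. t' \<in> carrier (torus n) \<and>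
          torus_aut n v t' =
            perm_aut n v \<sigma> \<otimes>\<^bsub>G\<^esub> torus_aut n v t \<otimes>\<^bsub>G\<^esub> inv\<^bsub>G\<^esub> (perm_aut n v \<sigma>))"

end

theory Submission
  imports Defs "HOL-Library.Multiset_Order"
begin

text \<open>
  Let \<open>x\<^sup>M\<close> be the ordered monomial whose exponents are the multiplicities of the multiset \<open>M\<close>.
  These monomials, for \<open>M\<close> with entries in \<open>{1..n}\<close> and size divisible by \<open>v\<close>, form a basis of \<open>A\<close>, and
  \<open>x\<^sup>M x\<^sup>N = \<plusminus>x\<^sup>M\<^sup>+\<^sup>N\<close>. The basis comes from a normal form on the free algebra whose kernel is the
  defining ideal (\<open>mem_skew_ideal_iff\<close>, \<open>carrier_skew_veronese\<close>). After this identification the theorem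
  rests on one fact: \<^emph>\<open>every automorphism \<open>\<phi>\<close> of \<open>A\<close> sends each monomial to a scalar multiple of a
  monomial\<close> (\<open>image_monomial_is_term\<close>), for the following reasons.

  \<^item> The element \<open>f = \<phi>(x\<^sup>M)\<close> is normal, \<open>f A = A f\<close>, because monomials commute up to sign. Comparing
    the largest and the smallest monomial of both sides of \<open>f x\<^sup>U = g f\<close> for a total order that is
    compatible with addition gives \<open>g = c x\<^sup>U\<close>. So all monomials of \<open>f\<close> pick up the same sign when they
    pass \<open>x\<^sup>U\<close>, for every \<open>U\<close> (\<open>image_monomial_normal\<close>).

  \<^item> If \<open>n\<close> and \<open>v\<close> have different parity, these signs determine the exponents modulo 2
    (\<open>commutation_determines_parity\<close>). With equal parity this fails, because \<open>A\<close> then contains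
    monomials with all exponents odd, and they are central.

  \<^item> Hence if some monomial of \<open>\<phi>(x\<^sup>M)\<close> has odd degree in \<open>x\<^sub>i\<close>, then \<open>x\<^sub>i\<close> divides all of them. As
    \<open>\<phi>\<close> is surjective, such an \<open>M\<close> exists for every \<open>i\<close>. Multiplying these monomials gives a monomial
    whose image is divisible by \<open>e = x\<^sub>1\<^sup>v \<cdots> x\<^sub>n\<^sup>v\<close>. Applied to the inverse of \<open>\<phi>\<close> this says that
    \<open>\<phi>(e)\<close> divides a monomial, and a divisor of a monomial is a scalar multiple of a monomial. Every
    monomial of \<open>A\<close> divides a power of \<open>e\<close>, so the same holds for all of them.

  The exponents of the images define an automorphism of the monoid of exponents of \<open>A\<close>. Such an
  automorphism comes from a permutation of the variables (\<open>induced_by_permutation\<close>), since it permutes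
  the multisets consisting of \<open>v\<close> copies of one variable. Composing with the inverse of this
  permutation leaves an automorphism that multiplies each monomial by a scalar. The scalars are
  multiplicative in the exponent, so they are determined by their values on \<open>x\<^sub>1\<^sup>v\<close> and on the
  \<open>x\<^sub>1\<^sup>v\<^sup>-\<^sup>1 x\<^sub>j\<close>, which correspond to a point of the torus (\<open>acts_by_id_torus\<close>). So the
  automorphism group is the product of the torus and the symmetric group, the torus is normalized by
  the symmetric group, and the factors of a product are unique; this is the claimed semidirect
  product (\<open>iso_semidirect\<close>).
\<close>


section \<open>Finitely supported functions\<close>

lemma poly_mapping_induct_keys [consumes 1, case_names single add zero]:
  assumes "Poly_Mapping.keys f \<subseteq> A"
    and single: "\<And>a b. a \<in> A \<Longrightarrow> P (Poly_Mapping.single a b)"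
    and add: "\<And>f g. Poly_Mapping.keys f \<subseteq> A \<Longrightarrow> Poly_Mapping.keys g \<subseteq> A \<Longrightarrow> P f \<Longrightarrow> P g \<Longrightarrow> P (f + g)"
    and zero: "P 0"
  shows "P (f :: 'a \<Rightarrow>\<^sub>0 'b::comm_monoid_add)"
  using assms(1)
proof (induction f rule: update_induct)
  case const
  show ?case using zero by simp
next
  case (update f a b)
  have upd: "Poly_Mapping.update a b f = f + Poly_Mapping.single a b"
    using update(1) by (intro poly_mapping_eqI)
      (auto simp: lookup_update lookup_add lookup_single in_keys_iff when_def)
  have k: "Poly_Mapping.keys (Poly_Mapping.update a b f) = insert a (Poly_Mapping.keys f)"
    using update(2) by (auto simp: keys_update)
  show ?case
    unfolding upd using update k by (intro add single) auto
qed

lemma poly_mapping_induct_single [case_names single add]: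
  assumes "\<And>a b. P (Poly_Mapping.single a b)" "\<And>f g. P f \<Longrightarrow> P g \<Longrightarrow> P (f + g)"
  shows "P (f :: 'a \<Rightarrow>\<^sub>0 'b::comm_monoid_add)"
  using subset_UNIV[of "Poly_Mapping.keys f"]
proof (induction f rule: poly_mapping_induct_keys)
  show "P 0" using assms(1)[of _ 0] by simp
qed (use assms in auto)

lemma poly_mapping_sum_singles:
  "(\<Sum>a\<in>Poly_Mapping.keys p. Poly_Mapping.single a (Poly_Mapping.lookup p a)) = p"
  by (rule poly_mapping_eqI) (auto simp: lookup_sum lookup_single when_def in_keys_iff)

lemma single_eq_0_iff [simp]: "Poly_Mapping.single a c = 0 \<longleftrightarrow> c = 0"
  by (metis lookup_single_eq lookup_zero single_zero)

section \<open>The normal form of a word\<close>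

fun inversions :: "nat list \<Rightarrow> nat" where
  "inversions [] = 0"
| "inversions (x # xs) = length (filter (\<lambda>y. y < x) xs) + inversions xs"

text \<open>
  The number of inversions between the letters of a word with content \<open>M\<close> and those of a word with
  content \<open>N\<close> that follows it; they are what has to be undone to sort the product.
\<close>

definition crossings :: "nat multiset \<Rightarrow> nat multiset \<Rightarrow> nat" where
  "crossings M N = (\<Sum>i\<in>#M. size {#j \<in># N. j < i#})"

lemma crossings_empty [simp]: "crossings {#} N = 0" "crossings M {#} = 0"
  by (simp_all add: crossings_def)

lemma crossings_add_left: "crossings (M + M') N = crossings M N + crossings M' N"
  by (simp add: crossings_def)

lemma crossings_add_right: "crossings M (N + N') = crossings M N + crossings M N'"
  by (simp add: crossings_def sum_mset.distrib)

lemma inversions_append: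
  "inversions (xs @ ys) = inversions xs + inversions ys + crossings (mset xs) (mset ys)"
  by (induction xs) (simp_all add: crossings_def flip: mset_filter)

text \<open>
  The product of the skew polynomial algebra with parameter \<open>q\<close>, written in coordinates with respect
  to the basis of ordered monomials: \<open>x\<^sup>M x\<^sup>N = q\<^sup>c x\<^sup>M\<^sup>+\<^sup>N\<close> with \<open>c = crossings M N\<close>.
\<close>

definition qmul :: "'k::comm_ring_1 \<Rightarrow> (nat multiset \<Rightarrow>\<^sub>0 'k) \<Rightarrow> (nat multiset \<Rightarrow>\<^sub>0 'k) \<Rightarrow> nat multiset \<Rightarrow>\<^sub>0 'k" where
  "qmul q f g = (\<Sum>M\<in>Poly_Mapping.keys f. \<Sum>N\<in>Poly_Mapping.keys g.
     Poly_Mapping.single (M + N) (q ^ crossings M N * Poly_Mapping.lookup f M * Poly_Mapping.lookup g N))"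

lemma qmul_add_left: "qmul q (f + f') g = qmul q f g + qmul q f' g"
  unfolding qmul_def
  by (rule setsum_keys_plus_distrib[where f = "\<lambda>M a. \<Sum>N\<in>Poly_Mapping.keys g.
     Poly_Mapping.single (M + N) (q ^ crossings M N * a * Poly_Mapping.lookup g N)"])
   (simp_all add: algebra_simps sum.distrib single_add)

lemma qmul_add_right: "qmul q f (g + g') = qmul q f g + qmul q f g'"
proof -
  have "(\<Sum>N\<in>Poly_Mapping.keys (g + g').
     Poly_Mapping.single (M + N) (q ^ crossings M N * a * Poly_Mapping.lookup (g + g') N)) =
   (\<Sum>N\<in>Poly_Mapping.keys g.
     Poly_Mapping.single (M + N) (q ^ crossings M N * a * Poly_Mapping.lookup g N)) +
   (\<Sum>N\<in>Poly_Mapping.keys g'.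
     Poly_Mapping.single (M + N) (q ^ crossings M N * a * Poly_Mapping.lookup g' N))" for M a
    by (rule setsum_keys_plus_distrib[where f = "\<lambda>N b.
     Poly_Mapping.single (M + N) (q ^ crossings M N * a * b)"])
     (simp_all add: algebra_simps single_add)
  then show ?thesis by (simp add: qmul_def sum.distrib)
qed

lemma qmul_zero [simp]: "qmul q 0 g = 0" "qmul q f 0 = 0"
  by (simp_all add: qmul_def)

lemma qmul_single:
  "qmul q (Poly_Mapping.single M a) (Poly_Mapping.single N b) =
     Poly_Mapping.single (M + N) (q ^ crossings M N * a * b)"
  by (simp add: qmul_def)

text \<open>
  Sorting a word by adjacent transpositions costs one factor \<open>q\<close> per inversion.
\<close>

definition normal_form :: "'k::comm_ring_1 \<Rightarrow> (nat word \<Rightarrow>\<^sub>0 'k) \<Rightarrow> nat multiset \<Rightarrow>\<^sub>0 'k" where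
  "normal_form q f = (\<Sum>w\<in>Poly_Mapping.keys f.
     Poly_Mapping.single (mset (letters w)) (q ^ inversions (letters w) * Poly_Mapping.lookup f w))"

lemma normal_form_add: "normal_form q (f + g) = normal_form q f + normal_form q g"
  unfolding normal_form_def
  by (rule setsum_keys_plus_distrib[where f = "\<lambda>w a.
     Poly_Mapping.single (mset (letters w)) (q ^ inversions (letters w) * a)"])
   (simp_all add: algebra_simps single_add)

lemma normal_form_zero [simp]: "normal_form q 0 = 0"
  by (simp add: normal_form_def)

lemma normal_form_minus: "normal_form q (f - g) = normal_form q f - normal_form q g"
  using normal_form_add[of q "f - g" g] by simp

lemma normal_form_single:
  "normal_form q (Poly_Mapping.single w a) =
     Poly_Mapping.single (mset (letters w)) (q ^ inversions (letters w) * a)"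
  by (simp add: normal_form_def)

text \<open>
  Both sides are biadditive, and on words this is the formula for the inversions of a concatenation.
\<close>

lemma normal_form_mult: "normal_form q (f * g) = qmul q (normal_form q f) (normal_form q g)"
proof (induction f rule: poly_mapping_induct_single)
  case (single u a)
  show ?case
  proof (induction g rule: poly_mapping_induct_single)
    case (single w b)
    show ?case
      by (simp add: mult_single normal_form_single qmul_single plus_word_def inversions_append
          power_add mult_ac)
  qed (simp_all add: distrib_left normal_form_add qmul_add_right)
qed (simp_all add: distrib_right normal_form_add qmul_add_left)

definition sorted_rep :: "(nat multiset \<Rightarrow>\<^sub>0 'k::comm_ring_1) \<Rightarrow> nat word \<Rightarrow>\<^sub>0 'k" where
  "sorted_rep p = (\<Sum>M\<in>Poly_Mapping.keys p.
     Poly_Mapping.single (Word (sorted_list_of_multiset M)) (Poly_Mapping.lookup p M))"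

lemma sorted_rep_add: "sorted_rep (p + p') = sorted_rep p + sorted_rep p'"
  unfolding sorted_rep_def
  by (rule setsum_keys_plus_distrib[where f = "\<lambda>M a.
     Poly_Mapping.single (Word (sorted_list_of_multiset M)) a"]) (simp_all add: single_add)

lemma sorted_rep_zero [simp]: "sorted_rep 0 = 0"
  by (simp add: sorted_rep_def)

lemma sorted_rep_single:
  "sorted_rep (Poly_Mapping.single M a) = Poly_Mapping.single (Word (sorted_list_of_multiset M)) a"
  by (simp add: sorted_rep_def)

lemma inversions_sorted: "sorted xs \<Longrightarrow> inversions xs = 0"
  by (induction xs) (auto simp: filter_empty_conv)

lemma normal_form_sorted_rep [simp]: "normal_form q (sorted_rep p) = p"
  by (induction p rule: poly_mapping_induct_single)
    (simp_all add: sorted_rep_single sorted_rep_add normal_form_single normal_form_add inversions_sorted)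

section \<open>The defining ideal is the kernel of the normal form\<close>

lemma free_algebra_sel [simp]:
  "carrier (free_algebra S) = {f. \<forall>w\<in>Poly_Mapping.keys f. set (letters w) \<subseteq> S}"
  "monoid.mult (free_algebra S) = (*)" "\<one>\<^bsub>free_algebra S\<^esub> = 1" "\<zero>\<^bsub>free_algebra S\<^esub> = 0"
  "ring.add (free_algebra S) = (+)" "module.smult (free_algebra S) = (\<lambda>c f. scalar c * f)"
  by (simp_all add: free_algebra_def)

lemma free_algebra_mult_closed:
  assumes "f \<in> carrier (free_algebra S)" "g \<in> carrier (free_algebra S)"
  shows "f * g \<in> carrier (free_algebra S)"
  using assms keys_mult[of f g] by (fastforce simp: plus_word_def)

lemma free_algebra_add_closed:
  assumes "f \<in> carrier (free_algebra S)" "g \<in> carrier (free_algebra S)"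
  shows "f + g \<in> carrier (free_algebra S)"
  using assms Poly_Mapping.keys_add[of f g] by auto

lemma free_algebra_uminus_closed:
  assumes "f \<in> carrier (free_algebra S)"
  shows "- f \<in> carrier (free_algebra S :: ('k::field, _) module)"
  using assms by (auto simp: in_keys_iff)

lemma free_algebra_single [simp]:
  "set xs \<subseteq> S \<Longrightarrow> Poly_Mapping.single (Word xs) c \<in> carrier (free_algebra S)"
  by simp

lemma ring_free_algebra: "ring (free_algebra S :: ('k::field, 'a word \<Rightarrow>\<^sub>0 'k) module)"
proof (rule ringI)
  show "abelian_group (free_algebra S :: ('k::field, 'a word \<Rightarrow>\<^sub>0 'k) module)"
  proof (rule abelian_groupI)
    fix x :: "'a word \<Rightarrow>\<^sub>0 'k" assume "x \<in> carrier (free_algebra S)"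
    then show "\<exists>y\<in>carrier (free_algebra S). y \<oplus>\<^bsub>free_algebra S\<^esub> x = \<zero>\<^bsub>free_algebra S\<^esub>"
      using free_algebra_uminus_closed by (intro bexI[of _ "- x"]) auto
  qed (use free_algebra_add_closed in \<open>auto simp: add_ac simp del: free_algebra_sel(1)\<close>, simp)
  show "monoid (free_algebra S :: ('k::field, 'a word \<Rightarrow>\<^sub>0 'k) module)"
    by (rule monoidI) (use free_algebra_mult_closed in
       \<open>auto simp: mult_ac algebra_simps zero_word_def simp del: free_algebra_sel(1)\<close>, simp add: zero_word_def)
qed (simp_all add: algebra_simps)

lemma skew_relator_eq:
  "indet j * indet i - scalar q * (indet i * indet j) =
     Poly_Mapping.single (Word [j, i]) 1 - Poly_Mapping.single (Word [i, j]) q"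
  by (simp add: indet_def scalar_def mult_single plus_word_def zero_word_def)

lemma skew_relators_subset: "skew_relators q n \<subseteq> carrier (free_algebra {1..n})"
proof
  fix r :: "nat word \<Rightarrow>\<^sub>0 'a"
  assume "r \<in> skew_relators q n"
  then obtain i j where r: "r = Poly_Mapping.single (Word [j, i]) 1 + - Poly_Mapping.single (Word [i, j]) q"
    and ij: "1 \<le> i" "i < j" "j \<le> n"
    unfolding skew_relators_def skew_relator_eq by auto
  show "r \<in> carrier (free_algebra {1..n})"
    unfolding r by (intro free_algebra_add_closed free_algebra_uminus_closed free_algebra_single)
      (use ij in auto)
qed

lemma ideal_skew_ideal: "ideal (skew_ideal q n) (free_algebra {1..n})"
  unfolding skew_ideal_def by (intro ring.genideal_ideal ring_free_algebra skew_relators_subset)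

lemma skew_ideal_closed:
  shows "f \<in> skew_ideal q n \<Longrightarrow> f \<in> carrier (free_algebra {1..n})"
    and "f \<in> skew_ideal q n \<Longrightarrow> g \<in> skew_ideal q n \<Longrightarrow> f + g \<in> skew_ideal q n"
    and "g \<in> carrier (free_algebra {1..n}) \<Longrightarrow> f \<in> skew_ideal q n \<Longrightarrow> g * f \<in> skew_ideal q n"
    and "g \<in> carrier (free_algebra {1..n}) \<Longrightarrow> f \<in> skew_ideal q n \<Longrightarrow> f * g \<in> skew_ideal q n"
    and "0 \<in> skew_ideal q n"
proof -
  interpret ideal "skew_ideal q n" "free_algebra {1..n}" by (rule ideal_skew_ideal)
  show "f \<in> skew_ideal q n \<Longrightarrow> f \<in> carrier (free_algebra {1..n})" by (rule a_Hcarr)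
  show "f \<in> skew_ideal q n \<Longrightarrow> g \<in> skew_ideal q n \<Longrightarrow> f + g \<in> skew_ideal q n"
    using additive_subgroup.a_closed[OF additive_subgroup_axioms, of f g] by (simp del: free_algebra_sel(1))
  show "g \<in> carrier (free_algebra {1..n}) \<Longrightarrow> f \<in> skew_ideal q n \<Longrightarrow> g * f \<in> skew_ideal q n"
    using I_l_closed[of f g] by (simp del: free_algebra_sel(1))
  show "g \<in> carrier (free_algebra {1..n}) \<Longrightarrow> f \<in> skew_ideal q n \<Longrightarrow> f * g \<in> skew_ideal q n"
    using I_r_closed[of f g] by (simp del: free_algebra_sel(1))
  show "0 \<in> skew_ideal q n" using additive_subgroup.zero_closed[OF additive_subgroup_axioms] by (simp del: free_algebra_sel(1))
qed

lemma skew_ideal_minimal: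
  assumes "ideal J (free_algebra {1..n})" "skew_relators q n \<subseteq> J"
  shows "skew_ideal q n \<subseteq> J"
  unfolding skew_ideal_def by (rule ring.genideal_minimal[OF ring_free_algebra assms])

text \<open>
  Closure under negation follows, as it is multiplication by the constant \<open>-1\<close>.
\<close>

lemma free_algebra_idealI:
  assumes "I \<subseteq> carrier (free_algebra S)" "0 \<in> I" "\<And>f g. f \<in> I \<Longrightarrow> g \<in> I \<Longrightarrow> f + g \<in> I"
    and "\<And>f g. f \<in> I \<Longrightarrow> g \<in> carrier (free_algebra S) \<Longrightarrow> g * f \<in> I"
    and "\<And>f g. f \<in> I \<Longrightarrow> g \<in> carrier (free_algebra S) \<Longrightarrow> f * g \<in> I"
  shows "ideal I (free_algebra S :: ('k::field, 'a word \<Rightarrow>\<^sub>0 'k) module)"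
proof (rule idealI)
  interpret ring "free_algebra S :: ('k::field, 'a word \<Rightarrow>\<^sub>0 'k) module" by (rule ring_free_algebra)
  have "- f \<in> I" if "f \<in> I" for f
  proof -
    have "- 1 \<in> carrier (free_algebra S)"
      using free_algebra_uminus_closed[of 1 S] by (simp add: zero_word_def)
    from assms(4)[OF that this] show ?thesis by simp
  qed
  moreover have "\<ominus>\<^bsub>free_algebra S\<^esub> f = - f" if "f \<in> I" for f
    using that assms(1) free_algebra_uminus_closed[of f S]
    by (intro minus_equality) (auto simp del: free_algebra_sel(1))
  ultimately show "subgroup I (add_monoid (free_algebra S :: ('k::field, 'a word \<Rightarrow>\<^sub>0 'k) module))"
    using assms by (intro add.subgroupI) (auto simp: a_inv_def simp del: free_algebra_sel(1))
qed (use assms ring_free_algebra in \<open>auto simp del: free_algebra_sel(1)\<close>)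

lemma normal_form_eq_0_if_mem_skew_ideal:
  assumes "f \<in> skew_ideal q n"
  shows "normal_form q f = 0"
proof -
  let ?J = "{f \<in> carrier (free_algebra {1..n}). normal_form q f = 0}"
  have "skew_ideal q n \<subseteq> ?J"
  proof (rule skew_ideal_minimal)
    show "ideal ?J (free_algebra {1..n})"
      by (rule free_algebra_idealI)
        (auto simp: normal_form_add normal_form_mult intro: free_algebra_add_closed free_algebra_mult_closed
          simp del: free_algebra_sel(1), simp)
    have "normal_form q r = 0" if "r \<in> skew_relators q n" for r
      using that by (auto simp: skew_relators_def skew_relator_eq normal_form_minus normal_form_single
          add_mset_commute)
    then show "skew_relators q n \<subseteq> ?J" using skew_relators_subset by blast
  qed
  with assms show ?thesis by blast
qed

text \<open>
  Moving a letter to its place in a sorted word uses the relation \<open>x\<^sub>j x\<^sub>i = q x\<^sub>i x\<^sub>j\<close> once for each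
  smaller letter of the word.
\<close>

lemma insert_letter_congruence:
  assumes "set (x # xs) \<subseteq> {1..n}" "sorted xs"
  shows "Poly_Mapping.single (Word (x # xs)) c
    - Poly_Mapping.single (Word (insort x xs)) (q ^ length (filter (\<lambda>y. y < x) xs) * c) \<in> skew_ideal q n"
  using assms
proof (induction xs arbitrary: c)
  case Nil
  then show ?case using skew_ideal_closed(5) by simp
next
  case (Cons y ys)
  show ?case
  proof (cases "x \<le> y")
    case True
    with Cons.prems have "filter (\<lambda>z. z < x) (y # ys) = []" by (auto simp: filter_empty_conv)
    with True show ?thesis using skew_ideal_closed(5) by (simp del: filter.simps)
  next
    case False
    let ?w = "\<lambda>xs c. Poly_Mapping.single (Word xs) c"
    let ?d = "q * c" and ?m = "length (filter (\<lambda>z. z < x) ys)"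
    have rel: "?w [x, y] 1 - ?w [y, x] q \<in> skew_ideal q n"
      unfolding skew_ideal_def
      by (rule subsetD[OF ring.genideal_self[OF ring_free_algebra skew_relators_subset]])
        (use False Cons.prems in \<open>force simp: skew_relators_def skew_relator_eq\<close>)
    \<comment> \<open>Swap the first two letters, then insert \<open>x\<close> into the tail.\<close>
    have "(?w [x, y] 1 - ?w [y, x] q) * ?w ys c \<in> skew_ideal q n"
      using Cons.prems by (intro skew_ideal_closed(4) rel) auto
    moreover have "?w [y] 1 * (?w (x # ys) ?d - ?w (insort x ys) (q ^ ?m * ?d)) \<in> skew_ideal q n"
      using Cons.prems by (intro skew_ideal_closed(3) Cons.IH) auto
    ultimately have "(?w [x, y] 1 - ?w [y, x] q) * ?w ys c
        + ?w [y] 1 * (?w (x # ys) ?d - ?w (insort x ys) (q ^ ?m * ?d)) \<in> skew_ideal q n"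
      by (rule skew_ideal_closed(2))
    then show ?thesis
      using False by (simp add: algebra_simps mult_single plus_word_def)
  qed
qed

lemma sort_word_congruence:
  assumes "set xs \<subseteq> {1..n}"
  shows "Poly_Mapping.single (Word xs) c
    - Poly_Mapping.single (Word (sort xs)) (q ^ inversions xs * c) \<in> skew_ideal q n"
  using assms
proof (induction xs)
  case Nil
  then show ?case using skew_ideal_closed(5) by simp
next
  case (Cons x xs)
  let ?w = "\<lambda>xs c. Poly_Mapping.single (Word xs) c"
  let ?d = "q ^ inversions xs * c"
  have len: "length (filter (\<lambda>y. y < x) (sort xs)) = length (filter (\<lambda>y. y < x) xs)"
    by (simp flip: size_mset add: mset_filter)
  have "?w [x] 1 * (?w xs c - ?w (sort xs) ?d) \<in> skew_ideal q n"
    using Cons by (intro skew_ideal_closed(3) Cons.IH) auto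
  moreover have "?w (x # sort xs) ?d - ?w (insort x (sort xs))
      (q ^ length (filter (\<lambda>y. y < x) (sort xs)) * ?d) \<in> skew_ideal q n"
    using Cons.prems by (intro insert_letter_congruence) auto
  ultimately have "?w [x] 1 * (?w xs c - ?w (sort xs) ?d) + (?w (x # sort xs) ?d - ?w (insort x (sort xs))
      (q ^ length (filter (\<lambda>y. y < x) (sort xs)) * ?d)) \<in> skew_ideal q n"
    by (rule skew_ideal_closed(2))
  then show ?case
    unfolding len by (simp add: algebra_simps mult_single plus_word_def power_add)
qed

text \<open>
  The ordered monomials span the quotient: insertion sort works modulo the defining ideal.
\<close>

lemma normal_form_congruence:
  assumes "f \<in> carrier (free_algebra {1..n})"
  shows "f - sorted_rep (normal_form q f) \<in> skew_ideal q n"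
proof -
  from assms have "Poly_Mapping.keys f \<subseteq> {w. set (letters w) \<subseteq> {1..n}}" by auto
  then show ?thesis
  proof (induction f rule: poly_mapping_induct_keys)
    case (single w c)
    then show ?case
      using sort_word_congruence[of "letters w" n c q]
      by (simp add: normal_form_single sorted_rep_single)
  next
    case (add f g)
    from skew_ideal_closed(2)[OF add(3,4)] show ?case
      by (simp add: normal_form_add sorted_rep_add algebra_simps)
  qed (simp add: skew_ideal_closed(5))
qed

text \<open>
  The ordered monomials are also independent in the quotient, since the normal form is multiplicative
  and kills the relators, hence vanishes on the whole ideal.
\<close>

lemma mem_skew_ideal_iff:
  "f \<in> skew_ideal q n \<longleftrightarrow> f \<in> carrier (free_algebra {1..n}) \<and> normal_form q f = 0"
  using normal_form_congruence[of f n q] normal_form_eq_0_if_mem_skew_ideal[of f q n]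
    skew_ideal_closed(1)[of f q n] by (auto simp del: free_algebra_sel(1))

(* Keeps the first index in {1..n}, and the Veronese degree 1 of the whole algebra, from becoming Suc 0. *)
declare One_nat_def [simp del]

section \<open>Monomial bases of skew polynomial algebras and of their Veronese subrings\<close>

lemma skew_class_def': "skew_class q n f = (\<lambda>h. h + f) ` skew_ideal q n"
  by (auto simp: skew_class_def a_r_coset_def')

lemma skew_class_eq_iff:
  assumes "f \<in> carrier (free_algebra {1..n})" "g \<in> carrier (free_algebra {1..n})"
  shows "skew_class q n f = skew_class q n g \<longleftrightarrow> normal_form q f = normal_form q g"
proof
  assume "skew_class q n f = skew_class q n g"
  moreover have "f \<in> skew_class q n f"
    using skew_ideal_closed(5) by (force simp: skew_class_def')
  ultimately obtain h where "h \<in> skew_ideal q n" "f = h + g"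
    by (auto simp: skew_class_def')
  then show "normal_form q f = normal_form q g"
    by (simp add: mem_skew_ideal_iff normal_form_add)
next
  have sub: "skew_class q n f \<subseteq> skew_class q n g"
    if "f \<in> carrier (free_algebra {1..n})" "g \<in> carrier (free_algebra {1..n})"
      "normal_form q f = normal_form q g" for f g
  proof
    fix x assume "x \<in> skew_class q n f"
    then obtain h where h: "h \<in> skew_ideal q n" "x = h + f" by (auto simp: skew_class_def')
    have "f + - g \<in> carrier (free_algebra {1..n})"
      by (intro free_algebra_add_closed free_algebra_uminus_closed that)
    then have "f - g \<in> skew_ideal q n"
      using that by (simp add: mem_skew_ideal_iff normal_form_minus)
    from skew_ideal_closed(2)[OF h(1) this] show "x \<in> skew_class q n g"
      using h(2) by (force simp: skew_class_def' intro!: image_eqI[of _ _ "h + (f - g)"])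
  qed
  assume "normal_form q f = normal_form q g"
  then show "skew_class q n f = skew_class q n g"
    using assms by (intro equalityI sub) auto
qed

lemma skew_poly_sel:
  "carrier (skew_poly q n) = skew_class q n ` carrier (free_algebra {1..n})"
  "\<one>\<^bsub>skew_poly q n\<^esub> = skew_class q n 1"
  "\<zero>\<^bsub>skew_poly q n\<^esub> = skew_class q n 0"
  "f \<in> carrier (free_algebra {1..n}) \<Longrightarrow> g \<in> carrier (free_algebra {1..n}) \<Longrightarrow>
     skew_class q n f \<otimes>\<^bsub>skew_poly q n\<^esub> skew_class q n g = skew_class q n (f * g)"
  "f \<in> carrier (free_algebra {1..n}) \<Longrightarrow> g \<in> carrier (free_algebra {1..n}) \<Longrightarrow>
     skew_class q n f \<oplus>\<^bsub>skew_poly q n\<^esub> skew_class q n g = skew_class q n (f + g)"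
proof -
  interpret ideal "skew_ideal q n" "free_algebra {1..n}" by (rule ideal_skew_ideal)
  note hom = rcos_ring_hom
  show "carrier (skew_poly q n) = skew_class q n ` carrier (free_algebra {1..n})"
    by (auto simp: skew_poly_def quotient_algebra_def FactRing_def A_RCOSETS_def' skew_class_def)
  show "\<one>\<^bsub>skew_poly q n\<^esub> = skew_class q n 1"
    using ring_hom_one[OF hom] by (simp add: skew_poly_def quotient_algebra_def skew_class_def)
  show "\<zero>\<^bsub>skew_poly q n\<^esub> = skew_class q n 0"
    by (simp add: skew_poly_def quotient_algebra_def skew_class_def' FactRing_def)
  show "skew_class q n f \<otimes>\<^bsub>skew_poly q n\<^esub> skew_class q n g = skew_class q n (f * g)"
    if "f \<in> carrier (free_algebra {1..n})" "g \<in> carrier (free_algebra {1..n})"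
    using ring_hom_mult[OF hom that] by (simp add: skew_poly_def quotient_algebra_def skew_class_def)
  show "skew_class q n f \<oplus>\<^bsub>skew_poly q n\<^esub> skew_class q n g = skew_class q n (f + g)"
    if "f \<in> carrier (free_algebra {1..n})" "g \<in> carrier (free_algebra {1..n})"
    using ring_hom_add[OF hom that] by (simp add: skew_poly_def quotient_algebra_def skew_class_def)
qed

lemma skew_poly_smult:
  assumes "f \<in> carrier (free_algebra {1..n})"
  shows "c \<odot>\<^bsub>skew_poly q n\<^esub> skew_class q n f = skew_class q n (scalar c * f)"
proof -
  have sc: "scalar c \<in> carrier (free_algebra {1..n})"
    by (simp add: scalar_def zero_word_def)
  have "skew_class q n (scalar c * g) = skew_class q n (scalar c * f)" if "g \<in> skew_class q n f" for g
  proof -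
    from that obtain h where h: "h \<in> skew_ideal q n" "g = h + f" by (auto simp: skew_class_def')
    then have "normal_form q g = normal_form q f" "g \<in> carrier (free_algebra {1..n})"
      using free_algebra_add_closed[OF _ assms] by (auto simp: mem_skew_ideal_iff normal_form_add)
    then show ?thesis
      using assms sc by (subst skew_class_eq_iff) (simp_all add: free_algebra_mult_closed normal_form_mult
          del: free_algebra_sel(1))
  qed
  moreover have "f \<in> skew_class q n f"
    using skew_ideal_closed(5) by (force simp: skew_class_def')
  moreover have "c \<odot>\<^bsub>skew_poly q n\<^esub> Y = (\<Union>g\<in>Y. skew_class q n (scalar c * g))" for Y
    by (simp add: skew_poly_def quotient_algebra_def skew_class_def)
  ultimately show ?thesis by blast
qed

text \<open>
  The exponents of the monomials in the \<open>v\<close>th Veronese subring; \<open>v = 1\<close> gives the whole algebra.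
\<close>

definition veronese_exponents :: "nat \<Rightarrow> nat \<Rightarrow> nat multiset set" where
  "veronese_exponents n v = {M. set_mset M \<subseteq> {1..n} \<and> v dvd size M}"

definition veronese_span :: "nat \<Rightarrow> nat \<Rightarrow> (nat multiset \<Rightarrow>\<^sub>0 'k::comm_ring_1) set" where
  "veronese_span n v = {p. Poly_Mapping.keys p \<subseteq> veronese_exponents n v}"

text \<open>
  The element with given coordinates with respect to the basis of ordered monomials.
\<close>

definition skew_elem :: "'k::field \<Rightarrow> nat \<Rightarrow> (nat multiset \<Rightarrow>\<^sub>0 'k) \<Rightarrow> (nat word \<Rightarrow>\<^sub>0 'k) set" where
  "skew_elem q n p = skew_class q n (sorted_rep p)"

lemma veronese_exponents_add: "M \<in> veronese_exponents n v \<Longrightarrow> N \<in> veronese_exponents n v \<Longrightarrow> M + N \<in> veronese_exponents n v"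
  by (auto simp: veronese_exponents_def)

lemma veronese_exponents_empty [simp]: "{#} \<in> veronese_exponents n v"
  by (simp add: veronese_exponents_def)

lemma veronese_exponents_subset: "veronese_exponents n v \<subseteq> veronese_exponents n 1"
  by (auto simp: veronese_exponents_def)

lemma veronese_span_subset: "veronese_span n v \<subseteq> veronese_span n 1"
  using veronese_exponents_subset by (auto simp: veronese_span_def)

lemma veronese_span_add: "p \<in> veronese_span n v \<Longrightarrow> p' \<in> veronese_span n v \<Longrightarrow> p + p' \<in> veronese_span n v"
  using Poly_Mapping.keys_add[of p p'] by (auto simp: veronese_span_def)

lemma veronese_span_zero [simp]: "0 \<in> veronese_span n v"
  by (simp add: veronese_span_def)

lemma veronese_span_single: "M \<in> veronese_exponents n v \<Longrightarrow> Poly_Mapping.single M a \<in> veronese_span n v"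
  by (simp add: veronese_span_def)

lemma veronese_span_sum: "(\<And>i. i \<in> I \<Longrightarrow> p i \<in> veronese_span n v) \<Longrightarrow> sum p I \<in> veronese_span n v"
  by (induction I rule: infinite_finite_induct) (auto simp: veronese_span_add)

lemma veronese_span_qmul: "p \<in> veronese_span n v \<Longrightarrow> p' \<in> veronese_span n v \<Longrightarrow> qmul q p p' \<in> veronese_span n v"
  unfolding qmul_def
  by (intro veronese_span_sum veronese_span_single veronese_exponents_add) (auto simp: veronese_span_def)

lemma sorted_rep_closed:
  "p \<in> veronese_span n 1 \<Longrightarrow> sorted_rep p \<in> carrier (free_algebra {1..n})"
  unfolding sorted_rep_def
  using keys_sum[of "\<lambda>M. Poly_Mapping.single (Word (sorted_list_of_multiset M)) (Poly_Mapping.lookup p M)"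
     "Poly_Mapping.keys p"]
  by (fastforce simp: veronese_span_def veronese_exponents_def)

lemma normal_form_closed:
  assumes "f \<in> carrier (free_algebra {1..n})"
  shows "normal_form q f \<in> veronese_span n 1"
  unfolding normal_form_def
  by (intro veronese_span_sum veronese_span_single) (use assms in \<open>auto simp: veronese_exponents_def\<close>)

lemma skew_class_conv_elem:
  assumes "f \<in> carrier (free_algebra {1..n})"
  shows "skew_class q n f = skew_elem q n (normal_form q f)"
  unfolding skew_elem_def
  by (subst skew_class_eq_iff) (use assms in \<open>auto intro!: sorted_rep_closed normal_form_closed simp del: free_algebra_sel(1)\<close>)

lemma bij_betw_skew_elem: "bij_betw (skew_elem q n) (veronese_span n 1) (carrier (skew_poly q n))"
proof (rule bij_betwI')
  fix p p' :: "nat multiset \<Rightarrow>\<^sub>0 'a" assume "p \<in> veronese_span n 1" "p' \<in> veronese_span n 1"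
  then show "skew_elem q n p = skew_elem q n p' \<longleftrightarrow> p = p'"
    unfolding skew_elem_def by (subst skew_class_eq_iff) (simp_all add: sorted_rep_closed del: free_algebra_sel(1))
next
  fix p :: "nat multiset \<Rightarrow>\<^sub>0 'a" assume "p \<in> veronese_span n 1"
  then show "skew_elem q n p \<in> carrier (skew_poly q n)"
    by (auto simp: skew_elem_def skew_poly_sel(1) sorted_rep_closed simp del: free_algebra_sel(1))
next
  fix y assume "y \<in> carrier (skew_poly q n)"
  then show "\<exists>p\<in>veronese_span n 1. y = skew_elem q n p"
    by (auto simp: skew_poly_sel(1) skew_class_conv_elem intro: normal_form_closed simp del: free_algebra_sel(1))
qed

lemma skew_elem_add:
  assumes "p \<in> veronese_span n 1" "p' \<in> veronese_span n 1"
  shows "skew_elem q n p \<oplus>\<^bsub>skew_poly q n\<^esub> skew_elem q n p' = skew_elem q n (p + p')"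
  using assms by (simp add: skew_elem_def skew_poly_sel sorted_rep_closed sorted_rep_add del: free_algebra_sel(1))

lemma skew_elem_mult:
  assumes "p \<in> veronese_span n 1" "p' \<in> veronese_span n 1"
  shows "skew_elem q n p \<otimes>\<^bsub>skew_poly q n\<^esub> skew_elem q n p' = skew_elem q n (qmul q p p')"
proof -
  have "skew_elem q n p \<otimes>\<^bsub>skew_poly q n\<^esub> skew_elem q n p' = skew_class q n (sorted_rep p * sorted_rep p')"
    unfolding skew_elem_def by (intro skew_poly_sel(4) sorted_rep_closed assms)
  also have "\<dots> = skew_elem q n (normal_form q (sorted_rep p * sorted_rep p'))"
    by (intro skew_class_conv_elem free_algebra_mult_closed sorted_rep_closed assms)
  finally show ?thesis by (simp add: normal_form_mult)
qed

lemma skew_elem_one: "\<one>\<^bsub>skew_poly q n\<^esub> = skew_elem q n (Poly_Mapping.single {#} 1)"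
proof -
  have "sorted_rep (Poly_Mapping.single {#} 1) = (1 :: nat word \<Rightarrow>\<^sub>0 'a)"
    unfolding sorted_rep_single by (simp flip: zero_word_def)
  then show ?thesis by (simp add: skew_poly_sel skew_elem_def)
qed

lemma skew_elem_zero: "\<zero>\<^bsub>skew_poly q n\<^esub> = skew_elem q n 0"
  by (simp add: skew_poly_sel skew_elem_def)

lemma skew_elem_smult:
  assumes "p \<in> veronese_span n 1"
  shows "c \<odot>\<^bsub>skew_poly q n\<^esub> skew_elem q n p = skew_elem q n (qmul q (Poly_Mapping.single {#} c) p)"
proof -
  have sc: "scalar c \<in> carrier (free_algebra {1..n})"
    by (simp add: scalar_def zero_word_def)
  have nf: "normal_form q (scalar c) = Poly_Mapping.single {#} c"
    by (simp add: scalar_def zero_word_def normal_form_single)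
  have "c \<odot>\<^bsub>skew_poly q n\<^esub> skew_elem q n p = skew_class q n (scalar c * sorted_rep p)"
    unfolding skew_elem_def by (intro skew_poly_smult sorted_rep_closed assms)
  also have "\<dots> = skew_elem q n (normal_form q (scalar c * sorted_rep p))"
    by (intro skew_class_conv_elem free_algebra_mult_closed sorted_rep_closed assms sc)
  finally show ?thesis by (simp add: normal_form_mult nf)
qed

lemma skew_gen_eq:
  assumes "i \<in> {1..n}"
  shows "skew_gen q n i = skew_elem q n (Poly_Mapping.single {#i#} 1)"
  using assms by (simp add: skew_gen_def skew_class_conv_elem indet_def normal_form_single)

lemma skew_gen_pow:
  assumes "i \<in> {1..n}"
  shows "skew_gen q n i [^]\<^bsub>skew_poly q n\<^esub> k = skew_elem q n (Poly_Mapping.single (replicate_mset k i) 1)"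
proof (induction k)
  case 0
  have "skew_gen q n i [^]\<^bsub>skew_poly q n\<^esub> (0::nat) = \<one>\<^bsub>skew_poly q n\<^esub>"
    by (simp add: nat_pow_def)
  then show ?case by (simp add: skew_elem_one)
next
  case (Suc k)
  have "skew_gen q n i [^]\<^bsub>skew_poly q n\<^esub> Suc k
      = (skew_gen q n i [^]\<^bsub>skew_poly q n\<^esub> k) \<otimes>\<^bsub>skew_poly q n\<^esub> skew_gen q n i"
    by (simp add: nat_pow_def)
  also have "\<dots> = skew_elem q n (qmul q (Poly_Mapping.single (replicate_mset k i) 1) (Poly_Mapping.single {#i#} 1))"
    unfolding Suc unfolding skew_gen_eq[OF assms]
    by (intro skew_elem_mult veronese_span_single) (use assms in \<open>auto simp: veronese_exponents_def\<close>)
  also have "crossings (replicate_mset k i) {#i#} = 0" by (simp add: crossings_def)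
  then have "qmul q (Poly_Mapping.single (replicate_mset k i) 1) (Poly_Mapping.single {#i#} 1)
      = Poly_Mapping.single (replicate_mset (Suc k) i) 1"
    by (simp add: qmul_single)
  finally show ?case .
qed

definition exponent_mset :: "nat \<Rightarrow> (nat \<Rightarrow> nat) \<Rightarrow> nat multiset" where
  "exponent_mset n s = (\<Sum>i=1..n. replicate_mset (s i) i)"

lemma count_exponent_mset: "count (exponent_mset n s) i = (if i \<in> {1..n} then s i else 0)"
  by (simp add: exponent_mset_def count_sum)

lemma size_exponent_mset: "size (exponent_mset n s) = (\<Sum>i=1..n. s i)"
  by (simp add: exponent_mset_def size_multiset_sum)

lemma exponent_mset_count: "set_mset M \<subseteq> {1..n} \<Longrightarrow> exponent_mset n (count M) = M"
  by (rule multiset_eqI) (auto simp: count_exponent_mset not_in_iff)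

lemma set_exponent_mset: "set_mset (exponent_mset n s) \<subseteq> {1..n}"
  by (auto simp: count_exponent_mset simp flip: count_greater_zero_iff split: if_splits)

lemma skew_monomial_eq: "skew_monomial q n s = skew_elem q n (Poly_Mapping.single (exponent_mset n s) 1)"
proof -
  define xs where "xs = [1..<Suc n]"
  have "set xs \<subseteq> {1..n}" "sorted_wrt (<) xs" by (auto simp: xs_def simp del: upt_Suc)
  then have "foldr (\<lambda>i y. (skew_gen q n i [^]\<^bsub>skew_poly q n\<^esub> s i) \<otimes>\<^bsub>skew_poly q n\<^esub> y) xs \<one>\<^bsub>skew_poly q n\<^esub>
     = skew_elem q n (Poly_Mapping.single (\<Sum>i\<in>set xs. replicate_mset (s i) i) 1)"
  proof (induction xs)
    case (Cons i xs)
    let ?N = "\<Sum>i\<in>set xs. replicate_mset (s i) i"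
    have N: "i < j" if "j \<in># ?N" for j
      using Cons.prems that by (auto simp: set_mset_sum split: if_splits)
    have c: "crossings (replicate_mset (s i) i) ?N = 0"
      by (auto simp: crossings_def dest: N)
    have "foldr (\<lambda>i y. (skew_gen q n i [^]\<^bsub>skew_poly q n\<^esub> s i) \<otimes>\<^bsub>skew_poly q n\<^esub> y) (i # xs) \<one>\<^bsub>skew_poly q n\<^esub>
      = skew_elem q n (Poly_Mapping.single (replicate_mset (s i) i) 1) \<otimes>\<^bsub>skew_poly q n\<^esub>
        skew_elem q n (Poly_Mapping.single ?N 1)"
      using Cons skew_gen_pow[of i n q "s i"] by simp
    also have "\<dots> = skew_elem q n (qmul q (Poly_Mapping.single (replicate_mset (s i) i) 1) (Poly_Mapping.single ?N 1))"
      by (intro skew_elem_mult veronese_span_single)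
        (use Cons.prems in \<open>auto simp: veronese_exponents_def set_mset_sum split: if_splits\<close>)
    also have "\<dots> = skew_elem q n (Poly_Mapping.single (\<Sum>i\<in>set (i # xs). replicate_mset (s i) i) 1)"
      using Cons.prems by (auto simp: qmul_single c)
    finally show ?case .
  qed (simp add: skew_elem_one)
  moreover have "set xs = {1..n}" by (auto simp: xs_def)
  ultimately show ?thesis
    by (simp add: skew_monomial_def exponent_mset_def xs_def)
qed

lemma abelian_monoid_skew_poly: "abelian_monoid (skew_poly q n)"
proof -
  interpret ideal "skew_ideal q n" "free_algebra {1..n}" by (rule ideal_skew_ideal)
  interpret Q: ring "free_algebra {1..n} Quot skew_ideal q n" by (rule quotient_is_ring)
  have eqs: "carrier (skew_poly q n) = carrier (free_algebra {1..n} Quot skew_ideal q n)"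
    "ring.add (skew_poly q n) = ring.add (free_algebra {1..n} Quot skew_ideal q n)"
    "\<zero>\<^bsub>skew_poly q n\<^esub> = \<zero>\<^bsub>free_algebra {1..n} Quot skew_ideal q n\<^esub>"
    by (simp_all add: skew_poly_def quotient_algebra_def)
  show ?thesis
    by (rule abelian_monoidI; unfold eqs; rule Q.a_closed Q.zero_closed Q.a_assoc Q.l_zero Q.a_comm; assumption)
qed

lemma skew_elem_finsum:
  assumes "\<And>i. i \<in> I \<Longrightarrow> p i \<in> veronese_span n 1" "finite I"
  shows "(\<Oplus>\<^bsub>skew_poly q n\<^esub>i\<in>I. skew_elem q n (p i)) = skew_elem q n (\<Sum>i\<in>I. p i)"
  using assms(2,1)
proof (induction I rule: finite_induct)
  case empty
  show ?case
    unfolding abelian_monoid.finsum_empty[OF abelian_monoid_skew_poly] skew_elem_zero sum.empty ..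
next
  case (insert i I)
  have carrier: "skew_elem q n (p j) \<in> carrier (skew_poly q n)" if "j \<in> insert i I" for j
    using insert.prems that bij_betw_apply[OF bij_betw_skew_elem] by blast
  have "(\<Oplus>\<^bsub>skew_poly q n\<^esub>j\<in>insert i I. skew_elem q n (p j))
    = skew_elem q n (p i) \<oplus>\<^bsub>skew_poly q n\<^esub> (\<Oplus>\<^bsub>skew_poly q n\<^esub>j\<in>I. skew_elem q n (p j))"
    by (rule abelian_monoid.finsum_insert[OF abelian_monoid_skew_poly insert.hyps]) (use carrier in auto)
  also have "\<dots> = skew_elem q n (p i) \<oplus>\<^bsub>skew_poly q n\<^esub> skew_elem q n (\<Sum>j\<in>I. p j)"
    using insert by simp
  also have "\<dots> = skew_elem q n (p i + (\<Sum>j\<in>I. p j))"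
    by (intro skew_elem_add veronese_span_sum insert.prems) auto
  finally show ?case using insert.hyps by simp
qed

lemma skew_grade_eq:
  "skew_grade q n d = skew_elem q n ` {p \<in> veronese_span n 1. \<forall>M\<in>Poly_Mapping.keys p. size M = d}"
proof (intro equalityI subsetI)
  fix y assume "y \<in> skew_grade q n d"
  then obtain f where f: "y = skew_class q n f" "f \<in> carrier (free_algebra {1..n})"
      "\<forall>w\<in>Poly_Mapping.keys f. length (letters w) = d"
    by (auto simp: skew_grade_def simp del: free_algebra_sel(1))
  have "Poly_Mapping.keys (normal_form q f) \<subseteq> {M. size M = d}"
    unfolding normal_form_def using f(3)
    by (intro order_trans[OF keys_sum]) auto
  then show "y \<in> skew_elem q n ` {p \<in> veronese_span n 1. \<forall>M\<in>Poly_Mapping.keys p. size M = d}"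
    using normal_form_closed[OF f(2)] unfolding f(1) skew_class_conv_elem[OF f(2)]
    by (intro imageI) blast
next
  fix y assume "y \<in> skew_elem q n ` {p \<in> veronese_span n 1. \<forall>M\<in>Poly_Mapping.keys p. size M = d}"
  then obtain p where p: "y = skew_elem q n p" "p \<in> veronese_span n 1" "\<forall>M\<in>Poly_Mapping.keys p. size M = d"
    by blast
  have "Poly_Mapping.keys (sorted_rep p) \<subseteq> {w. length (letters w) = d}"
  proof -
    have "length (sorted_list_of_multiset M) = size M" for M :: "nat multiset"
      by (metis mset_sorted_list_of_multiset size_mset)
    then show ?thesis
      unfolding sorted_rep_def using p(3)
      by (intro order_trans[OF keys_sum]) auto
  qed
  then show "y \<in> skew_grade q n d"
    using sorted_rep_closed[OF p(2)] p(1) by (auto simp: skew_grade_def skew_elem_def simp del: free_algebra_sel(1))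
qed

lemma skew_veronese_sel:
  "monoid.mult (skew_veronese q n v) = monoid.mult (skew_poly q n)"
  "\<one>\<^bsub>skew_veronese q n v\<^esub> = \<one>\<^bsub>skew_poly q n\<^esub>"
  "ring.add (skew_veronese q n v) = ring.add (skew_poly q n)"
  "module.smult (skew_veronese q n v) = module.smult (skew_poly q n)"
  by (simp_all add: skew_veronese_def veronese_def)

text \<open>
  Elements of the Veronese subring are finite sums of homogeneous ones. Conversely, a combination of
  monomials of degrees divisible by \<open>v\<close> is the sum of its homogeneous parts, and no part beyond the
  sum of all degrees is needed.
\<close>

lemma carrier_skew_veronese:
  assumes "v > 0"
  shows "carrier (skew_veronese q n v) = skew_elem q n ` veronese_span n v"
proof (intro equalityI subsetI)
  fix y assume "y \<in> carrier (skew_veronese q n v)"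
  then obtain m c where y: "y = (\<Oplus>\<^bsub>skew_poly q n\<^esub>i\<in>{..m}. c i)" and c: "\<And>i. c i \<in> skew_grade q n (v * i)"
    by (auto simp: skew_veronese_def veronese_def)
  have "\<exists>p. c i = skew_elem q n p \<and> p \<in> veronese_span n 1 \<and> (\<forall>M\<in>Poly_Mapping.keys p. size M = v * i)" for i
    using c[of i] by (auto simp: skew_grade_eq)
  then obtain p where p: "\<And>i. c i = skew_elem q n (p i)" "\<And>i. p i \<in> veronese_span n 1"
    "\<And>i M. M \<in> Poly_Mapping.keys (p i) \<Longrightarrow> size M = v * i" by metis
  have "p i \<in> veronese_span n v" for i
    using p(2)[of i] p(3)[of _ i] by (auto simp: veronese_span_def veronese_exponents_def)
  then have "(\<Sum>i\<in>{..m}. p i) \<in> veronese_span n v" by (rule veronese_span_sum)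
  moreover have "y = skew_elem q n (\<Sum>i\<in>{..m}. p i)"
    unfolding y p(1) using p(2) by (intro skew_elem_finsum) auto
  ultimately show "y \<in> skew_elem q n ` veronese_span n v" by blast
next
  fix y assume "y \<in> skew_elem q n ` veronese_span n v"
  then obtain p where y: "y = skew_elem q n p" and p: "p \<in> veronese_span n v" by blast
  define part where "part = (\<lambda>i. \<Sum>M\<in>{M\<in>Poly_Mapping.keys p. size M = v * i}.
      Poly_Mapping.single M (Poly_Mapping.lookup p M))"
  define m where "m = (\<Sum>M\<in>Poly_Mapping.keys p. size M)"
  have keys_part: "Poly_Mapping.keys (part i) \<subseteq> {M\<in>Poly_Mapping.keys p. size M = v * i}" for i
    unfolding part_def by (rule order_trans[OF keys_sum]) (auto split: if_splits)
  have span: "part i \<in> veronese_span n 1" for i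
    using keys_part[of i] p veronese_exponents_subset by (fastforce simp: veronese_span_def)
  have "(\<Sum>i\<le>m. part i) = (\<Sum>M\<in>Poly_Mapping.keys p. Poly_Mapping.single M (Poly_Mapping.lookup p M))"
  proof -
    have le: "size M div v \<le> m" if "M \<in> Poly_Mapping.keys p" for M
    proof -
      have "size M \<le> m"
        unfolding m_def by (rule member_le_sum) (use that in auto)
      then show ?thesis using div_le_dividend le_trans by blast
    qed
    have "size M = v * i \<longleftrightarrow> size M div v = i" if "M \<in> Poly_Mapping.keys p" for M i
      using that p \<open>v > 0\<close> by (auto simp: veronese_span_def veronese_exponents_def)
    then have "part i = (\<Sum>M\<in>{M\<in>Poly_Mapping.keys p. size M div v = i}.
      Poly_Mapping.single M (Poly_Mapping.lookup p M))" for i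
      unfolding part_def by (intro sum.cong) auto
    then show ?thesis
      by (simp only:) (rule sum.group, use le in auto)
  qed
  also have "\<dots> = p"
    by (rule poly_mapping_sum_singles)
  finally have "y = (\<Oplus>\<^bsub>skew_poly q n\<^esub>i\<in>{..m}. skew_elem q n (part i))"
    using span by (subst skew_elem_finsum) (auto simp: y)
  moreover have "skew_elem q n (part i) \<in> skew_grade q n (v * i)" for i
    using span[of i] keys_part[of i] by (auto simp: skew_grade_eq)
  moreover have "carrier (skew_veronese q n v) =
      {(\<Oplus>\<^bsub>skew_poly q n\<^esub>i\<in>{..m}. c i) | m c. \<forall>i. c i \<in> skew_grade q n (v * i)}"
    by (simp add: skew_veronese_def veronese_def)
  ultimately show "y \<in> carrier (skew_veronese q n v)"
    by blast
qed

lemma skew_veronese_1: "skew_veronese q n 1 = skew_poly q n"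
proof -
  obtain S where S: "skew_veronese q n 1 = (skew_poly q n)\<lparr>carrier := S\<rparr>"
    unfolding skew_veronese_def veronese_def by blast
  have "carrier (skew_veronese q n 1) = carrier (skew_poly q n)"
    by (metis carrier_skew_veronese bij_betw_imp_surj_on bij_betw_skew_elem zero_less_one)
  then have "S = carrier (skew_poly q n)"
    unfolding S by simp
  then show ?thesis
    unfolding S by simp
qed

section \<open>Largest and smallest monomials of a product\<close>

lemma keys_qmul: "Poly_Mapping.keys (qmul q f g) \<subseteq> {M + N | M N. M \<in> Poly_Mapping.keys f \<and> N \<in> Poly_Mapping.keys g}"
proof -
  have "Poly_Mapping.keys (qmul q f g) \<subseteq> (\<Union>M\<in>Poly_Mapping.keys f. \<Union>N\<in>Poly_Mapping.keys g. {M + N})"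
    unfolding qmul_def
    by (intro order_trans[OF keys_sum] UN_mono order_refl) auto
  then show ?thesis by blast
qed

text \<open>
  If \<open>A + B\<close> arises in only one way as a sum of exponents from the two factors, no cancellation can
  occur at \<open>x\<^sup>A\<^sup>+\<^sup>B\<close>.
\<close>

lemma lookup_qmul_unique:
  assumes A: "A \<in> Poly_Mapping.keys f" and B: "B \<in> Poly_Mapping.keys g"
    and "\<And>M N. M \<in> Poly_Mapping.keys f \<Longrightarrow> N \<in> Poly_Mapping.keys g \<Longrightarrow> M + N = A + B \<Longrightarrow> M = A \<and> N = B"
  shows "Poly_Mapping.lookup (qmul q f g) (A + B) =
    q ^ crossings A B * Poly_Mapping.lookup f A * Poly_Mapping.lookup g B"
proof -
  let ?t = "\<lambda>M N. q ^ crossings M N * Poly_Mapping.lookup f M * Poly_Mapping.lookup g N"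
  have "Poly_Mapping.lookup (qmul q f g) (A + B) = (\<Sum>M\<in>Poly_Mapping.keys f. \<Sum>N\<in>Poly_Mapping.keys g.
      if M + N = A + B then ?t M N else 0)"
    by (simp add: qmul_def lookup_sum lookup_single when_def)
  also have "\<dots> = (\<Sum>M\<in>Poly_Mapping.keys f. \<Sum>N\<in>Poly_Mapping.keys g.
      if N = B then (if M = A then ?t M N else 0) else 0)"
    using assms(3) by (intro sum.cong refl) auto
  also have "\<dots> = ?t A B"
    using A B by simp
  finally show ?thesis .
qed

lemma lookup_qmul_single_right:
  "Poly_Mapping.lookup (qmul q f (Poly_Mapping.single B b)) (A + B) = q ^ crossings A B * Poly_Mapping.lookup f A * b"
  by (auto simp: qmul_def lookup_sum lookup_single when_def in_keys_iff)

lemma lookup_qmul_single_left: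
  "Poly_Mapping.lookup (qmul q (Poly_Mapping.single A a) g) (A + B) = q ^ crossings A B * a * Poly_Mapping.lookup g B"
  by (auto simp: qmul_def lookup_sum lookup_single when_def in_keys_iff)

lemma keys_scale [simp]:
  "(c :: 'k::field) \<noteq> 0 \<Longrightarrow> Poly_Mapping.keys (qmul q (Poly_Mapping.single {#} c) f) = Poly_Mapping.keys f"
  using lookup_qmul_single_left[of q "{#}" c f] by (auto simp: in_keys_iff)

text \<open>
  The multiset order is total and compatible with addition, so the largest exponents of two factors
  add up to the largest exponent of the product, and likewise for the smallest ones. This plays the
  role of the Newton polytope.
\<close>

lemma
  fixes f g :: "nat multiset \<Rightarrow>\<^sub>0 'k::field"
  assumes "f \<noteq> 0" "g \<noteq> 0" "q \<noteq> 0"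
  shows qmul_nonzero: "qmul q f g \<noteq> 0"
    and Max_keys_qmul: "Max (Poly_Mapping.keys (qmul q f g)) = Max (Poly_Mapping.keys f) + Max (Poly_Mapping.keys g)"
    and Min_keys_qmul: "Min (Poly_Mapping.keys (qmul q f g)) = Min (Poly_Mapping.keys f) + Min (Poly_Mapping.keys g)"
proof -
  let ?K = Poly_Mapping.keys
  have ne: "?K f \<noteq> {}" "?K g \<noteq> {}" using assms by simp_all
  \<comment> \<open>The extreme exponents of the factors are the only pair with their sum.\<close>
  have eqI: "M = A \<and> N = B" if "M \<le> A" "N \<le> B" "M + N = A + B" for M N A B :: "nat multiset"
    using that by (metis add_less_le_mono add_le_less_mono order_le_imp_less_or_eq less_irrefl)
  have mx: "Max (?K f) + Max (?K g) \<in> ?K (qmul q f g)"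
  proof -
    have "Poly_Mapping.lookup (qmul q f g) (Max (?K f) + Max (?K g)) \<noteq> 0"
      by (subst lookup_qmul_unique) (use assms ne Max_in[OF finite_keys ne(1)] Max_in[OF finite_keys ne(2)]
        in \<open>auto intro: eqI simp flip: in_keys_iff dest!: eqI[rotated 2]\<close>)
    then show ?thesis by (simp add: in_keys_iff)
  qed
  have mn: "Min (?K f) + Min (?K g) \<in> ?K (qmul q f g)"
  proof -
    have "Poly_Mapping.lookup (qmul q f g) (Min (?K f) + Min (?K g)) \<noteq> 0"
      by (subst lookup_qmul_unique) (use assms ne Min_in[OF finite_keys ne(1)] Min_in[OF finite_keys ne(2)]
        in \<open>auto simp flip: in_keys_iff dest!: eqI[OF _ _ sym, rotated 2]\<close>)
    then show ?thesis by (simp add: in_keys_iff)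
  qed
  show "qmul q f g \<noteq> 0" using mx by auto
  show "Max (?K (qmul q f g)) = Max (?K f) + Max (?K g)"
    using mx keys_qmul[of q f g] by (intro Max_eqI) (auto intro!: add_mono)
  show "Min (?K (qmul q f g)) = Min (?K f) + Min (?K g)"
    using mn keys_qmul[of q f g] by (intro Min_eqI) (auto intro!: add_mono)
qed

definition is_term :: "(nat multiset \<Rightarrow>\<^sub>0 'k::field) \<Rightarrow> bool" where
  "is_term f \<longleftrightarrow> (\<exists>M c. c \<noteq> 0 \<and> f = Poly_Mapping.single M c)"

lemma is_term_iff: "is_term f \<longleftrightarrow> f \<noteq> 0 \<and> Max (Poly_Mapping.keys f) = Min (Poly_Mapping.keys f)"
proof
  assume f: "f \<noteq> 0 \<and> Max (Poly_Mapping.keys f) = Min (Poly_Mapping.keys f)"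
  have "M = Max (Poly_Mapping.keys f)" if "M \<in> Poly_Mapping.keys f" for M
    using f that by (metis Max_ge Min_le antisym finite_keys)
  moreover have "Max (Poly_Mapping.keys f) \<in> Poly_Mapping.keys f"
    using f by (intro Max_in) simp_all
  ultimately have "f = Poly_Mapping.single (Max (Poly_Mapping.keys f)) (Poly_Mapping.lookup f (Max (Poly_Mapping.keys f)))"
    by (intro poly_mapping_eqI) (metis in_keys_iff lookup_single_eq lookup_single_not_eq)
  then show "is_term f"
    using \<open>Max _ \<in> _\<close> unfolding is_term_def in_keys_iff by blast
qed (auto simp: is_term_def)

text \<open>
  A divisor of a monomial is a scalar multiple of a monomial, because the gap between the largest and
  the smallest exponent is additive.
\<close>

lemma is_term_factors:
  assumes "is_term (qmul q f g)" "q \<noteq> 0"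
  shows "is_term f" "is_term g"
proof -
  have nz: "f \<noteq> 0" "g \<noteq> 0" using assms by (auto simp: is_term_iff)
  have "Max (Poly_Mapping.keys f) + Max (Poly_Mapping.keys g) = Min (Poly_Mapping.keys f) + Min (Poly_Mapping.keys g)"
    using assms nz by (simp add: is_term_iff Max_keys_qmul Min_keys_qmul)
  moreover have "Min (Poly_Mapping.keys f) \<le> Max (Poly_Mapping.keys f)" "Min (Poly_Mapping.keys g) \<le> Max (Poly_Mapping.keys g)"
    using nz by simp_all
  ultimately have "Min (Poly_Mapping.keys f) = Max (Poly_Mapping.keys f)" "Min (Poly_Mapping.keys g) = Max (Poly_Mapping.keys g)"
    by (metis add_less_le_mono add_le_less_mono order_le_imp_less_or_eq less_irrefl)+
  then show "is_term f" "is_term g" using nz by (simp_all add: is_term_iff)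
qed

lemma is_term_single [simp]: "is_term (Poly_Mapping.single M c) \<longleftrightarrow> c \<noteq> 0"
  by (simp add: is_term_iff)

lemma is_term_qmul: "is_term f \<Longrightarrow> is_term g \<Longrightarrow> q \<noteq> 0 \<Longrightarrow> is_term (qmul q f g)"
  by (auto simp: is_term_def[of f] is_term_def[of g] qmul_single)

section \<open>Commutation signs\<close>

text \<open>
  The parity of \<open>crossings M N + crossings N M\<close> is the commutation sign of \<open>x\<^sup>M\<close> and \<open>x\<^sup>N\<close>. Every pair
  of an entry of \<open>M\<close> and an entry of \<open>N\<close> is counted once in one of the three summands, depending on
  how the two entries compare.
\<close>

lemma crossings_swap: "crossings M N + crossings N M + (\<Sum>i\<in>#M. count N i) = size M * size N"
proof (induction M)
  case (add x M)
  have c: "crossings {#x#} N + crossings N {#x#} + count N x = size N"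
    by (induction N) (auto simp: crossings_def)
  show ?case
    using add c crossings_add_left[of "{#x#}" M N] crossings_add_right[of N "{#x#}" M]
    by (simp add: algebra_simps)
qed simp

text \<open>
  The effect of conjugating \<open>h\<close> by \<open>x\<^sup>M\<close>.
\<close>

definition conj_twist :: "nat multiset \<Rightarrow> (nat multiset \<Rightarrow>\<^sub>0 'k::field) \<Rightarrow> nat multiset \<Rightarrow>\<^sub>0 'k" where
  "conj_twist M h = (\<Sum>N\<in>Poly_Mapping.keys h.
     Poly_Mapping.single N ((- 1) ^ (crossings M N + crossings N M) * Poly_Mapping.lookup h N))"

lemma conj_twist_add: "conj_twist M (f + g) = conj_twist M f + conj_twist M g"
  unfolding conj_twist_def
  by (rule setsum_keys_plus_distrib[where f = "\<lambda>N a.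
     Poly_Mapping.single N ((- 1) ^ (crossings M N + crossings N M) * a)"])
   (simp_all add: algebra_simps single_add)

lemma conj_twist_single: "conj_twist M (Poly_Mapping.single N a) =
    Poly_Mapping.single N ((- 1) ^ (crossings M N + crossings N M) * a)"
  by (simp add: conj_twist_def)

lemma monomial_commute:
  "qmul (- 1) (Poly_Mapping.single M a) h = qmul (- 1) (conj_twist M h) (Poly_Mapping.single M a)"
proof (induction h rule: poly_mapping_induct_single)
  case (single N b)
  have "(- 1) ^ crossings M N = (- 1) ^ (crossings M N + crossings N M) * (- 1 :: 'a) ^ crossings N M"
    by (simp add: power_add mult.assoc flip: power_mult_distrib)
  then show ?case by (simp add: conj_twist_single qmul_single add.commute mult_ac)
qed (simp_all add: conj_twist_add qmul_add_left qmul_add_right)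

lemma conj_twist_closed: "h \<in> veronese_span n v \<Longrightarrow> conj_twist M h \<in> veronese_span n v"
  unfolding conj_twist_def
  by (intro veronese_span_sum veronese_span_single) (auto simp: veronese_span_def)

lemma replicate_in_support: "i \<in> {1..n} \<Longrightarrow> replicate_mset v i \<in> veronese_exponents n v"
  by (auto simp: veronese_exponents_def)

lemma replicate_add_in_support:
  "i \<in> {1..n} \<Longrightarrow> j \<in> {1..n} \<Longrightarrow> v > 0 \<Longrightarrow> add_mset j (replicate_mset (v - 1) i) \<in> veronese_exponents n v"
  by (auto simp: veronese_exponents_def)

lemma size_conv_sum: "set_mset M \<subseteq> {1..n::nat} \<Longrightarrow> size M = (\<Sum>i=1..n. count M i)"
  using size_exponent_mset[of n "count M"] by (simp add: exponent_mset_count)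

text \<open>
  Let \<open>d\<^sub>i\<close> be the parity of \<open>N\<^sub>i + N'\<^sub>i\<close> and \<open>D\<close> that of the total degree of \<open>x\<^sup>N x\<^sup>N\<^sup>'\<close>, so that
  \<open>D = \<Sum>d\<^sub>i\<close>. Commutation with \<open>x\<^sub>i\<^sup>v\<close> and with \<open>x\<^sub>i\<^sup>v\<^sup>-\<^sup>1 x\<^sub>j\<close> gives \<open>v D = v d\<^sub>i\<close> and
  \<open>v D = (v - 1) d\<^sub>i + d\<^sub>j\<close> modulo 2. Hence all \<open>d\<^sub>i\<close> are equal and \<open>D = n d\<^sub>i\<close>. If \<open>v\<close> is odd and \<open>n\<close>
  even, then \<open>D = 0\<close> and so \<open>d\<^sub>i = 0\<close>. If \<open>v\<close> is even and \<open>n\<close> odd, then \<open>D = 0\<close> because degrees in the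
  Veronese subring are multiples of \<open>v\<close>, and \<open>d\<^sub>i = D\<close>.
\<close>

lemma commutation_determines_parity:
  assumes "even n \<longleftrightarrow> odd v" "v > 0" "N \<in> veronese_exponents n v" "N' \<in> veronese_exponents n v"
    and comm: "\<And>U. U \<in> veronese_exponents n v \<Longrightarrow>
      even (crossings N U + crossings U N) \<longleftrightarrow> even (crossings N' U + crossings U N')"
    and i: "i \<in> {1..n}"
  shows "odd (count N i) \<longleftrightarrow> odd (count N' i)"
proof -
  define d where "d = (\<lambda>i. count N i + count N' i)"
  define D where "D = size N + size N'"
  have D: "D = (\<Sum>i=1..n. d i)"
    using assms(3,4) size_conv_sum[of N n] size_conv_sum[of N' n]
    by (simp add: D_def d_def sum.distrib veronese_exponents_def)
  have key: "even (D * size U + (\<Sum>i\<in>#U. d i))" if "U \<in> veronese_exponents n v" for U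
  proof -
    have "even ((crossings N U + crossings U N) + (crossings N' U + crossings U N'))"
      using comm[OF that] by simp
    moreover have "(crossings N U + crossings U N) + (crossings N' U + crossings U N') + (\<Sum>i\<in>#U. d i) = D * size U"
      using crossings_swap[of U N] crossings_swap[of U N']
      by (simp add: D_def d_def sum_mset.distrib algebra_simps)
    ultimately show ?thesis by (metis even_add)
  qed
  have ki: "even (D * v + v * d i)" if "i \<in> {1..n}" for i
    using key[OF replicate_in_support[OF that, of v]] by simp
  have "even (D * v + (v - 1) * d i + d j)" if "j \<in> {1..n}" for j
    using key[OF replicate_add_in_support[OF i that \<open>v > 0\<close>]] \<open>v > 0\<close> by (simp add: add_ac)
  then have dij: "even (d i) \<longleftrightarrow> even (d j)" if "j \<in> {1..n}" for j
    using ki[OF i] that \<open>v > 0\<close> by (cases v) (auto)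
  have Dn: "even D \<longleftrightarrow> even (n * d i)"
  proof -
    have "even (\<Sum>j=1..n. d j + d i)"
      using dij by (intro dvd_sum) auto
    then have "even (D + n * d i)" by (simp add: D sum.distrib)
    then show ?thesis by simp
  qed
  have "even (d i)"
  proof (cases "even v")
    case True
    then have "even (size N)" "even (size N')"
      using assms(3,4) by (auto simp: veronese_exponents_def elim: dvd_trans)
    then have "even D" by (simp add: D_def)
    then show ?thesis using Dn assms(1) True by simp
  next
    case False
    then show ?thesis using Dn assms(1) ki[OF i] by simp
  qed
  then show ?thesis by (simp add: d_def)
qed

lemma qmul_divide_monomial:
  fixes p :: "nat multiset \<Rightarrow>\<^sub>0 'k::field"
  assumes "\<And>N. N \<in> Poly_Mapping.keys p \<Longrightarrow> E \<subseteq># N" "q \<noteq> 0"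
  obtains h where "p = qmul q (Poly_Mapping.single E 1) h"
    "Poly_Mapping.keys h \<subseteq> (\<lambda>N. N - E) ` Poly_Mapping.keys p"
proof -
  from assms(1) have "Poly_Mapping.keys p \<subseteq> {N. E \<subseteq># N}" by blast
  then have "\<exists>h. p = qmul q (Poly_Mapping.single E 1) h"
  proof (induction p rule: poly_mapping_induct_keys)
    case (single N b)
    then have "Poly_Mapping.single N b = qmul q (Poly_Mapping.single E 1)
       (Poly_Mapping.single (N - E) (b / q ^ crossings E (N - E)))"
      using \<open>q \<noteq> 0\<close> by (simp add: qmul_single)
    then show ?case by blast
  next
    case (add f g)
    then show ?case by (metis qmul_add_right)
  next
    case zero
    then show ?case by (intro exI[of _ 0]) simp
  qed
  then obtain h where h: "p = qmul q (Poly_Mapping.single E 1) h" by blast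
  have "N \<in> (\<lambda>N. N - E) ` Poly_Mapping.keys p" if "N \<in> Poly_Mapping.keys h" for N
  proof -
    have "E + N \<in> Poly_Mapping.keys p"
      using that \<open>q \<noteq> 0\<close> by (simp add: h in_keys_iff lookup_qmul_single_left)
    then show ?thesis by force
  qed
  with h that show ?thesis by blast
qed

section \<open>Images of monomials under an automorphism\<close>

abbreviation xmon :: "nat multiset \<Rightarrow> nat multiset \<Rightarrow>\<^sub>0 'k::field" where
  "xmon M \<equiv> Poly_Mapping.single M 1"

text \<open>
  An automorphism of the Veronese subring and its inverse, in coordinates. Listing the properties of
  both maps makes the situation symmetric, so that each lemma applies to the inverse as well. The
  condition on constants expresses linearity over the field.
\<close>

locale skew_veronese_inverse_endos =
  fixes n v :: nat and \<phi> \<psi> :: "(nat multiset \<Rightarrow>\<^sub>0 'k::field) \<Rightarrow> nat multiset \<Rightarrow>\<^sub>0 'k"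
  assumes char: "(- 1 :: 'k) \<noteq> 1" and n: "n \<ge> 2" and v: "v > 0" and parity: "even n \<longleftrightarrow> odd v"
    and closed: "p \<in> veronese_span n v \<Longrightarrow> \<phi> p \<in> veronese_span n v"
    and add: "p \<in> veronese_span n v \<Longrightarrow> p' \<in> veronese_span n v \<Longrightarrow> \<phi> (p + p') = \<phi> p + \<phi> p'"
    and mult: "p \<in> veronese_span n v \<Longrightarrow> p' \<in> veronese_span n v \<Longrightarrow> \<phi> (qmul (- 1) p p') = qmul (- 1) (\<phi> p) (\<phi> p')"
    and const: "\<phi> (Poly_Mapping.single {#} c) = Poly_Mapping.single {#} c"
    and inverse: "p \<in> veronese_span n v \<Longrightarrow> \<psi> (\<phi> p) = p"
    and closed': "p \<in> veronese_span n v \<Longrightarrow> \<psi> p \<in> veronese_span n v"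
    and add': "p \<in> veronese_span n v \<Longrightarrow> p' \<in> veronese_span n v \<Longrightarrow> \<psi> (p + p') = \<psi> p + \<psi> p'"
    and mult': "p \<in> veronese_span n v \<Longrightarrow> p' \<in> veronese_span n v \<Longrightarrow> \<psi> (qmul (- 1) p p') = qmul (- 1) (\<psi> p) (\<psi> p')"
    and const': "\<psi> (Poly_Mapping.single {#} c) = Poly_Mapping.single {#} c"
    and inverse': "p \<in> veronese_span n v \<Longrightarrow> \<phi> (\<psi> p) = p"
begin

lemma swapped: "skew_veronese_inverse_endos n v \<psi> \<phi>"
  by unfold_locales (fact char n v parity closed' add' mult' const' inverse' closed add mult const inverse)+

lemma zero: "\<phi> 0 = 0"
  using const[of 0] by simp

lemma nonzero: "M \<in> veronese_exponents n v \<Longrightarrow> \<phi> (xmon M) \<noteq> 0"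
  using inverse[of "xmon M"] skew_veronese_inverse_endos.zero[OF swapped] by (auto simp: veronese_span_single)

lemma scale:
  assumes "M \<in> veronese_exponents n v"
  shows "\<phi> (Poly_Mapping.single M c) = qmul (- 1) (Poly_Mapping.single {#} c) (\<phi> (xmon M))"
proof -
  have "Poly_Mapping.single M c = qmul (- 1) (Poly_Mapping.single {#} c) (xmon M)"
    by (simp add: qmul_single)
  then show ?thesis
    using assms by (simp only: mult[OF veronese_span_single veronese_span_single] veronese_exponents_empty const)
qed

text \<open>
  As \<open>x\<^sup>U\<close> is the image of some \<open>h\<close>, and \<open>x\<^sup>M h = h' x\<^sup>M\<close> for a twist \<open>h'\<close> of \<open>h\<close>, there is an equation
  \<open>f x\<^sup>U = g f\<close> for \<open>f = \<phi>(x\<^sup>M)\<close> and \<open>g = \<phi>(h')\<close>. Its largest and smallest exponents show that both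
  extreme exponents of \<open>g\<close> equal \<open>U\<close>.
\<close>

lemma image_monomial_normal:
  assumes M: "M \<in> veronese_exponents n v" and U: "U \<in> veronese_exponents n v"
  obtains c where "qmul (- 1) (\<phi> (xmon M)) (xmon U) = qmul (- 1) (Poly_Mapping.single U c) (\<phi> (xmon M))"
proof -
  define h where "h = \<psi> (xmon U)"
  define g where "g = \<phi> (conj_twist M h)"
  have h: "h \<in> veronese_span n v" "\<phi> h = xmon U"
    using U by (auto simp: h_def closed' inverse' veronese_span_single)
  have "qmul (- 1) (\<phi> (xmon M)) (xmon U) = \<phi> (qmul (- 1) (xmon M) h)"
    using M h by (simp add: mult veronese_span_single)
  also have "\<dots> = \<phi> (qmul (- 1) (conj_twist M h) (xmon M))"
    by (simp add: monomial_commute)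
  also have "\<dots> = qmul (- 1) g (\<phi> (xmon M))"
    using M h by (simp add: mult veronese_span_single conj_twist_closed g_def)
  finally have eq: "qmul (- 1) (\<phi> (xmon M)) (xmon U) = qmul (- 1) g (\<phi> (xmon M))" .
  have "qmul (- 1) (\<phi> (xmon M)) (xmon U) \<noteq> 0"
    by (intro qmul_nonzero nonzero M) auto
  then have g0: "g \<noteq> 0" by (auto simp: eq)
  \<comment> \<open>The extreme exponents of \<open>f\<close> cancel on both sides.\<close>
  have "Max (Poly_Mapping.keys g) = U" "Min (Poly_Mapping.keys g) = U"
    using arg_cong[OF eq, of "\<lambda>f. Max (Poly_Mapping.keys f)"]
      arg_cong[OF eq, of "\<lambda>f. Min (Poly_Mapping.keys f)"] g0 nonzero[OF M]
    by (simp_all add: Max_keys_qmul Min_keys_qmul add.commute)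
  moreover from this g0 have "is_term g" by (simp add: is_term_iff)
  ultimately obtain c where "g = Poly_Mapping.single U c" by (auto simp: is_term_def)
  with eq that show ?thesis by simp
qed

text \<open>
  The coefficients at \<open>K + U\<close> in the equation \<open>f x\<^sup>U = c x\<^sup>U f\<close>, for an exponent \<open>K\<close> of \<open>f\<close>, identify
  \<open>c\<close> with the commutation sign of \<open>x\<^sup>K\<close> and \<open>x\<^sup>U\<close>. So this sign is the same for all exponents of \<open>f\<close>.
\<close>

lemma image_monomial_parity:
  assumes M: "M \<in> veronese_exponents n v" and N: "N \<in> Poly_Mapping.keys (\<phi> (xmon M))" "N' \<in> Poly_Mapping.keys (\<phi> (xmon M))"
    and i: "i \<in> {1..n}"
  shows "odd (count N i) \<longleftrightarrow> odd (count N' i)"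
proof (rule commutation_determines_parity[OF parity v _ _ _ i])
  have "\<phi> (xmon M) \<in> veronese_span n v" using M by (intro closed veronese_span_single)
  with N show "N \<in> veronese_exponents n v" "N' \<in> veronese_exponents n v" by (auto simp: veronese_span_def)
  fix U assume U: "U \<in> veronese_exponents n v"
  obtain c where c: "qmul (- 1) (\<phi> (xmon M)) (xmon U) = qmul (- 1) (Poly_Mapping.single U c) (\<phi> (xmon M))"
    using image_monomial_normal[OF M U] .
  have "(- 1) ^ (crossings K U + crossings U K) = c" if "K \<in> Poly_Mapping.keys (\<phi> (xmon M))" for K
  proof -
    have "(- 1) ^ crossings K U * Poly_Mapping.lookup (\<phi> (xmon M)) K * 1
        = (- 1) ^ crossings U K * c * Poly_Mapping.lookup (\<phi> (xmon M)) K"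
      unfolding lookup_qmul_single_right[symmetric] lookup_qmul_single_left[symmetric] c add.commute[of K U] ..
    then have "(- 1) ^ crossings K U = (- 1) ^ crossings U K * c"
      using that by (simp add: in_keys_iff)
    then have "(- 1) ^ (crossings K U + crossings U K) = (- 1 * - 1) ^ crossings U K * c"
      unfolding power_add power_mult_distrib by (simp only: mult_ac)
    then show ?thesis by simp
  qed
  from this[OF N(1)] this[OF N(2)] have eq:
    "(- 1 :: 'k) ^ (crossings N U + crossings U N) = (- 1) ^ (crossings N' U + crossings U N')" by simp
  then show "even (crossings N U + crossings U N) \<longleftrightarrow> even (crossings N' U + crossings U N')"
    using char unfolding minus_one_power_iff by (auto split: if_splits)
qed

lemma exists_odd_support:
  assumes i: "i \<in> {1..n}"
  shows "\<exists>T\<in>veronese_exponents n v. odd (count T i)"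
proof (cases "odd v")
  case True
  with replicate_in_support[OF i, of v] show ?thesis by (intro bexI) auto
next
  case False
  obtain j where "j \<in> {1..n}" "j \<noteq> i"
    using i n by (cases "i = 1") (auto intro: that[of 1] that[of 2])
  with False v replicate_add_in_support[OF i, of j v] show ?thesis
    by (intro bexI[of _ "add_mset j (replicate_mset (v - 1) i)"]) auto
qed

lemma sum_additive:
  assumes "finite I" "\<And>i. i \<in> I \<Longrightarrow> p i \<in> veronese_span n v"
  shows "\<phi> (\<Sum>i\<in>I. p i) = (\<Sum>i\<in>I. \<phi> (p i))"
  using assms
proof (induction I rule: finite_induct)
  case (insert i I)
  then show ?case using add[of "p i" "sum p I"] by (simp add: veronese_span_sum)
qed (simp add: zero)

lemma keys_image_term:
  assumes "M \<in> veronese_exponents n v" "c \<noteq> 0"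
  shows "Poly_Mapping.keys (\<phi> (Poly_Mapping.single M c)) = Poly_Mapping.keys (\<phi> (xmon M))"
  using keys_scale[OF assms(2), of "- 1" "\<phi> (xmon M)"] by (subst scale[OF assms(1)]) simp

lemma keys_image_subset:
  assumes "h \<in> veronese_span n v"
  shows "Poly_Mapping.keys (\<phi> h) \<subseteq> (\<Union>M\<in>Poly_Mapping.keys h. Poly_Mapping.keys (\<phi> (xmon M)))"
proof -
  have supp: "M \<in> veronese_exponents n v" if "M \<in> Poly_Mapping.keys h" for M
    using assms that by (auto simp: veronese_span_def)
  have "\<phi> h = \<phi> (\<Sum>M\<in>Poly_Mapping.keys h. Poly_Mapping.single M (Poly_Mapping.lookup h M))"
    by (simp only: poly_mapping_sum_singles)
  also have "\<dots> = (\<Sum>M\<in>Poly_Mapping.keys h. \<phi> (Poly_Mapping.single M (Poly_Mapping.lookup h M)))"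
    using supp by (intro sum_additive veronese_span_single) auto
  also have "Poly_Mapping.keys \<dots> \<subseteq>
      (\<Union>M\<in>Poly_Mapping.keys h. Poly_Mapping.keys (\<phi> (Poly_Mapping.single M (Poly_Mapping.lookup h M))))"
    by (rule keys_sum)
  also have "\<dots> = (\<Union>M\<in>Poly_Mapping.keys h. Poly_Mapping.keys (\<phi> (xmon M)))"
    using supp by (intro SUP_cong refl keys_image_term) (auto simp: in_keys_iff)
  finally show ?thesis .
qed

text \<open>
  A monomial \<open>x\<^sup>T\<close> of odd degree in \<open>x\<^sub>i\<close> occurs in the image of some monomial by surjectivity. All other
  monomials of that image then have odd, hence positive, degree in \<open>x\<^sub>i\<close>.
\<close>

lemma exists_monomial_with_divisible_image:
  assumes i: "i \<in> {1..n}"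
  shows "\<exists>M\<in>veronese_exponents n v. \<forall>N\<in>Poly_Mapping.keys (\<phi> (xmon M)). i \<in># N"
proof -
  obtain T where T: "T \<in> veronese_exponents n v" "odd (count T i)"
    using exists_odd_support[OF i] by blast
  have h: "\<psi> (xmon T) \<in> veronese_span n v" "\<phi> (\<psi> (xmon T)) = xmon T"
    using T by (auto simp: closed' inverse' veronese_span_single)
  obtain M where M: "M \<in> Poly_Mapping.keys (\<psi> (xmon T))" "T \<in> Poly_Mapping.keys (\<phi> (xmon M))"
    using keys_image_subset[OF h(1)] h(2) by auto
  then have MS: "M \<in> veronese_exponents n v" using h by (auto simp: veronese_span_def)
  have "odd (count N i)" if "N \<in> Poly_Mapping.keys (\<phi> (xmon M))" for N
    using image_monomial_parity[OF MS that M(2) i] T by simp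
  then show ?thesis using MS by (metis count_greater_zero_iff odd_pos)
qed

lemma image_sum:
  assumes "A \<in> veronese_exponents n v" "B \<in> veronese_exponents n v"
  shows "qmul (- 1) (\<phi> (xmon A)) (\<phi> (xmon B)) = qmul (- 1) (Poly_Mapping.single {#} ((- 1) ^ crossings A B)) (\<phi> (xmon (A + B)))"
    and "Poly_Mapping.keys (\<phi> (xmon (A + B))) = Poly_Mapping.keys (qmul (- 1) (\<phi> (xmon A)) (\<phi> (xmon B)))"
proof -
  show *: "qmul (- 1) (\<phi> (xmon A)) (\<phi> (xmon B)) = qmul (- 1) (Poly_Mapping.single {#} ((- 1) ^ crossings A B)) (\<phi> (xmon (A + B)))"
  proof -
    have "qmul (- 1) (\<phi> (xmon A)) (\<phi> (xmon B)) = \<phi> (qmul (- 1) (xmon A) (xmon B))"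
      by (rule mult[symmetric]) (intro veronese_span_single assms)+
    also have "\<dots> = \<phi> (Poly_Mapping.single (A + B) ((- 1) ^ crossings A B))"
      by (simp add: qmul_single)
    also have "\<dots> = qmul (- 1) (Poly_Mapping.single {#} ((- 1) ^ crossings A B)) (\<phi> (xmon (A + B)))"
      by (intro scale veronese_exponents_add assms)
    finally show ?thesis .
  qed
  show "Poly_Mapping.keys (\<phi> (xmon (A + B))) = Poly_Mapping.keys (qmul (- 1) (\<phi> (xmon A)) (\<phi> (xmon B)))"
    unfolding * by simp
qed

text \<open>
  Multiply powers of the monomials found for the individual variables: the exponents of the image of
  a product are sums of exponents of the images of the factors.
\<close>

lemma exists_monomial_with_highly_divisible_image:
  "finite I \<Longrightarrow> I \<subseteq> {1..n} \<Longrightarrow>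
    \<exists>W\<in>veronese_exponents n v. \<forall>N\<in>Poly_Mapping.keys (\<phi> (xmon W)). \<forall>i\<in>I. count N i \<ge> k"
proof (induction I rule: finite_induct)
  case empty
  show ?case by (intro bexI[of _ "{#}"]) auto
next
  case (insert i I)
  obtain W where W: "W \<in> veronese_exponents n v" "\<forall>N\<in>Poly_Mapping.keys (\<phi> (xmon W)). \<forall>i\<in>I. count N i \<ge> k"
    using insert by auto
  obtain M where M: "M \<in> veronese_exponents n v" "\<forall>N\<in>Poly_Mapping.keys (\<phi> (xmon M)). i \<in># N"
    using exists_monomial_with_divisible_image[of i] insert.prems by blast
  have "\<exists>V\<in>veronese_exponents n v. \<forall>N\<in>Poly_Mapping.keys (\<phi> (xmon V)). (\<forall>i\<in>I. count N i \<ge> k) \<and> count N i \<ge> l" for l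
  proof (induction l)
    case 0
    then show ?case using W by auto
  next
    case (Suc l)
    then obtain V where V: "V \<in> veronese_exponents n v"
       "\<forall>N\<in>Poly_Mapping.keys (\<phi> (xmon V)). (\<forall>i\<in>I. count N i \<ge> k) \<and> count N i \<ge> l" by blast
    have "(\<forall>i\<in>I. count N i \<ge> k) \<and> count N i \<ge> Suc l" if N: "N \<in> Poly_Mapping.keys (\<phi> (xmon (V + M)))" for N
    proof -
      obtain A B where "N = A + B" "A \<in> Poly_Mapping.keys (\<phi> (xmon V))" "B \<in> Poly_Mapping.keys (\<phi> (xmon M))"
        using subsetD[OF keys_qmul N[unfolded image_sum(2)[OF V(1) M(1)]]] by blast
      with V(2) M(2) have "\<forall>i\<in>I. count A i \<ge> k" "count A i \<ge> l" "i \<in># B" by auto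
      with \<open>N = A + B\<close> show ?thesis by (auto simp: trans_le_add1 simp flip: count_greater_zero_iff)
    qed
    with V M show ?case by (meson veronese_exponents_add)
  qed
  from this[of k] show ?case by auto
qed

text \<open>
  With \<open>e = x\<^sub>1\<^sup>v \<cdots> x\<^sub>n\<^sup>v\<close>, the previous lemma for the inverse \<open>\<psi>\<close> yields a monomial with
  \<open>\<psi>(x\<^sup>W) = e h\<close>. Then \<open>x\<^sup>W = \<phi>(e) \<phi>(h)\<close>, so \<open>\<phi>(e)\<close> is a scalar multiple of a monomial, as is the image
  of every power of \<open>e\<close>, and hence the image of every divisor of such a power.
\<close>

lemma image_monomial_is_term:
  assumes M: "M \<in> veronese_exponents n v"
  shows "is_term (\<phi> (xmon M))"
proof -
  define E where "E = exponent_mset n (\<lambda>_. v)"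
  have E: "E \<in> veronese_exponents n v"
    unfolding E_def veronese_exponents_def using set_exponent_mset by (auto simp: size_exponent_mset)
  obtain W where W: "W \<in> veronese_exponents n v" "\<forall>N\<in>Poly_Mapping.keys (\<psi> (xmon W)). \<forall>i\<in>{1..n}. count N i \<ge> v"
    using skew_veronese_inverse_endos.exists_monomial_with_highly_divisible_image[OF swapped, of "{1..n}" v] by auto
  have EN: "E \<subseteq># N" if "N \<in> Poly_Mapping.keys (\<psi> (xmon W))" for N
    using W(2) that by (auto simp: subseteq_mset_def E_def count_exponent_mset)
  obtain h where h: "\<psi> (xmon W) = qmul (- 1) (xmon E) h"
      "Poly_Mapping.keys h \<subseteq> (\<lambda>N. N - E) ` Poly_Mapping.keys (\<psi> (xmon W))"
    using qmul_divide_monomial[of "\<psi> (xmon W)" E "- 1"] EN by auto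
  have "N - E \<in> veronese_exponents n v" if "N \<in> Poly_Mapping.keys (\<psi> (xmon W))" for N
  proof -
    have "N \<in> veronese_exponents n v" using closed'[OF veronese_span_single[OF W(1)]] that by (auto simp: veronese_span_def)
    moreover note EN[OF that]
    ultimately show ?thesis
      using E by (auto simp: veronese_exponents_def size_Diff_submset dest: in_diffD)
  qed
  then have hS: "h \<in> veronese_span n v" using h(2) by (auto simp: veronese_span_def)
  have "xmon W = qmul (- 1) (\<phi> (xmon E)) (\<phi> h)"
    using inverse'[OF veronese_span_single[OF W(1)], of 1] mult[OF veronese_span_single[OF E] hS] h(1) by simp
  moreover have "is_term (xmon W :: _ \<Rightarrow>\<^sub>0 'k)" by simp
  ultimately have tE: "is_term (\<phi> (xmon E))" using is_term_factors(1)[of "- 1"] by auto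
  have tk: "repeat_mset k E \<in> veronese_exponents n v \<and> is_term (\<phi> (xmon (repeat_mset k E)))" for k
  proof (induction k)
    case 0
    have "is_term (\<phi> (xmon {#}))" unfolding const is_term_single by (rule one_neq_zero)
    then show ?case by simp
  next
    case (Suc k)
    have "is_term (qmul (- 1) (\<phi> (xmon E)) (\<phi> (xmon (repeat_mset k E))))"
      using Suc tE by (intro is_term_qmul) auto
    then show ?case
      using Suc E image_sum(2)[OF E, of "repeat_mset k E"]
      by (auto simp: veronese_exponents_add is_term_iff simp flip: keys_eq_empty)
  qed
  \<comment> \<open>A crude bound: no multiplicity in \<open>M\<close> exceeds its size, and every multiplicity in \<open>E\<close> is positive.\<close>
  define F where "F = repeat_mset (size M) E"
  have "M \<subseteq># F"
  proof -
    have "count M i \<le> size M * count E i" for i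
    proof (cases "i \<in># M")
      case True
      then have "count E i > 0" using M v by (auto simp: E_def count_exponent_mset veronese_exponents_def)
      then show ?thesis
        using mult_le_mono[OF count_le_size[of M i], of 1 "count E i"] by simp
    qed (simp add: not_in_iff)
    then show ?thesis by (simp add: subseteq_mset_def F_def)
  qed
  then have F: "F = M + (F - M)" by simp
  have "F - M \<in> veronese_exponents n v"
    using tk[of "size M"] M \<open>M \<subseteq># F\<close> unfolding F_def[symmetric]
    by (auto simp: veronese_exponents_def size_Diff_submset dest: in_diffD)
  from image_sum(2)[OF M this] have "is_term (qmul (- 1) (\<phi> (xmon M)) (\<phi> (xmon (F - M))))"
    using tk[of "size M"] unfolding F_def[symmetric] F[symmetric]
    by (auto simp: is_term_iff simp flip: keys_eq_empty)
  then show ?thesis using is_term_factors(1)[of "- 1"] by auto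
qed

end

section \<open>Automorphisms of the monoid of exponents\<close>

lemma repeat_conv_sum: "repeat_mset k Q = (\<Sum>i\<in>#Q. replicate_mset k i)"
  by (induction Q) (auto intro!: multiset_eqI)

lemma repeat_mset_cancel: "k > 0 \<Longrightarrow> repeat_mset k A = repeat_mset k B \<Longrightarrow> A = B"
  by (metis count_repeat_mset multiset_eqI nat_mult_eq_cancel1)

text \<open>
  An automorphism of the monoid of exponents together with its inverse.
\<close>

locale support_monoid_inverse_endos =
  fixes n v :: nat and \<pi> \<pi>' :: "nat multiset \<Rightarrow> nat multiset"
  assumes v: "v > 0"
    and closed: "A \<in> veronese_exponents n v \<Longrightarrow> \<pi> A \<in> veronese_exponents n v"
    and add: "A \<in> veronese_exponents n v \<Longrightarrow> B \<in> veronese_exponents n v \<Longrightarrow> \<pi> (A + B) = \<pi> A + \<pi> B"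
    and inverse: "A \<in> veronese_exponents n v \<Longrightarrow> \<pi>' (\<pi> A) = A"
    and closed': "A \<in> veronese_exponents n v \<Longrightarrow> \<pi>' A \<in> veronese_exponents n v"
    and add': "A \<in> veronese_exponents n v \<Longrightarrow> B \<in> veronese_exponents n v \<Longrightarrow> \<pi>' (A + B) = \<pi>' A + \<pi>' B"
    and inverse': "A \<in> veronese_exponents n v \<Longrightarrow> \<pi> (\<pi>' A) = A"
begin

lemma swapped: "support_monoid_inverse_endos n v \<pi>' \<pi>"
  by unfold_locales (fact v closed' add' inverse' closed add inverse)+

lemma empty: "\<pi> {#} = {#}"
  using add[of "{#}" "{#}"] by simp

lemma nonempty: "A \<in> veronese_exponents n v \<Longrightarrow> A \<noteq> {#} \<Longrightarrow> \<pi> A \<noteq> {#}"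
  using inverse[of A] support_monoid_inverse_endos.empty[OF swapped] by auto

lemma sum_mset:
  assumes "\<And>i. i \<in># Q \<Longrightarrow> f i \<in> veronese_exponents n v"
  shows "\<pi> (\<Sum>i\<in>#Q. f i) = (\<Sum>i\<in>#Q. \<pi> (f i))"
proof -
  have "\<pi> (\<Sum>i\<in>#Q. f i) = (\<Sum>i\<in>#Q. \<pi> (f i)) \<and> (\<Sum>i\<in>#Q. f i) \<in> veronese_exponents n v"
    using assms by (induction Q) (simp_all add: empty add veronese_exponents_add)
  then show ?thesis ..
qed

lemma repeat: "A \<in> veronese_exponents n v \<Longrightarrow> \<pi> (repeat_mset k A) = repeat_mset k (\<pi> A) \<and> repeat_mset k A \<in> veronese_exponents n v"
  by (induction k) (auto simp: empty add veronese_exponents_add)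

text \<open>
  After multiplication by \<open>v\<close>, every exponent is a sum of multisets \<open>v \<cdot> {i}\<close>, so these determine \<open>\<pi>\<close>.
\<close>

lemma repeat_image:
  assumes "A \<in> veronese_exponents n v"
  shows "repeat_mset v (\<pi> A) = (\<Sum>i\<in>#A. \<pi> (replicate_mset v i))"
proof -
  have "repeat_mset v (\<pi> A) = \<pi> (\<Sum>i\<in>#A. replicate_mset v i)"
    using repeat[OF assms, of v] by (simp add: repeat_conv_sum)
  also have "\<dots> = (\<Sum>i\<in>#A. \<pi> (replicate_mset v i))"
    using assms by (intro sum_mset replicate_in_support) (auto simp: veronese_exponents_def)
  finally show ?thesis .
qed

text \<open>
  Write \<open>v \<cdot> {j} = \<pi>(Q)\<close>. Then \<open>v\<^sup>2 \<cdot> {j}\<close> is the sum of the \<open>\<pi>(v \<cdot> {i})\<close> over the entries \<open>i\<close> of \<open>Q\<close>, so each of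
  these is a multiple of \<open>{j}\<close>. This assigns to each \<open>j\<close> an \<open>i\<close>, injectively, hence every \<open>i\<close> occurs.
\<close>

lemma image_pure:
  assumes "i \<in> {1..n}"
  shows "\<exists>j\<in>{1..n}. set_mset (\<pi> (replicate_mset v i)) = {j}"
proof -
  have *: "\<exists>i\<in>{1..n}. set_mset (\<pi> (replicate_mset v i)) = {j}" if j: "j \<in> {1..n}" for j
  proof -
    let ?Q = "\<pi>' (replicate_mset v j)"
    have Q: "?Q \<in> veronese_exponents n v"
      by (intro closed' replicate_in_support j)
    have "replicate_mset v j \<noteq> {#}" using v by (cases v) auto
    then have "?Q \<noteq> {#}"
      by (rule support_monoid_inverse_endos.nonempty[OF swapped replicate_in_support[OF j]])
    then obtain i where i: "i \<in># ?Q" by blast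
    have in_range: "i \<in> {1..n}" using Q i by (auto simp: veronese_exponents_def)
    have "repeat_mset v (replicate_mset v j) = (\<Sum>i\<in>#?Q. \<pi> (replicate_mset v i))"
      using repeat_image[OF Q] inverse'[OF replicate_in_support[OF j]] by simp
    then have "\<pi> (replicate_mset v i) \<subseteq># repeat_mset v (replicate_mset v j)"
      using i by (auto dest!: multi_member_split)
    then have "set_mset (\<pi> (replicate_mset v i)) \<subseteq> set_mset (repeat_mset v (replicate_mset v j))"
      by (rule set_mset_mono)
    moreover have "x = j" if "x \<in># repeat_mset v (replicate_mset v j)" for x
      using that unfolding count_greater_zero_iff[symmetric] count_repeat_mset count_replicate_mset
      by (simp split: if_splits)
    ultimately have "set_mset (\<pi> (replicate_mset v i)) \<subseteq> {j}"
      by blast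
    moreover have "\<pi> (replicate_mset v i) \<noteq> {#}"
      using v by (intro nonempty replicate_in_support in_range) auto
    ultimately show ?thesis using in_range by (intro bexI[of _ i]) auto
  qed
  have "\<forall>j\<in>{1..n}. \<exists>i. i \<in> {1..n} \<and> set_mset (\<pi> (replicate_mset v i)) = {j}"
    using * by blast
  from bchoice[OF this] obtain \<tau> where
    \<tau>: "\<forall>j\<in>{1..n}. \<tau> j \<in> {1..n} \<and> set_mset (\<pi> (replicate_mset v (\<tau> j))) = {j}"
    by blast
  have "inj_on \<tau> {1..n}"
  proof (rule inj_onI)
    fix j k assume jk: "j \<in> {1..n}" "k \<in> {1..n}" "\<tau> j = \<tau> k"
    then have "{j} = {k}" using \<tau> by metis
    then show "j = k" by simp
  qed
  moreover have "\<tau> ` {1..n} \<subseteq> {1..n}" using \<tau> by blast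
  ultimately have "\<tau> ` {1..n} = {1..n}" using endo_inj_surj by blast
  with assms obtain j where j: "j \<in> {1..n}" "i = \<tau> j" by blast
  from \<tau> j(1) have "set_mset (\<pi> (replicate_mset v i)) = {j}" unfolding j(2) by blast
  with j(1) show ?thesis by blast
qed

lemma image_replicate_multiple:
  assumes i: "i \<in> {1..n}"
  shows "\<exists>j\<in>{1..n}. \<exists>a. \<pi> (replicate_mset v i) = repeat_mset a (replicate_mset v j)"
proof -
  obtain j where j: "j \<in> {1..n}" "set_mset (\<pi> (replicate_mset v i)) = {j}"
    using image_pure[OF i] by blast
  have multiple: "replicate_mset (a * v) j = repeat_mset a (replicate_mset v j)" for a
    by (simp add: multiset_eq_iff)
  from j have eq: "\<pi> (replicate_mset v i) = replicate_mset (size (\<pi> (replicate_mset v i))) j"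
    using set_mset_subset_singletonD[of "\<pi> (replicate_mset v i)" j] by simp
  moreover have "v dvd size (\<pi> (replicate_mset v i))"
    using closed[OF replicate_in_support[OF i]] by (simp add: veronese_exponents_def)
  then obtain a where "size (\<pi> (replicate_mset v i)) = a * v"
    by (metis dvd_def mult.commute)
  ultimately have "\<pi> (replicate_mset v i) = repeat_mset a (replicate_mset v j)"
    using multiple[of a] by metis
  with j show ?thesis by blast
qed

text \<open>
  Both \<open>\<pi>\<close> and its inverse multiply sizes by positive integers here, and the product of these is 1.
\<close>

lemma image_replicate:
  assumes i: "i \<in> {1..n}"
  shows "\<exists>j\<in>{1..n}. \<pi> (replicate_mset v i) = replicate_mset v j"
proof -
  obtain j a where j: "j \<in> {1..n}" "\<pi> (replicate_mset v i) = repeat_mset a (replicate_mset v j)"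
    using image_replicate_multiple[OF i] by blast
  obtain k b where k: "k \<in> {1..n}" "\<pi>' (replicate_mset v j) = repeat_mset b (replicate_mset v k)"
    using support_monoid_inverse_endos.image_replicate_multiple[OF swapped j(1)] by blast
  have "replicate_mset v i = repeat_mset a (repeat_mset b (replicate_mset v k))"
    using inverse[OF replicate_in_support[OF i]] j
      support_monoid_inverse_endos.repeat[OF swapped replicate_in_support[OF j(1)], of a] k by simp
  \<comment> \<open>\<open>a\<close> and \<open>b\<close> are the factors by which \<open>\<pi>\<close> and its inverse multiply sizes.\<close>
  from arg_cong[OF this, of size] have "v = a * (b * v)" by simp
  then have "a = 1" using v by simp
  then have "repeat_mset a (replicate_mset v j) = replicate_mset v j"
    by (simp add: multiset_eq_iff)
  with j show ?thesis by metis
qed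

lemma induced_by_permutation:
  "\<exists>\<sigma>. \<sigma> permutes {1..n} \<and> (\<forall>A\<in>veronese_exponents n v. \<pi> A = image_mset \<sigma> A)"
proof -
  define \<sigma> where "\<sigma> = (\<lambda>i. if i \<in> {1..n} then SOME j. j \<in> {1..n} \<and> \<pi> (replicate_mset v i) = replicate_mset v j else i)"
  have \<sigma>: "\<sigma> i \<in> {1..n} \<and> \<pi> (replicate_mset v i) = replicate_mset v (\<sigma> i)" if i: "i \<in> {1..n}" for i
  proof -
    have "\<exists>j. j \<in> {1..n} \<and> \<pi> (replicate_mset v i) = replicate_mset v j" using image_replicate[OF i] by blast
    from someI_ex[OF this] show ?thesis using i unfolding \<sigma>_def by (simp only: if_True)
  qed
  have "inj_on \<sigma> {1..n}"
  proof (rule inj_onI)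
    fix i j assume ij: "i \<in> {1..n}" "j \<in> {1..n}" "\<sigma> i = \<sigma> j"
    then have "\<pi> (replicate_mset v i) = \<pi> (replicate_mset v j)" using \<sigma> by metis
    then have "replicate_mset v i = replicate_mset v j"
      by (metis inverse replicate_in_support ij(1,2))
    then show "i = j" using v by (simp add: replicate_mset_eq_iff)
  qed
  moreover have "\<sigma> ` {1..n} \<subseteq> {1..n}" using \<sigma> by blast
  ultimately have "bij_betw \<sigma> {1..n} {1..n}" by (simp add: bij_betw_def endo_inj_surj)
  then have "\<sigma> permutes {1..n}" by (rule bij_imp_permutes) (simp only: \<sigma>_def if_False)
  moreover have "\<pi> A = image_mset \<sigma> A" if A: "A \<in> veronese_exponents n v" for A
  proof (rule repeat_mset_cancel[OF v])
    have "repeat_mset v (\<pi> A) = (\<Sum>i\<in>#A. \<pi> (replicate_mset v i))" by (rule repeat_image[OF A])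
    also have "\<dots> = (\<Sum>i\<in>#A. replicate_mset v (\<sigma> i))"
      using A \<sigma> by (intro arg_cong[where f = sum_mset] image_mset_cong) (auto simp: veronese_exponents_def)
    also have "\<dots> = repeat_mset v (image_mset \<sigma> A)"
      by (simp add: repeat_conv_sum image_mset.compositionality comp_def)
    finally show "repeat_mset v (\<pi> A) = repeat_mset v (image_mset \<sigma> A)" .
  qed
  ultimately show ?thesis by blast
qed

end

section \<open>The permutation induced by an automorphism\<close>

context skew_veronese_inverse_endos
begin

definition image_exponent :: "nat multiset \<Rightarrow> nat multiset" where
  "image_exponent M = (THE N. N \<in> Poly_Mapping.keys (\<phi> (xmon M)))"

lemma image_monomial:
  assumes "M \<in> veronese_exponents n v"
  shows "\<exists>c. c \<noteq> 0 \<and> \<phi> (xmon M) = Poly_Mapping.single (image_exponent M) c"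
proof -
  obtain N c where N: "c \<noteq> 0" "\<phi> (xmon M) = Poly_Mapping.single N c"
    using image_monomial_is_term[OF assms] unfolding is_term_def by blast
  then have "image_exponent M = N" unfolding image_exponent_def N(2) by (intro the_equality) auto
  with N show ?thesis by blast
qed

lemma keys_image_monomial:
  assumes "M \<in> veronese_exponents n v"
  shows "Poly_Mapping.keys (\<phi> (xmon M)) = {image_exponent M}"
  using image_monomial[OF assms] by auto

lemma image_exponent_closed:
  assumes "M \<in> veronese_exponents n v"
  shows "image_exponent M \<in> veronese_exponents n v"
proof -
  have "Poly_Mapping.keys (\<phi> (xmon M)) \<subseteq> veronese_exponents n v"
    using closed[OF veronese_span_single[OF assms, of 1]] by (simp add: veronese_span_def)
  then show ?thesis unfolding keys_image_monomial[OF assms] by simp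
qed

lemma image_exponent_add:
  assumes A: "A \<in> veronese_exponents n v" and B: "B \<in> veronese_exponents n v"
  shows "image_exponent (A + B) = image_exponent A + image_exponent B"
proof -
  obtain a where a: "a \<noteq> 0" "\<phi> (xmon A) = Poly_Mapping.single (image_exponent A) a"
    using image_monomial[OF A] by blast
  obtain b where b: "b \<noteq> 0" "\<phi> (xmon B) = Poly_Mapping.single (image_exponent B) b"
    using image_monomial[OF B] by blast
  have "{image_exponent (A + B)} = {image_exponent A + image_exponent B}"
    using image_sum(2)[OF A B] a(1) b(1)
    unfolding keys_image_monomial[OF veronese_exponents_add[OF A B]] a(2) b(2) qmul_single by simp
  then show ?thesis by simp
qed

lemma image_exponent_inverse:
  assumes A: "A \<in> veronese_exponents n v"
  shows "skew_veronese_inverse_endos.image_exponent \<psi> (image_exponent A) = A"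
proof -
  interpret inv: skew_veronese_inverse_endos n v \<psi> \<phi> by (rule swapped)
  obtain a where a: "a \<noteq> 0" "\<phi> (xmon A) = Poly_Mapping.single (image_exponent A) a"
    using image_monomial[OF A] by blast
  have "{inv.image_exponent (image_exponent A)} = Poly_Mapping.keys (\<psi> (\<phi> (xmon A)))"
    unfolding a(2) inv.keys_image_term[OF image_exponent_closed[OF A] a(1)]
      inv.keys_image_monomial[OF image_exponent_closed[OF A]] ..
  also have "\<dots> = {A}" by (simp add: inverse veronese_span_single A)
  finally show ?thesis by simp
qed

theorem monomials_permuted:
  "\<exists>\<sigma> c. \<sigma> permutes {1..n} \<and>
    (\<forall>M\<in>veronese_exponents n v. c M \<noteq> 0 \<and> \<phi> (xmon M) = Poly_Mapping.single (image_mset \<sigma> M) (c M))"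
proof -
  interpret inv: skew_veronese_inverse_endos n v \<psi> \<phi> by (rule swapped)
  interpret support_monoid_inverse_endos n v image_exponent inv.image_exponent
    by unfold_locales
      (fact v image_exponent_closed inv.image_exponent_closed image_exponent_add inv.image_exponent_add image_exponent_inverse inv.image_exponent_inverse)+
  obtain \<sigma> where \<sigma>: "\<sigma> permutes {1..n}" "\<forall>A\<in>veronese_exponents n v. image_exponent A = image_mset \<sigma> A"
    using induced_by_permutation by blast
  have "\<forall>M\<in>veronese_exponents n v. \<exists>c. c \<noteq> 0 \<and> \<phi> (xmon M) = Poly_Mapping.single (image_mset \<sigma> M) c"
    using \<sigma>(2) image_monomial by fastforce
  then obtain c where "\<forall>M\<in>veronese_exponents n v. c M \<noteq> 0 \<and> \<phi> (xmon M) = Poly_Mapping.single (image_mset \<sigma> M) (c M)"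
    by metis
  with \<sigma>(1) show ?thesis by blast
qed

end

section \<open>Recognizing semidirect products\<close>

text \<open>
  An internal semidirect product: a unique factorization \<open>g = \<tau>(a) \<pi>(h)\<close>, with \<open>\<theta>\<close> the conjugation of the
  image of \<open>\<tau>\<close> by that of \<open>\<pi>\<close>.
\<close>

lemma iso_semidirect:
  fixes G :: "('g, 'y) monoid_scheme"
  assumes G: "group G" and H: "group H" and \<tau>: "\<tau> \<in> hom N G" and \<pi>: "\<pi> \<in> hom H G"
    and surj: "\<And>g. g \<in> carrier G \<Longrightarrow> \<exists>a\<in>carrier N. \<exists>h\<in>carrier H. g = \<tau> a \<otimes>\<^bsub>G\<^esub> \<pi> h"
    and unique: "\<And>a h a' h'. a \<in> carrier N \<Longrightarrow> h \<in> carrier H \<Longrightarrow> a' \<in> carrier N \<Longrightarrow> h' \<in> carrier H \<Longrightarrow>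
      \<tau> a \<otimes>\<^bsub>G\<^esub> \<pi> h = \<tau> a' \<otimes>\<^bsub>G\<^esub> \<pi> h' \<Longrightarrow> a = a' \<and> h = h'"
    and \<theta>: "\<And>h a. h \<in> carrier H \<Longrightarrow> a \<in> carrier N \<Longrightarrow> \<theta> h a \<in> carrier N"
    and conj: "\<And>h a. h \<in> carrier H \<Longrightarrow> a \<in> carrier N \<Longrightarrow> \<tau> (\<theta> h a) = \<pi> h \<otimes>\<^bsub>G\<^esub> \<tau> a \<otimes>\<^bsub>G\<^esub> inv\<^bsub>G\<^esub> (\<pi> h)"
    and N: "\<And>a b. a \<in> carrier N \<Longrightarrow> b \<in> carrier N \<Longrightarrow> a \<otimes>\<^bsub>N\<^esub> b \<in> carrier N"
  shows "G \<cong> semidirect H N \<theta>"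
proof -
  interpret G: group G by (rule G)
  interpret H: group H by (rule H)
  let ?S = "semidirect H N \<theta>"
  define f where "f = (\<lambda>(h, a). \<tau> a \<otimes>\<^bsub>G\<^esub> \<pi> h)"
  have carrier: "\<tau> a \<in> carrier G" "\<pi> h \<in> carrier G" if "a \<in> carrier N" "h \<in> carrier H" for a h
    using \<tau> \<pi> that by (auto simp: hom_def)
  have bij: "bij_betw f (carrier ?S) (carrier G)"
  proof (rule bij_betwI')
    fix x y assume "x \<in> carrier ?S" "y \<in> carrier ?S"
    then show "f x = f y \<longleftrightarrow> x = y"
      using unique by (auto simp: f_def semidirect_def)
  next
    fix x assume "x \<in> carrier ?S"
    then show "f x \<in> carrier G" using carrier by (auto simp: f_def semidirect_def)
  next
    fix g assume "g \<in> carrier G"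
    then obtain a h where "a \<in> carrier N" "h \<in> carrier H" "g = \<tau> a \<otimes>\<^bsub>G\<^esub> \<pi> h" using surj by blast
    then show "\<exists>x\<in>carrier ?S. g = f x"
      by (intro bexI[of _ "(h, a)"]) (auto simp: f_def semidirect_def)
  qed
  have closed: "x \<otimes>\<^bsub>?S\<^esub> y \<in> carrier ?S" if "x \<in> carrier ?S" "y \<in> carrier ?S" for x y
    using that \<theta> N by (auto simp: semidirect_def)
  have f_mult: "f (x \<otimes>\<^bsub>?S\<^esub> y) = f x \<otimes>\<^bsub>G\<^esub> f y" if "x \<in> carrier ?S" "y \<in> carrier ?S" for x y
  proof -
    obtain h a k b where xy: "x = (h, a)" "y = (k, b)" by (cases x, cases y)
    with that have mem: "h \<in> carrier H" "a \<in> carrier N" "k \<in> carrier H" "b \<in> carrier N"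
      by (auto simp: semidirect_def)
    have "f (x \<otimes>\<^bsub>?S\<^esub> y) = \<tau> (a \<otimes>\<^bsub>N\<^esub> \<theta> h b) \<otimes>\<^bsub>G\<^esub> \<pi> (h \<otimes>\<^bsub>H\<^esub> k)"
      by (simp add: xy f_def semidirect_def)
    also have "\<dots> = (\<tau> a \<otimes>\<^bsub>G\<^esub> (\<pi> h \<otimes>\<^bsub>G\<^esub> \<tau> b \<otimes>\<^bsub>G\<^esub> inv\<^bsub>G\<^esub> (\<pi> h))) \<otimes>\<^bsub>G\<^esub> (\<pi> h \<otimes>\<^bsub>G\<^esub> \<pi> k)"
      using hom_mult[OF \<tau> mem(2) \<theta>[OF mem(1,4)]] hom_mult[OF \<pi> mem(1,3)] conj[OF mem(1,4)] by simp
    also have "\<dots> = (\<tau> a \<otimes>\<^bsub>G\<^esub> \<pi> h) \<otimes>\<^bsub>G\<^esub> (\<tau> b \<otimes>\<^bsub>G\<^esub> \<pi> k)"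
    proof -
      have c: "\<tau> a \<in> carrier G" "\<pi> h \<in> carrier G" "\<tau> b \<in> carrier G" "\<pi> k \<in> carrier G"
        using carrier mem by auto
      have "inv\<^bsub>G\<^esub> (\<pi> h) \<otimes>\<^bsub>G\<^esub> (\<pi> h \<otimes>\<^bsub>G\<^esub> \<pi> k) = \<pi> k"
        using c by (simp flip: G.m_assoc)
      then show ?thesis using c by (simp add: G.m_assoc)
    qed
    finally show ?thesis by (simp add: xy f_def)
  qed
  let ?g = "inv_into (carrier ?S) f"
  have "?g \<in> hom G ?S"
  proof (rule homI)
    fix x assume "x \<in> carrier G"
    then show "?g x \<in> carrier ?S" using bij by (simp add: bij_betw_def inv_into_into)
  next
    fix x y assume xy: "x \<in> carrier G" "y \<in> carrier G"
    then have g: "?g x \<in> carrier ?S" "?g y \<in> carrier ?S" "f (?g x) = x" "f (?g y) = y"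
      using bij by (auto simp: bij_betw_def inv_into_into f_inv_into_f)
    then have "x \<otimes>\<^bsub>G\<^esub> y = f (?g x \<otimes>\<^bsub>?S\<^esub> ?g y)" by (simp only: f_mult)
    then show "?g (x \<otimes>\<^bsub>G\<^esub> y) = ?g x \<otimes>\<^bsub>?S\<^esub> ?g y"
      using bij closed g(1,2) by (simp only: bij_betw_def inv_into_f_f)
  qed
  then have "?g \<in> iso G ?S" using bij_betw_inv_into[OF bij] by (simp add: iso_def)
  then show ?thesis unfolding is_iso_def by blast
qed

section \<open>Automorphism groups of algebras\<close>

text \<open>
  Closure of the carrier is what makes composites and inverses of automorphisms preserve the
  operations.
\<close>

locale closed_algebra_operations =
  fixes A :: "('k, 'a) module"
  assumes one_closed: "\<one>\<^bsub>A\<^esub> \<in> carrier A"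
    and mult_closed: "x \<in> carrier A \<Longrightarrow> y \<in> carrier A \<Longrightarrow> x \<otimes>\<^bsub>A\<^esub> y \<in> carrier A"
    and add_closed: "x \<in> carrier A \<Longrightarrow> y \<in> carrier A \<Longrightarrow> x \<oplus>\<^bsub>A\<^esub> y \<in> carrier A"
    and smult_closed: "x \<in> carrier A \<Longrightarrow> c \<odot>\<^bsub>A\<^esub> x \<in> carrier A"
begin

lemma algebra_autoI:
  assumes "f \<in> extensional (carrier A)" "bij_betw f (carrier A) (carrier A)" "f \<one>\<^bsub>A\<^esub> = \<one>\<^bsub>A\<^esub>"
    and "\<And>x y. x \<in> carrier A \<Longrightarrow> y \<in> carrier A \<Longrightarrow> f (x \<otimes>\<^bsub>A\<^esub> y) = f x \<otimes>\<^bsub>A\<^esub> f y"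
    and "\<And>x y. x \<in> carrier A \<Longrightarrow> y \<in> carrier A \<Longrightarrow> f (x \<oplus>\<^bsub>A\<^esub> y) = f x \<oplus>\<^bsub>A\<^esub> f y"
    and "\<And>c x. x \<in> carrier A \<Longrightarrow> f (c \<odot>\<^bsub>A\<^esub> x) = c \<odot>\<^bsub>A\<^esub> f x"
  shows "f \<in> algebra_auto A"
  using assms unfolding algebra_auto_def Bij_def
  by (auto intro!: ring_hom_memI dest: bij_betwE)

lemma algebra_autoD:
  assumes "f \<in> algebra_auto A"
  shows "f \<in> extensional (carrier A)" "bij_betw f (carrier A) (carrier A)" "f \<one>\<^bsub>A\<^esub> = \<one>\<^bsub>A\<^esub>"
    and "\<And>x. x \<in> carrier A \<Longrightarrow> f x \<in> carrier A"
    and "\<And>x y. x \<in> carrier A \<Longrightarrow> y \<in> carrier A \<Longrightarrow> f (x \<otimes>\<^bsub>A\<^esub> y) = f x \<otimes>\<^bsub>A\<^esub> f y"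
    and "\<And>x y. x \<in> carrier A \<Longrightarrow> y \<in> carrier A \<Longrightarrow> f (x \<oplus>\<^bsub>A\<^esub> y) = f x \<oplus>\<^bsub>A\<^esub> f y"
    and "\<And>c x. x \<in> carrier A \<Longrightarrow> f (c \<odot>\<^bsub>A\<^esub> x) = c \<odot>\<^bsub>A\<^esub> f x"
  using assms unfolding algebra_auto_def Bij_def ring_hom_def by auto

lemma inverse_algebra_auto:
  assumes f: "f \<in> algebra_auto A"
  shows "(\<lambda>x\<in>carrier A. inv_into (carrier A) f x) \<in> algebra_auto A"
proof -
  note D = algebra_autoD[OF f]
  let ?g = "inv_into (carrier A) f"
  have g: "?g x \<in> carrier A" "f (?g x) = x" if "x \<in> carrier A" for x
    using D(2) that by (auto simp: bij_betw_def inv_into_into f_inv_into_f)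
  have gf: "?g (f x) = x" if "x \<in> carrier A" for x
    using D(2) that by (simp add: bij_betw_def)
  show ?thesis
  proof (rule algebra_autoI)
    show "bij_betw (\<lambda>x\<in>carrier A. ?g x) (carrier A) (carrier A)"
      using bij_betw_inv_into[OF D(2)] by (simp add: bij_betw_def inj_on_def)
    show "(\<lambda>x\<in>carrier A. ?g x) \<one>\<^bsub>A\<^esub> = \<one>\<^bsub>A\<^esub>" using gf[OF one_closed] D(3) one_closed by simp
  next
    fix x y assume xy: "x \<in> carrier A" "y \<in> carrier A"
    have "?g (x \<otimes>\<^bsub>A\<^esub> y) = ?g x \<otimes>\<^bsub>A\<^esub> ?g y"
      using gf[OF mult_closed[OF g(1)[OF xy(1)] g(1)[OF xy(2)]]] D(5)[OF g(1)[OF xy(1)] g(1)[OF xy(2)]] g(2) xy by simp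
    with xy show "(\<lambda>x\<in>carrier A. ?g x) (x \<otimes>\<^bsub>A\<^esub> y) = (\<lambda>x\<in>carrier A. ?g x) x \<otimes>\<^bsub>A\<^esub> (\<lambda>x\<in>carrier A. ?g x) y"
      by (simp add: mult_closed)
    have "?g (x \<oplus>\<^bsub>A\<^esub> y) = ?g x \<oplus>\<^bsub>A\<^esub> ?g y"
      using gf[OF add_closed[OF g(1)[OF xy(1)] g(1)[OF xy(2)]]] D(6)[OF g(1)[OF xy(1)] g(1)[OF xy(2)]] g(2) xy by simp
    with xy show "(\<lambda>x\<in>carrier A. ?g x) (x \<oplus>\<^bsub>A\<^esub> y) = (\<lambda>x\<in>carrier A. ?g x) x \<oplus>\<^bsub>A\<^esub> (\<lambda>x\<in>carrier A. ?g x) y"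
      by (simp add: add_closed)
  next
    fix c x assume x: "x \<in> carrier A"
    have "?g (c \<odot>\<^bsub>A\<^esub> x) = c \<odot>\<^bsub>A\<^esub> ?g x"
      using gf[OF smult_closed[OF g(1)[OF x]]] D(7)[OF g(1)[OF x]] g(2)[OF x] by simp
    with x show "(\<lambda>x\<in>carrier A. ?g x) (c \<odot>\<^bsub>A\<^esub> x) = c \<odot>\<^bsub>A\<^esub> (\<lambda>x\<in>carrier A. ?g x) x"
      by (simp add: smult_closed)
  qed simp
qed

lemma compose_algebra_auto:
  assumes f: "f \<in> algebra_auto A" and g: "g \<in> algebra_auto A"
  shows "compose (carrier A) f g \<in> algebra_auto A"
proof (rule algebra_autoI)
  note D = algebra_autoD[OF f] and E = algebra_autoD[OF g]
  show "bij_betw (compose (carrier A) f g) (carrier A) (carrier A)"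
    by (rule bij_betw_compose[OF E(2) D(2)])
qed (simp_all add: compose_def one_closed mult_closed add_closed smult_closed algebra_autoD[OF f] algebra_autoD[OF g])

lemma id_algebra_auto: "(\<lambda>x\<in>carrier A. x) \<in> algebra_auto A"
  by (rule algebra_autoI) (auto simp: one_closed mult_closed add_closed smult_closed bij_betw_def inj_on_def)

lemma subgroup_algebra_auto: "subgroup (algebra_auto A) (BijGroup (carrier A))"
proof (rule subgroup.intro)
  have Bij: "f \<in> Bij (carrier A)" if "f \<in> algebra_auto A" for f
    using that by (simp add: algebra_auto_def)
  then show "algebra_auto A \<subseteq> carrier (BijGroup (carrier A))" by (auto simp: BijGroup_def)
  fix f g assume "f \<in> algebra_auto A" "g \<in> algebra_auto A"
  then show "f \<otimes>\<^bsub>BijGroup (carrier A)\<^esub> g \<in> algebra_auto A"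
    using Bij compose_algebra_auto by (simp add: BijGroup_def)
next
  show "\<one>\<^bsub>BijGroup (carrier A)\<^esub> \<in> algebra_auto A"
    using id_algebra_auto by (simp add: BijGroup_def)
next
  fix f assume f: "f \<in> algebra_auto A"
  then have "f \<in> Bij (carrier A)" by (simp add: algebra_auto_def)
  then show "inv\<^bsub>BijGroup (carrier A)\<^esub> f \<in> algebra_auto A"
    using inverse_algebra_auto[OF f] by (simp only: inv_BijGroup)
qed

lemma group_Algebra_Aut: "group (Algebra_Aut A)"
  unfolding Algebra_Aut_def by (rule subgroup.subgroup_is_group[OF subgroup_algebra_auto group_BijGroup])

lemma Algebra_Aut_mult:
  assumes "f \<in> algebra_auto A" "g \<in> algebra_auto A"
  shows "f \<otimes>\<^bsub>Algebra_Aut A\<^esub> g = compose (carrier A) f g"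
  using assms by (simp add: Algebra_Aut_def BijGroup_def algebra_auto_def)

end

lemma carrier_Algebra_Aut [simp]: "carrier (Algebra_Aut A) = algebra_auto A"
  by (simp add: Algebra_Aut_def)

section \<open>Automorphisms in coordinates\<close>

lemma minus_one_neq_one:
  assumes "CHAR('k::field) \<noteq> 2"
  shows "(- 1 :: 'k) \<noteq> 1"
proof
  assume "(- 1 :: 'k) = 1"
  then have "(of_nat 2 :: 'k) = 0" by (metis add.right_inverse of_nat_numeral one_add_one)
  then have "CHAR('k) dvd 2" by (simp only: of_nat_eq_0_iff_char_dvd)
  moreover have "CHAR('k) \<noteq> 1" using CHAR_not_1[where 'a = 'k] by (simp add: One_nat_def)
  ultimately show False using assms by (metis prime_nat_iff two_is_prime_nat)
qed

lemma bij_betw_skew_elem_veronese: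
  assumes "v > 0"
  shows "bij_betw (skew_elem q n) (veronese_span n v) (carrier (skew_veronese q n v))"
  unfolding carrier_skew_veronese[OF assms]
  using bij_betw_imp_inj_on[OF bij_betw_skew_elem] veronese_span_subset inj_on_subset
  by (metis inj_on_imp_bij_betw)

lemma skew_elem_closed: "v > 0 \<Longrightarrow> p \<in> veronese_span n v \<Longrightarrow> skew_elem q n p \<in> carrier (skew_veronese q n v)"
  by (simp add: carrier_skew_veronese)

lemma skew_elem_inject:
  "p \<in> veronese_span n v \<Longrightarrow> p' \<in> veronese_span n v \<Longrightarrow> skew_elem q n p = skew_elem q n p' \<longleftrightarrow> p = p'"
  using bij_betw_imp_inj_on[OF bij_betw_skew_elem, of q n] veronese_span_subset[of n v]
  by (meson inj_on_eq_iff subsetD)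

lemma veronese_elem_ops:
  assumes "p \<in> veronese_span n v" "p' \<in> veronese_span n v"
  shows "skew_elem q n p \<oplus>\<^bsub>skew_veronese q n v\<^esub> skew_elem q n p' = skew_elem q n (p + p')"
    and "skew_elem q n p \<otimes>\<^bsub>skew_veronese q n v\<^esub> skew_elem q n p' = skew_elem q n (qmul q p p')"
    and "c \<odot>\<^bsub>skew_veronese q n v\<^esub> skew_elem q n p = skew_elem q n (qmul q (Poly_Mapping.single {#} c) p)"
    and "\<one>\<^bsub>skew_veronese q n v\<^esub> = skew_elem q n (Poly_Mapping.single {#} 1)"
  using assms subsetD[OF veronese_span_subset]
  by (auto simp only: skew_veronese_sel skew_elem_one intro!: skew_elem_add skew_elem_mult skew_elem_smult)

lemma closed_algebra_operations_veronese:
  assumes "v > 0"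
  shows "closed_algebra_operations (skew_veronese q n v)"
proof
  show "\<one>\<^bsub>skew_veronese q n v\<^esub> \<in> carrier (skew_veronese q n v)"
    using skew_elem_closed[OF assms veronese_span_single[OF veronese_exponents_empty]]
    by (simp only: skew_veronese_sel skew_elem_one)
next
  fix x y assume "x \<in> carrier (skew_veronese q n v)" "y \<in> carrier (skew_veronese q n v)"
  then obtain p r where *: "x = skew_elem q n p" "y = skew_elem q n r" "p \<in> veronese_span n v" "r \<in> veronese_span n v"
    unfolding carrier_skew_veronese[OF assms] by blast
  show "x \<otimes>\<^bsub>skew_veronese q n v\<^esub> y \<in> carrier (skew_veronese q n v)"
    unfolding *(1,2) veronese_elem_ops(2)[OF *(3,4)] using * by (intro skew_elem_closed[OF assms] veronese_span_qmul)
  show "x \<oplus>\<^bsub>skew_veronese q n v\<^esub> y \<in> carrier (skew_veronese q n v)"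
    unfolding *(1,2) veronese_elem_ops(1)[OF *(3,4)] using * by (intro skew_elem_closed[OF assms] veronese_span_add)
next
  fix c x assume "x \<in> carrier (skew_veronese q n v)"
  then obtain p where *: "x = skew_elem q n p" "p \<in> veronese_span n v"
    unfolding carrier_skew_veronese[OF assms] by blast
  show "c \<odot>\<^bsub>skew_veronese q n v\<^esub> x \<in> carrier (skew_veronese q n v)"
    unfolding *(1) veronese_elem_ops(3)[OF *(2,2)] using *
    by (intro skew_elem_closed[OF assms] veronese_span_qmul veronese_span_single veronese_exponents_empty)
qed

text \<open>
  The map on the Veronese subring that \<open>\<Phi>\<close> describes in coordinates. Restriction to the carrier is
  needed because automorphisms are extensional functions.
\<close>

definition coordinate_aut :: "'k::field \<Rightarrow> nat \<Rightarrow> nat \<Rightarrow> ((nat multiset \<Rightarrow>\<^sub>0 'k) \<Rightarrow> nat multiset \<Rightarrow>\<^sub>0 'k) \<Rightarrow>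
    (nat word \<Rightarrow>\<^sub>0 'k) set \<Rightarrow> (nat word \<Rightarrow>\<^sub>0 'k) set" where
  "coordinate_aut q n v \<Phi> =
    (\<lambda>y\<in>carrier (skew_veronese q n v). skew_elem q n (\<Phi> (inv_into (veronese_span n v) (skew_elem q n) y)))"

lemma coordinate_aut_elem:
  assumes "v > 0" "p \<in> veronese_span n v"
  shows "coordinate_aut q n v \<Phi> (skew_elem q n p) = skew_elem q n (\<Phi> p)"
  using assms bij_betw_inv_into_left[OF bij_betw_skew_elem_veronese[OF assms(1)] assms(2), of q]
  by (simp add: coordinate_aut_def skew_elem_closed)

lemma coordinate_aut_algebra_auto:
  assumes v: "v > 0"
    and closed: "\<And>p. p \<in> veronese_span n v \<Longrightarrow> \<Phi> p \<in> veronese_span n v"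
    and closed': "\<And>p. p \<in> veronese_span n v \<Longrightarrow> \<Psi> p \<in> veronese_span n v"
    and inv: "\<And>p. p \<in> veronese_span n v \<Longrightarrow> \<Psi> (\<Phi> p) = p"
    and inv': "\<And>p. p \<in> veronese_span n v \<Longrightarrow> \<Phi> (\<Psi> p) = p"
    and add: "\<And>p r. p \<in> veronese_span n v \<Longrightarrow> r \<in> veronese_span n v \<Longrightarrow> \<Phi> (p + r) = \<Phi> p + \<Phi> r"
    and mult: "\<And>p r. p \<in> veronese_span n v \<Longrightarrow> r \<in> veronese_span n v \<Longrightarrow> \<Phi> (qmul q p r) = qmul q (\<Phi> p) (\<Phi> r)"
    and const: "\<And>c. \<Phi> (Poly_Mapping.single {#} c) = Poly_Mapping.single {#} c"
  shows "coordinate_aut q n v \<Phi> \<in> algebra_auto (skew_veronese q n v)"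
proof -
  interpret closed_algebra_operations "skew_veronese q n v" by (rule closed_algebra_operations_veronese[OF v])
  note car = carrier_skew_veronese[OF v, of q n]
  note ev = coordinate_aut_elem[OF v]
  have one: "Poly_Mapping.single {#} c \<in> veronese_span n v" for c :: 'a
    by (rule veronese_span_single[OF veronese_exponents_empty])
  show ?thesis
  proof (rule algebra_autoI)
    show "coordinate_aut q n v \<Phi> \<in> extensional (carrier (skew_veronese q n v))"
      by (simp add: coordinate_aut_def)
    show "bij_betw (coordinate_aut q n v \<Phi>) (carrier (skew_veronese q n v)) (carrier (skew_veronese q n v))"
    proof (rule bij_betwI[where g = "coordinate_aut q n v \<Psi>"])
      show "coordinate_aut q n v \<Phi> \<in> carrier (skew_veronese q n v) \<rightarrow> carrier (skew_veronese q n v)"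
        "coordinate_aut q n v \<Psi> \<in> carrier (skew_veronese q n v) \<rightarrow> carrier (skew_veronese q n v)"
        using closed closed' by (auto simp: car ev)
      fix x assume "x \<in> carrier (skew_veronese q n v)"
      then obtain p where "x = skew_elem q n p" "p \<in> veronese_span n v" unfolding car by blast
      then show "coordinate_aut q n v \<Psi> (coordinate_aut q n v \<Phi> x) = x" "coordinate_aut q n v \<Phi> (coordinate_aut q n v \<Psi> x) = x"
        by (simp_all add: ev closed closed' inv inv')
    qed
    show "coordinate_aut q n v \<Phi> \<one>\<^bsub>skew_veronese q n v\<^esub> = \<one>\<^bsub>skew_veronese q n v\<^esub>"
      unfolding veronese_elem_ops(4)[OF one one] ev[OF one] const ..
  next
    fix x y assume "x \<in> carrier (skew_veronese q n v)" "y \<in> carrier (skew_veronese q n v)"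
    then obtain p r where *: "x = skew_elem q n p" "y = skew_elem q n r" "p \<in> veronese_span n v" "r \<in> veronese_span n v"
      unfolding car by blast
    note ops = veronese_elem_ops[OF *(3,4), of q] veronese_elem_ops[OF closed[OF *(3)] closed[OF *(4)], of q]
    show "coordinate_aut q n v \<Phi> (x \<otimes>\<^bsub>skew_veronese q n v\<^esub> y) =
        coordinate_aut q n v \<Phi> x \<otimes>\<^bsub>skew_veronese q n v\<^esub> coordinate_aut q n v \<Phi> y"
      unfolding *(1,2) ops(2) ev[OF *(3)] ev[OF *(4)] ops(6) ev[OF veronese_span_qmul[OF *(3,4)]] mult[OF *(3,4)] ..
    show "coordinate_aut q n v \<Phi> (x \<oplus>\<^bsub>skew_veronese q n v\<^esub> y) =
        coordinate_aut q n v \<Phi> x \<oplus>\<^bsub>skew_veronese q n v\<^esub> coordinate_aut q n v \<Phi> y"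
      unfolding *(1,2) ops(1) ev[OF *(3)] ev[OF *(4)] ops(5) ev[OF veronese_span_add[OF *(3,4)]] add[OF *(3,4)] ..
  next
    fix c x assume "x \<in> carrier (skew_veronese q n v)"
    then obtain p where *: "x = skew_elem q n p" "p \<in> veronese_span n v" unfolding car by blast
    show "coordinate_aut q n v \<Phi> (c \<odot>\<^bsub>skew_veronese q n v\<^esub> x) = c \<odot>\<^bsub>skew_veronese q n v\<^esub> coordinate_aut q n v \<Phi> x"
      unfolding *(1) veronese_elem_ops(3)[OF *(2,2)] ev[OF *(2)] ev[OF veronese_span_qmul[OF one *(2)]]
        veronese_elem_ops(3)[OF closed[OF *(2)] closed[OF *(2)]] mult[OF one *(2)] const ..
  qed
qed

definition coordinate_map :: "'k::field \<Rightarrow> nat \<Rightarrow> nat \<Rightarrow> ((nat word \<Rightarrow>\<^sub>0 'k) set \<Rightarrow> (nat word \<Rightarrow>\<^sub>0 'k) set) \<Rightarrow>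
    (nat multiset \<Rightarrow>\<^sub>0 'k) \<Rightarrow> nat multiset \<Rightarrow>\<^sub>0 'k" where
  "coordinate_map q n v \<phi> p = inv_into (veronese_span n v) (skew_elem q n) (\<phi> (skew_elem q n p))"

lemma
  assumes v: "v > 0" and \<phi>: "\<phi> \<in> algebra_auto (skew_veronese q n v)"
  shows coordinate_map_closed: "p \<in> veronese_span n v \<Longrightarrow> coordinate_map q n v \<phi> p \<in> veronese_span n v"
    and skew_elem_coordinate_map: "p \<in> veronese_span n v \<Longrightarrow> skew_elem q n (coordinate_map q n v \<phi> p) = \<phi> (skew_elem q n p)"
    and coordinate_map_add: "p \<in> veronese_span n v \<Longrightarrow> r \<in> veronese_span n v \<Longrightarrow>
      coordinate_map q n v \<phi> (p + r) = coordinate_map q n v \<phi> p + coordinate_map q n v \<phi> r"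
    and coordinate_map_mult: "p \<in> veronese_span n v \<Longrightarrow> r \<in> veronese_span n v \<Longrightarrow>
      coordinate_map q n v \<phi> (qmul q p r) = qmul q (coordinate_map q n v \<phi> p) (coordinate_map q n v \<phi> r)"
    and coordinate_map_const: "coordinate_map q n v \<phi> (Poly_Mapping.single {#} c) = Poly_Mapping.single {#} c"
proof -
  interpret closed_algebra_operations "skew_veronese q n v" by (rule closed_algebra_operations_veronese[OF v])
  note D = algebra_autoD[OF \<phi>]
  note bij = bij_betw_skew_elem_veronese[OF v, of q n]
  show closed: "coordinate_map q n v \<phi> p \<in> veronese_span n v"
    and elem: "skew_elem q n (coordinate_map q n v \<phi> p) = \<phi> (skew_elem q n p)" if "p \<in> veronese_span n v" for p
    using D(4)[OF skew_elem_closed[OF v that]] bij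
    by (auto simp: coordinate_map_def bij_betw_def inv_into_into f_inv_into_f)
  have one: "Poly_Mapping.single {#} c \<in> veronese_span n v" for c :: 'a
    by (rule veronese_span_single[OF veronese_exponents_empty])
  show "coordinate_map q n v \<phi> (p + r) = coordinate_map q n v \<phi> p + coordinate_map q n v \<phi> r"
    if pr: "p \<in> veronese_span n v" "r \<in> veronese_span n v" for p r
  proof -
    have "skew_elem q n (coordinate_map q n v \<phi> (p + r)) = skew_elem q n (coordinate_map q n v \<phi> p + coordinate_map q n v \<phi> r)"
      unfolding elem[OF veronese_span_add[OF pr]] veronese_elem_ops(1)[OF closed closed, OF pr, symmetric]
        veronese_elem_ops(1)[OF pr, symmetric] elem[OF pr(1)] elem[OF pr(2)]
      by (intro D(6) skew_elem_closed v pr)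
    then show ?thesis by (simp only: skew_elem_inject[OF closed[OF veronese_span_add[OF pr]] veronese_span_add[OF closed[OF pr(1)] closed[OF pr(2)]]])
  qed
  show "coordinate_map q n v \<phi> (qmul q p r) = qmul q (coordinate_map q n v \<phi> p) (coordinate_map q n v \<phi> r)"
    if pr: "p \<in> veronese_span n v" "r \<in> veronese_span n v" for p r
  proof -
    have "skew_elem q n (coordinate_map q n v \<phi> (qmul q p r)) = skew_elem q n (qmul q (coordinate_map q n v \<phi> p) (coordinate_map q n v \<phi> r))"
      unfolding elem[OF veronese_span_qmul[OF pr]] veronese_elem_ops(2)[OF closed closed, OF pr, symmetric]
        veronese_elem_ops(2)[OF pr, symmetric] elem[OF pr(1)] elem[OF pr(2)]
      by (intro D(5) skew_elem_closed v pr)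
    then show ?thesis by (simp only: skew_elem_inject[OF closed[OF veronese_span_qmul[OF pr]] veronese_span_qmul[OF closed[OF pr(1)] closed[OF pr(2)]]])
  qed
  show "coordinate_map q n v \<phi> (Poly_Mapping.single {#} c) = Poly_Mapping.single {#} c"
  proof -
    have c: "skew_elem q n (Poly_Mapping.single {#} c) = c \<odot>\<^bsub>skew_veronese q n v\<^esub> \<one>\<^bsub>skew_veronese q n v\<^esub>"
      unfolding veronese_elem_ops(4)[OF one one] veronese_elem_ops(3)[OF one one] by (simp only: qmul_single) simp
    have "\<phi> (skew_elem q n (Poly_Mapping.single {#} c)) = skew_elem q n (Poly_Mapping.single {#} c)"
      unfolding c D(7)[OF one_closed] D(3) ..
    then have "skew_elem q n (coordinate_map q n v \<phi> (Poly_Mapping.single {#} c)) = skew_elem q n (Poly_Mapping.single {#} c)"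
      unfolding elem[OF one] .
    then show ?thesis by (simp only: skew_elem_inject[OF closed[OF one] one])
  qed
qed

text \<open>
  Automorphisms are linear and the monomials span.
\<close>

lemma algebra_auto_eqI:
  assumes v: "v > 0" and \<phi>: "\<phi> \<in> algebra_auto (skew_veronese q n v)" and \<psi>: "\<psi> \<in> algebra_auto (skew_veronese q n v)"
    and eq: "\<And>M. M \<in> veronese_exponents n v \<Longrightarrow> \<phi> (skew_elem q n (xmon M)) = \<psi> (skew_elem q n (xmon M))"
  shows "\<phi> = \<psi>"
proof -
  interpret closed_algebra_operations "skew_veronese q n v" by (rule closed_algebra_operations_veronese[OF v])
  note D = algebra_autoD[OF \<phi>] and E = algebra_autoD[OF \<psi>]
  have single: "\<phi> (skew_elem q n (Poly_Mapping.single M c)) = \<psi> (skew_elem q n (Poly_Mapping.single M c))"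
    if M: "M \<in> veronese_exponents n v" for M c
  proof -
    have mem: "xmon M \<in> veronese_span n v" by (rule veronese_span_single[OF M])
    have c: "skew_elem q n (Poly_Mapping.single M c) = c \<odot>\<^bsub>skew_veronese q n v\<^esub> skew_elem q n (xmon M)"
      unfolding veronese_elem_ops(3)[OF mem mem] by (simp add: qmul_single)
    show ?thesis
      unfolding c D(7)[OF skew_elem_closed[OF v mem]] E(7)[OF skew_elem_closed[OF v mem]] eq[OF M] ..
  qed
  have "\<phi> (skew_elem q n p) = \<psi> (skew_elem q n p)" if "p \<in> veronese_span n v" for p
  proof -
    from that have "Poly_Mapping.keys p \<subseteq> veronese_exponents n v" by (simp add: veronese_span_def)
    then show ?thesis
    proof (induction p rule: poly_mapping_induct_keys)
      case (add f g)
      then have mem: "f \<in> veronese_span n v" "g \<in> veronese_span n v" by (simp_all add: veronese_span_def)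
      show ?case
        unfolding veronese_elem_ops(1)[OF mem, symmetric]
          D(6)[OF skew_elem_closed[OF v mem(1)] skew_elem_closed[OF v mem(2)]]
          E(6)[OF skew_elem_closed[OF v mem(1)] skew_elem_closed[OF v mem(2)]] add.IH ..
    next
      case zero
      show ?case using single[OF veronese_exponents_empty, of 0] by simp
    qed (rule single)
  qed
  then have "\<phi> y = \<psi> y" if "y \<in> carrier (skew_veronese q n v)" for y
    using that unfolding carrier_skew_veronese[OF v] by blast
  then show ?thesis by (rule extensionalityI[OF D(1) E(1)])
qed

section \<open>Actions on monomials\<close>

text \<open>
  The common shape of all automorphisms: \<open>x\<^sup>M\<close> goes to \<open>c(M)\<close> times the monomial obtained by permuting
  the variables.
\<close>

definition acts_by :: "'k::field \<Rightarrow> nat \<Rightarrow> nat \<Rightarrow> ((nat word \<Rightarrow>\<^sub>0 'k) set \<Rightarrow> (nat word \<Rightarrow>\<^sub>0 'k) set) \<Rightarrow>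
    (nat \<Rightarrow> nat) \<Rightarrow> (nat multiset \<Rightarrow> 'k) \<Rightarrow> bool" where
  "acts_by q n v g \<sigma> c \<longleftrightarrow> (\<forall>M\<in>veronese_exponents n v.
     g (skew_elem q n (xmon M)) = skew_elem q n (Poly_Mapping.single (image_mset \<sigma> M) (c M)))"

lemma image_mset_support:
  assumes "\<sigma> permutes {1..n}" "M \<in> veronese_exponents n v"
  shows "image_mset \<sigma> M \<in> veronese_exponents n v"
  using assms(2) permutes_in_image[OF assms(1)] by (auto simp: veronese_exponents_def)

lemma skew_elem_single_scale:
  assumes "M \<in> veronese_exponents n v"
  shows "skew_elem q n (Poly_Mapping.single M (a * b)) =
    a \<odot>\<^bsub>skew_veronese q n v\<^esub> skew_elem q n (Poly_Mapping.single M b)"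
  unfolding veronese_elem_ops(3)[OF veronese_span_single[OF assms] veronese_span_single[OF assms]]
  by (simp add: qmul_single)

lemma acts_by_single:
  assumes v: "v > 0" and g: "g \<in> algebra_auto (skew_veronese q n v)" "acts_by q n v g \<sigma> c"
    and \<sigma>: "\<sigma> permutes {1..n}" and M: "M \<in> veronese_exponents n v"
  shows "g (skew_elem q n (Poly_Mapping.single M a)) = skew_elem q n (Poly_Mapping.single (image_mset \<sigma> M) (a * c M))"
proof -
  interpret closed_algebra_operations "skew_veronese q n v" by (rule closed_algebra_operations_veronese[OF v])
  have "g (skew_elem q n (Poly_Mapping.single M (a * 1)))
      = a \<odot>\<^bsub>skew_veronese q n v\<^esub> g (skew_elem q n (xmon M))"
    unfolding skew_elem_single_scale[OF M]
    by (intro algebra_autoD(7)[OF g(1)] skew_elem_closed[OF v] veronese_span_single M)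
  also have "\<dots> = skew_elem q n (Poly_Mapping.single (image_mset \<sigma> M) (a * c M))"
    using g(2) M by (simp add: acts_by_def skew_elem_single_scale[OF image_mset_support[OF \<sigma> M]])
  finally show ?thesis by simp
qed

lemma acts_by_compose:
  assumes v: "v > 0" and g: "g \<in> algebra_auto (skew_veronese q n v)" "acts_by q n v g \<sigma> c" "\<sigma> permutes {1..n}"
    and h: "h \<in> algebra_auto (skew_veronese q n v)" "acts_by q n v h \<tau> d" "\<tau> permutes {1..n}"
  shows "acts_by q n v (g \<otimes>\<^bsub>Algebra_Aut (skew_veronese q n v)\<^esub> h) (\<sigma> \<circ> \<tau>) (\<lambda>M. d M * c (image_mset \<tau> M))"
  unfolding acts_by_def
proof
  interpret closed_algebra_operations "skew_veronese q n v" by (rule closed_algebra_operations_veronese[OF v])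
  fix M assume M: "M \<in> veronese_exponents n v"
  have "(g \<otimes>\<^bsub>Algebra_Aut (skew_veronese q n v)\<^esub> h) (skew_elem q n (xmon M)) = g (h (skew_elem q n (xmon M)))"
    unfolding Algebra_Aut_mult[OF g(1) h(1)]
    by (intro compose_eq skew_elem_closed[OF v] veronese_span_single M)
  also have "h (skew_elem q n (xmon M)) = skew_elem q n (Poly_Mapping.single (image_mset \<tau> M) (d M))"
    using h(2) M by (simp add: acts_by_def)
  also have "g \<dots> = skew_elem q n (Poly_Mapping.single (image_mset (\<sigma> \<circ> \<tau>) M) (d M * c (image_mset \<tau> M)))"
    unfolding acts_by_single[OF v g image_mset_support[OF h(3) M]] by (simp add: image_mset.compositionality)
  finally show "(g \<otimes>\<^bsub>Algebra_Aut (skew_veronese q n v)\<^esub> h) (skew_elem q n (xmon M)) =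
      skew_elem q n (Poly_Mapping.single (image_mset (\<sigma> \<circ> \<tau>) M) (d M * c (image_mset \<tau> M)))" .
qed

text \<open>
  In coordinates, the automorphism and its inverse satisfy the conditions under which monomials are
  known to be permuted up to scalars.
\<close>

lemma algebra_auto_acts_by:
  assumes char: "CHAR('k::field) \<noteq> 2" and n: "n \<ge> 2" and v: "v > 0" and parity: "even n \<longleftrightarrow> odd v"
    and g: "g \<in> algebra_auto (skew_veronese (- 1 :: 'k) n v)"
  shows "\<exists>\<sigma> c. \<sigma> permutes {1..n} \<and> acts_by (- 1) n v g \<sigma> c"
proof -
  interpret closed_algebra_operations "skew_veronese (- 1 :: 'k) n v"
    by (rule closed_algebra_operations_veronese[OF v])
  define h where "h = (\<lambda>x\<in>carrier (skew_veronese (- 1) n v). inv_into (carrier (skew_veronese (- 1) n v)) g x)"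
  have h: "h \<in> algebra_auto (skew_veronese (- 1) n v)" unfolding h_def by (rule inverse_algebra_auto[OF g])
  have inv: "h (g x) = x" "g (h x) = x" if "x \<in> carrier (skew_veronese (- 1) n v)" for x
    using that algebra_autoD(2,4)[OF g] by (auto simp: h_def bij_betw_def f_inv_into_f)
  have hg: "coordinate_map (- 1) n v h (coordinate_map (- 1) n v g p) = p"
    if p: "p \<in> veronese_span n v" for p
  proof -
    have "skew_elem (- 1) n (coordinate_map (- 1) n v h (coordinate_map (- 1) n v g p)) = skew_elem (- 1) n p"
      unfolding skew_elem_coordinate_map[OF v h coordinate_map_closed[OF v g p]] skew_elem_coordinate_map[OF v g p]
      by (rule inv(1)[OF skew_elem_closed[OF v p]])
    then show ?thesis
      by (simp only: skew_elem_inject[OF coordinate_map_closed[OF v h coordinate_map_closed[OF v g p]] p])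
  qed
  have gh: "coordinate_map (- 1) n v g (coordinate_map (- 1) n v h p) = p"
    if p: "p \<in> veronese_span n v" for p
  proof -
    have "skew_elem (- 1) n (coordinate_map (- 1) n v g (coordinate_map (- 1) n v h p)) = skew_elem (- 1) n p"
      unfolding skew_elem_coordinate_map[OF v g coordinate_map_closed[OF v h p]] skew_elem_coordinate_map[OF v h p]
      by (rule inv(2)[OF skew_elem_closed[OF v p]])
    then show ?thesis
      by (simp only: skew_elem_inject[OF coordinate_map_closed[OF v g coordinate_map_closed[OF v h p]] p])
  qed
  interpret skew_veronese_inverse_endos n v "coordinate_map (- 1 :: 'k) n v g" "coordinate_map (- 1) n v h"
    by unfold_locales (fact minus_one_neq_one[OF char] n v parity
      coordinate_map_closed[OF v g] coordinate_map_closed[OF v h] coordinate_map_add[OF v g] coordinate_map_add[OF v h]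
      coordinate_map_mult[OF v g] coordinate_map_mult[OF v h] coordinate_map_const[OF v g] coordinate_map_const[OF v h] hg gh)+
  obtain \<sigma> c where \<sigma>: "\<sigma> permutes {1..n}"
    and c: "\<forall>M\<in>veronese_exponents n v. c M \<noteq> 0 \<and> coordinate_map (- 1) n v g (xmon M) = Poly_Mapping.single (image_mset \<sigma> M) (c M)"
    using monomials_permuted by blast
  have "acts_by (- 1) n v g \<sigma> c"
    unfolding acts_by_def
  proof
    fix M assume M: "M \<in> veronese_exponents n v"
    show "g (skew_elem (- 1) n (xmon M)) = skew_elem (- 1) n (Poly_Mapping.single (image_mset \<sigma> M) (c M))"
      using c M by (simp flip: skew_elem_coordinate_map[OF v g veronese_span_single[OF M]])
  qed
  with \<sigma> show ?thesis by blast
qed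

section \<open>The torus\<close>

definition diag_map :: "(nat multiset \<Rightarrow> 'k) \<Rightarrow> (nat multiset \<Rightarrow>\<^sub>0 'k) \<Rightarrow> nat multiset \<Rightarrow>\<^sub>0 'k::field" where
  "diag_map d p = (\<Sum>M\<in>Poly_Mapping.keys p. Poly_Mapping.single M (d M * Poly_Mapping.lookup p M))"

lemma diag_map_add: "diag_map d (p + r) = diag_map d p + diag_map d r"
  unfolding diag_map_def
  by (rule setsum_keys_plus_distrib[where f = "\<lambda>M a. Poly_Mapping.single M (d M * a)"])
    (simp_all add: distrib_left single_add)

lemma diag_map_single: "diag_map d (Poly_Mapping.single M a) = Poly_Mapping.single M (d M * a)"
  by (simp add: diag_map_def)

lemma diag_map_zero [simp]: "diag_map d 0 = 0"
  by (simp add: diag_map_def)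

lemma diag_map_closed: "p \<in> veronese_span n v \<Longrightarrow> diag_map d p \<in> veronese_span n v"
  unfolding diag_map_def by (intro veronese_span_sum veronese_span_single) (auto simp: veronese_span_def)

lemma diag_map_inverse:
  assumes "\<And>M. M \<in> veronese_exponents n v \<Longrightarrow> d M * e M = 1" "p \<in> veronese_span n v"
  shows "diag_map d (diag_map e p) = p"
proof -
  from assms(2) have "Poly_Mapping.keys p \<subseteq> veronese_exponents n v" by (simp add: veronese_span_def)
  then show ?thesis
    by (induction p rule: poly_mapping_induct_keys)
      (simp_all add: diag_map_single diag_map_add assms(1) flip: mult.assoc)
qed

lemma diag_map_mult:
  assumes "\<And>A B. A \<in> veronese_exponents n v \<Longrightarrow> B \<in> veronese_exponents n v \<Longrightarrow> d (A + B) = d A * d B"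
    and "p \<in> veronese_span n v" "r \<in> veronese_span n v"
  shows "diag_map d (qmul q p r) = qmul q (diag_map d p) (diag_map d r)"
proof -
  from assms(2) have "Poly_Mapping.keys p \<subseteq> veronese_exponents n v" by (simp add: veronese_span_def)
  then show ?thesis
  proof (induction p rule: poly_mapping_induct_keys)
    case (single A a)
    from assms(3) have "Poly_Mapping.keys r \<subseteq> veronese_exponents n v" by (simp add: veronese_span_def)
    then show ?case
    proof (induction r rule: poly_mapping_induct_keys)
      case (single B b)
      then show ?case
        using \<open>A \<in> veronese_exponents n v\<close> by (simp add: qmul_single diag_map_single assms(1) mult_ac)
    qed (simp_all add: qmul_add_right diag_map_add)
  qed (simp_all add: qmul_add_left diag_map_add)
qed

text \<open>
  A multiplicative system of scalars is compatible with \<open>x\<^sup>M x\<^sup>N = \<plusminus>x\<^sup>M\<^sup>+\<^sup>N\<close>.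
\<close>

lemma exists_diagonal_auto:
  assumes v: "v > 0"
    and mult: "\<And>A B. A \<in> veronese_exponents n v \<Longrightarrow> B \<in> veronese_exponents n v \<Longrightarrow> d (A + B) = d A * d B"
    and nz: "\<And>A. A \<in> veronese_exponents n v \<Longrightarrow> d A \<noteq> 0"
  shows "\<exists>g\<in>algebra_auto (skew_veronese q n v). acts_by q n v g id d"
proof -
  have "d {#} * d {#} = d {#}" using mult[of "{#}" "{#}"] by simp
  then have d1: "d {#} = 1" using nz[of "{#}"] by simp
  have "coordinate_aut q n v (diag_map d) \<in> algebra_auto (skew_veronese q n v)"
  proof (rule coordinate_aut_algebra_auto[where \<Psi> = "diag_map (\<lambda>M. 1 / d M)"])
    show "diag_map (\<lambda>M. 1 / d M) (diag_map d p) = p" "diag_map d (diag_map (\<lambda>M. 1 / d M) p) = p"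
      if "p \<in> veronese_span n v" for p
      by (rule diag_map_inverse[OF _ that]; simp add: nz)+
    show "diag_map d (qmul q p r) = qmul q (diag_map d p) (diag_map d r)"
      if "p \<in> veronese_span n v" "r \<in> veronese_span n v" for p r
      by (rule diag_map_mult[OF mult that])
  qed (simp_all add: v diag_map_closed diag_map_add diag_map_single d1)
  moreover have "acts_by q n v (coordinate_aut q n v (diag_map d)) id d"
    unfolding acts_by_def
    by (simp add: coordinate_aut_elem[OF v veronese_span_single] diag_map_single)
  ultimately show ?thesis by blast
qed

text \<open>
  The scalar by which the point \<open>(c, k\<^sub>2, \<dots>, k\<^sub>n)\<close> of the torus acts on \<open>x\<^sup>M\<close>, with \<open>c = t 1\<close>.
\<close>

definition torus_weight :: "nat \<Rightarrow> nat \<Rightarrow> (nat \<Rightarrow> 'k::field) \<Rightarrow> nat multiset \<Rightarrow> 'k" where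
  "torus_weight n v t M = t 1 ^ (size M div v) * (\<Prod>i=2..n. t i ^ count M i)"

lemma mem_torus_iff:
  "t \<in> carrier (torus n) \<longleftrightarrow> t \<in> extensional {1..n} \<and> (\<forall>i\<in>{1..n}. t i \<noteq> 0)"
  by (auto simp: torus_def PiE_def Pi_def ring_of_type_algebra_def)

lemma torus_mult: "t \<otimes>\<^bsub>torus n\<^esub> u = (\<lambda>i\<in>{1..n}. t i * u i)"
  by (simp add: torus_def ring_of_type_algebra_def)

lemma torus_weight_add:
  assumes "A \<in> veronese_exponents n v" "B \<in> veronese_exponents n v"
  shows "torus_weight n v t (A + B) = torus_weight n v t A * torus_weight n v t B"
proof -
  have "(size A + size B) div v = size A div v + size B div v"
    using assms by (simp add: veronese_exponents_def div_plus_div_distrib_dvd_left)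
  then show ?thesis
    by (simp add: torus_weight_def power_add prod.distrib mult_ac)
qed

lemma torus_weight_nonzero: "n \<ge> 2 \<Longrightarrow> t \<in> carrier (torus n) \<Longrightarrow> torus_weight n v t A \<noteq> 0"
  by (auto simp: torus_weight_def mem_torus_iff)

lemma torus_weight_mult:
  "n \<ge> 2 \<Longrightarrow> torus_weight n v (t \<otimes>\<^bsub>torus n\<^esub> u) A = torus_weight n v t A * torus_weight n v u A"
  by (simp add: torus_weight_def torus_mult power_mult_distrib prod.distrib mult_ac)

lemma torus_weight_generators:
  assumes "v > 0"
  shows "torus_weight n v t (replicate_mset v 1) = t 1"
    and "j \<in> {2..n} \<Longrightarrow> torus_weight n v t (add_mset j (replicate_mset (v - 1) 1)) = t 1 * t j"
proof -
  show "torus_weight n v t (replicate_mset v 1) = t 1"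
    using assms by (simp add: torus_weight_def prod.neutral)
  assume j: "j \<in> {2..n}"
  have "(\<Prod>i=2..n. t i ^ count (add_mset j (replicate_mset (v - 1) 1)) i) = (\<Prod>i=2..n. if i = j then t i else 1)"
    by (intro prod.cong) auto
  also have "\<dots> = t j" using j by simp
  finally show "torus_weight n v t (add_mset j (replicate_mset (v - 1) 1)) = t 1 * t j"
    using assms by (simp add: torus_weight_def)
qed

text \<open>
  Up to adding multiples of \<open>v \<cdot> {1}\<close>, every exponent is a sum of the multisets \<open>v \<cdot> {1}\<close> and
  \<open>(v - 1) \<cdot> {1} + {j}\<close>: to absorb the entries different from 1, use one of the latter for each of them.
\<close>

lemma multiplicative_eq_1:
  fixes r :: "nat multiset \<Rightarrow> 'k::field"
  assumes v: "v > 0" and n: "n \<ge> 1"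
    and mult: "\<And>A B. A \<in> veronese_exponents n v \<Longrightarrow> B \<in> veronese_exponents n v \<Longrightarrow> r (A + B) = r A * r B"
    and r0: "r {#} = 1"
    and r1: "r (replicate_mset v 1) = 1"
    and rj: "\<And>j. j \<in> {2..n} \<Longrightarrow> r (add_mset j (replicate_mset (v - 1) 1)) = 1"
    and M: "M \<in> veronese_exponents n v"
  shows "r M = 1"
proof -
  have one: "(1::nat) \<in> {1..n}" using n by simp
  have repeat: "repeat_mset k (replicate_mset v 1) \<in> veronese_exponents n v \<and> r (repeat_mset k (replicate_mset v 1)) = 1" for k
    by (induction k) (auto simp: r0 r1 mult veronese_exponents_add replicate_in_support[OF one])
  have gens: "(\<Sum>j\<in>#F. add_mset j (replicate_mset (v - 1) 1)) \<in> veronese_exponents n v \<and>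
      r (\<Sum>j\<in>#F. add_mset j (replicate_mset (v - 1) 1)) = 1" if "set_mset F \<subseteq> {2..n}" for F
    using that
  proof (induction F)
    case (add j F)
    have "add_mset j (replicate_mset (v - 1) 1) \<in> veronese_exponents n v"
      using add.prems by (intro replicate_add_in_support one v) auto
    moreover have "j \<in> {2..n}" "set_mset F \<subseteq> {2..n}" using add.prems by auto
    moreover note IH = add.IH[OF \<open>set_mset F \<subseteq> {2..n}\<close>]
    ultimately have "r (add_mset j (replicate_mset (v - 1) 1) + (\<Sum>j\<in>#F. add_mset j (replicate_mset (v - 1) 1))) = 1"
      "add_mset j (replicate_mset (v - 1) 1) + (\<Sum>j\<in>#F. add_mset j (replicate_mset (v - 1) 1)) \<in> veronese_exponents n v"
      by (simp_all only: mult rj veronese_exponents_add mult_1_left)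
    then show ?case by simp
  qed (simp add: r0)
  define F where "F = filter_mset (\<lambda>j. j \<noteq> 1) M"
  have F: "set_mset F \<subseteq> {2..n}" using M by (auto simp: F_def veronese_exponents_def)
  have sz: "size M = count M 1 + size F"
    unfolding F_def by (metis multiset_partition size_union filter_eq_replicate_mset size_replicate_mset)
  have dv: "size M = v * (size M div v)" using M by (simp add: veronese_exponents_def)
  have cnt: "count (\<Sum>j\<in>#F. add_mset j (replicate_mset (v - 1) 1)) i =
      count F i + (if i = 1 then (v - 1) * size F else 0)" for i F
    by (induction F) auto
  have F1: "count F i = (if i = 1 then 0 else count M i)" for i by (simp add: F_def)
  have "M + repeat_mset (size F) (replicate_mset v 1) =
      repeat_mset (size M div v) (replicate_mset v 1) + (\<Sum>j\<in>#F. add_mset j (replicate_mset (v - 1) 1))"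
  proof (rule multiset_eqI)
    fix i
    have "count M 1 + size F * v = size M div v * v + (v - 1) * size F"
      using sz dv v by (cases v) (auto simp: algebra_simps)
    then show "count (M + repeat_mset (size F) (replicate_mset v 1)) i =
      count (repeat_mset (size M div v) (replicate_mset v 1) + (\<Sum>j\<in>#F. add_mset j (replicate_mset (v - 1) 1))) i"
      by (simp add: cnt F1)
  qed
  from arg_cong[OF this, of r] show ?thesis
    using repeat gens[OF F] M by (simp add: mult)
qed

lemma torus_aut_characterization:
  fixes \<phi> :: "(nat word \<Rightarrow>\<^sub>0 'k::field) set \<Rightarrow> (nat word \<Rightarrow>\<^sub>0 'k) set"
  assumes "v > 0"
  shows "(\<forall>N s. (\<Sum>i=1..n. s i) = N * v \<longrightarrow>
        \<phi> (skew_monomial q n s) =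
          (t 1 ^ N * (\<Prod>i=2..n. t i ^ s i)) \<odot>\<^bsub>skew_veronese q n v\<^esub> skew_monomial q n s)
     \<longleftrightarrow> acts_by q n v \<phi> id (torus_weight n v t)" (is "?L \<longleftrightarrow> ?R")
proof
  assume L: ?L
  show ?R
    unfolding acts_by_def
  proof
    fix M assume M: "M \<in> veronese_exponents n v"
    have eM: "exponent_mset n (count M) = M" using M by (simp add: exponent_mset_count veronese_exponents_def)
    have "(\<Sum>i=1..n. count M i) = size M div v * v"
      using M size_conv_sum[of M n] by (simp add: veronese_exponents_def)
    with L have "\<phi> (skew_monomial q n (count M)) =
      torus_weight n v t M \<odot>\<^bsub>skew_veronese q n v\<^esub> skew_monomial q n (count M)"
      unfolding torus_weight_def by blast
    then show "\<phi> (skew_elem q n (xmon M)) =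
        skew_elem q n (Poly_Mapping.single (image_mset id M) (torus_weight n v t M))"
      unfolding skew_monomial_eq eM skew_elem_single_scale[OF M, symmetric] by simp
  qed
next
  assume R: ?R
  show ?L
  proof (intro allI impI)
    fix N s assume N: "(\<Sum>i=1..n. s i) = N * v"
    let ?M = "exponent_mset n s"
    have M: "?M \<in> veronese_exponents n v"
      using N set_exponent_mset by (simp add: veronese_exponents_def size_exponent_mset)
    have "(\<Prod>i=2..n. t i ^ count ?M i) = (\<Prod>i=2..n. t i ^ s i)"
      by (intro prod.cong) (auto simp: count_exponent_mset)
    then have "torus_weight n v t ?M = t 1 ^ N * (\<Prod>i=2..n. t i ^ s i)"
      using assms by (simp add: torus_weight_def size_exponent_mset N)
    then show "\<phi> (skew_monomial q n s) =
        (t 1 ^ N * (\<Prod>i=2..n. t i ^ s i)) \<odot>\<^bsub>skew_veronese q n v\<^esub> skew_monomial q n s"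
      using R M skew_elem_single_scale[OF M, of q "torus_weight n v t ?M" 1]
      by (simp add: acts_by_def skew_monomial_eq)
  qed
qed

lemma acts_by_unique:
  assumes "v > 0" "\<phi> \<in> algebra_auto (skew_veronese q n v)" "\<psi> \<in> algebra_auto (skew_veronese q n v)"
    and "acts_by q n v \<phi> \<sigma> c" "acts_by q n v \<psi> \<sigma> c'" "\<And>M. M \<in> veronese_exponents n v \<Longrightarrow> c M = c' M"
  shows "\<phi> = \<psi>"
  by (rule algebra_auto_eqI[OF assms(1-3)]) (use assms(4-6) in \<open>simp add: acts_by_def\<close>)

text \<open>
  The definite description is justified since the weights define an automorphism and automorphisms are
  determined on monomials.
\<close>

lemma torus_aut:
  fixes t :: "nat \<Rightarrow> 'k::field"
  assumes v: "v > 0" and n: "n \<ge> 2" and t: "t \<in> carrier (torus n)"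
  shows "torus_aut n v t \<in> algebra_auto (skew_veronese (- 1) n v) \<and>
    acts_by (- 1) n v (torus_aut n v t) id (torus_weight n v t)"
proof -
  obtain g where g: "g \<in> algebra_auto (skew_veronese (- 1) n v)" "acts_by (- 1) n v g id (torus_weight n v t)"
    using exists_diagonal_auto[where q = "- 1" and d = "torus_weight n v t", OF v torus_weight_add torus_weight_nonzero[OF n t]]
    by blast
  show ?thesis
    unfolding torus_aut_def torus_aut_characterization[OF v]
    by (rule theI[where a = g]) (use g acts_by_unique[OF v] in blast)+
qed

text \<open>
  The scalars of a diagonal automorphism are nonzero by injectivity and multiplicative in the exponent,
  as the sign in \<open>x\<^sup>A x\<^sup>B = \<plusminus>x\<^sup>A\<^sup>+\<^sup>B\<close> appears on both sides. The point of the torus is read off from the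
  values at \<open>x\<^sub>1\<^sup>v\<close> and \<open>x\<^sub>1\<^sup>v\<^sup>-\<^sup>1 x\<^sub>j\<close>; the quotient of the given scalars by its weights is then
  multiplicative and equal to 1 on these monomials.
\<close>

lemma acts_by_id_torus:
  fixes g :: "(nat word \<Rightarrow>\<^sub>0 'k::field) set \<Rightarrow> (nat word \<Rightarrow>\<^sub>0 'k) set"
  assumes v: "v > 0" and n: "n \<ge> 2" and g: "g \<in> algebra_auto (skew_veronese (- 1) n v)" "acts_by (- 1) n v g id c"
  shows "\<exists>t\<in>carrier (torus n). g = torus_aut n v t"
proof -
  interpret closed_algebra_operations "skew_veronese (- 1 :: 'k) n v"
    by (rule closed_algebra_operations_veronese[OF v])
  note D = algebra_autoD[OF g(1)]
  have act: "g (skew_elem (- 1) n (Poly_Mapping.single M a)) = skew_elem (- 1) n (Poly_Mapping.single M (a * c M))"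
    if "M \<in> veronese_exponents n v" for M a
    using acts_by_single[OF v g permutes_id that, of a] by simp
  have mem: "Poly_Mapping.single M a \<in> veronese_span n v" if "M \<in> veronese_exponents n v" for M and a :: 'k
    using that by (rule veronese_span_single)
  have nz: "c M \<noteq> 0" if M: "M \<in> veronese_exponents n v" for M
  proof
    assume "c M = 0"
    then have "g (skew_elem (- 1) n (Poly_Mapping.single M 1)) = g (skew_elem (- 1) n (Poly_Mapping.single M 0))"
      unfolding act[OF M] by simp
    moreover have "inj_on g (carrier (skew_veronese (- 1) n v))" using D(2) by (rule bij_betw_imp_inj_on)
    ultimately have "skew_elem (- 1) n (Poly_Mapping.single M 1) = skew_elem (- 1) n (Poly_Mapping.single M (0 :: 'k))"
      using skew_elem_closed[OF v mem[OF M]] by (meson inj_onD)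
    then show False by (simp only: skew_elem_inject[OF mem[OF M] mem[OF M]]) simp
  qed
  have mult: "c (A + B) = c A * c B" if A: "A \<in> veronese_exponents n v" and B: "B \<in> veronese_exponents n v" for A B
  proof -
    have AB: "A + B \<in> veronese_exponents n v" using A B by (rule veronese_exponents_add)
    let ?s = "(- 1 :: 'k) ^ crossings A B"
    have "skew_elem (- 1) n (Poly_Mapping.single (A + B) (?s * c (A + B)))
        = g (skew_elem (- 1) n (qmul (- 1) (xmon A) (xmon B)))"
      unfolding qmul_single by (simp add: act[OF AB])
    also have "\<dots> = g (skew_elem (- 1) n (xmon A)) \<otimes>\<^bsub>skew_veronese (- 1) n v\<^esub> g (skew_elem (- 1) n (xmon B))"
      unfolding veronese_elem_ops(2)[OF mem[OF A] mem[OF B], symmetric]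
      by (rule D(5)[OF skew_elem_closed[OF v mem[OF A]] skew_elem_closed[OF v mem[OF B]]])
    also have "\<dots> = skew_elem (- 1) n (Poly_Mapping.single (A + B) (?s * c A * c B))"
      unfolding act[OF A] act[OF B] veronese_elem_ops(2)[OF mem[OF A] mem[OF B]] qmul_single by simp
    finally have "?s * c (A + B) = ?s * c A * c B"
      unfolding skew_elem_inject[OF mem[OF AB] mem[OF AB]] by (metis lookup_single_eq)
    then show ?thesis by simp
  qed
  have one: "replicate_mset v 1 \<in> veronese_exponents n v" using n by (intro replicate_in_support) auto
  have gen: "add_mset j (replicate_mset (v - 1) 1) \<in> veronese_exponents n v" if "j \<in> {2..n}" for j
    using that n v by (intro replicate_add_in_support) auto
  define t where "t = (\<lambda>i\<in>{1..n}. if i = 1 then c (replicate_mset v 1)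
      else c (add_mset i (replicate_mset (v - 1) 1)) / c (replicate_mset v 1))"
  have t: "t \<in> carrier (torus n)"
    using nz[OF one] nz[OF gen] by (auto simp: mem_torus_iff t_def)
  have t1: "t 1 = c (replicate_mset v 1)" using n by (simp add: t_def)
  have tj: "t 1 * t j = c (add_mset j (replicate_mset (v - 1) 1))" if "j \<in> {2..n}" for j
    using that nz[OF one] n by (auto simp: t_def)
  have w0: "torus_weight n v t {#} = 1" by (simp add: torus_weight_def)
  have c0: "c {#} = 1" using mult[of "{#}" "{#}"] nz[of "{#}"] by simp
  have "c M / torus_weight n v t M = 1" if M: "M \<in> veronese_exponents n v" for M
  proof (rule multiplicative_eq_1[OF v _ _ _ _ _ M, where r = "\<lambda>M. c M / torus_weight n v t M"])
    show "c (A + B) / torus_weight n v t (A + B) = c A / torus_weight n v t A * (c B / torus_weight n v t B)"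
      if "A \<in> veronese_exponents n v" "B \<in> veronese_exponents n v" for A B
      using that by (simp add: mult torus_weight_add)
    show "c (replicate_mset v 1) / torus_weight n v t (replicate_mset v 1) = 1"
      using nz[OF one] by (simp add: torus_weight_generators(1)[OF v] t1)
    show "c (add_mset j (replicate_mset (v - 1) 1)) / torus_weight n v t (add_mset j (replicate_mset (v - 1) 1)) = 1"
      if "j \<in> {2..n}" for j
      using nz[OF gen[OF that]] by (simp add: torus_weight_generators(2)[OF v that] tj[OF that])
  qed (use n w0 c0 in auto)
  then have eq: "torus_weight n v t M = c M" if "M \<in> veronese_exponents n v" for M
    using that torus_weight_nonzero[OF n t] by (metis divide_eq_1_iff)
  have "g = torus_aut n v t"
    by (rule acts_by_unique[OF v g(1) conjunct1[OF torus_aut[OF v n t]] g(2) conjunct2[OF torus_aut[OF v n t]]])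
      (simp add: eq)
  with t show ?thesis by blast
qed

lemma torus_aut_inject:
  fixes t u :: "nat \<Rightarrow> 'k::field"
  assumes v: "v > 0" and n: "n \<ge> 2" and t: "t \<in> carrier (torus n)" and u: "u \<in> carrier (torus n)"
    and eq: "torus_aut n v t = torus_aut n v u"
  shows "t = u"
proof -
  have w: "torus_weight n v t M = torus_weight n v u M" if M: "M \<in> veronese_exponents n v" for M
  proof -
    have "skew_elem (- 1) n (Poly_Mapping.single M (torus_weight n v t M)) =
        skew_elem (- 1) n (Poly_Mapping.single M (torus_weight n v u M))"
      using torus_aut[OF v n t] torus_aut[OF v n u] M eq by (simp add: acts_by_def)
    then show ?thesis
      unfolding skew_elem_inject[OF veronese_span_single[OF M] veronese_span_single[OF M]] by (metis lookup_single_eq)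
  qed
  have t1: "t 1 = u 1"
    using w[of "replicate_mset v 1"] n torus_weight_generators(1)[OF v, of n t] torus_weight_generators(1)[OF v, of n u]
      replicate_in_support[of 1 n v] by simp
  have tj: "t j = u j" if j: "j \<in> {2..n}" for j
  proof -
    have "add_mset j (replicate_mset (v - 1) 1) \<in> veronese_exponents n v"
      using j n v by (intro replicate_add_in_support) auto
    from w[OF this] have "t 1 * t j = u 1 * u j"
      using torus_weight_generators(2)[OF v j, of t] torus_weight_generators(2)[OF v j, of u] by simp
    moreover have "u 1 \<noteq> 0" using u n by (simp add: mem_torus_iff)
    ultimately show ?thesis using t1 by simp
  qed
  show ?thesis
  proof (rule extensionalityI[of _ "{1..n}"])
    fix j assume "j \<in> {1..n}"
    then show "t j = u j" using t1 tj[of j] by (cases "j = 1") auto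
  qed (use t u in \<open>auto simp: mem_torus_iff\<close>)
qed

lemma torus_aut_hom:
  assumes v: "v > 0" and n: "n \<ge> 2"
  shows "torus_aut n v \<in> hom (torus n) (Algebra_Aut (skew_veronese (- 1 :: 'k::field) n v))"
proof (rule homI)
  fix t u :: "nat \<Rightarrow> 'k" assume t: "t \<in> carrier (torus n)" and u: "u \<in> carrier (torus n)"
  interpret closed_algebra_operations "skew_veronese (- 1 :: 'k) n v"
    by (rule closed_algebra_operations_veronese[OF v])
  have tu: "t \<otimes>\<^bsub>torus n\<^esub> u \<in> carrier (torus n)"
    using t u by (auto simp: torus_mult mem_torus_iff)
  note T = torus_aut[OF v n t] and U = torus_aut[OF v n u] and TU = torus_aut[OF v n tu]
  note product = acts_by_compose[OF v conjunct1[OF T] conjunct2[OF T] permutes_id conjunct1[OF U] conjunct2[OF U] permutes_id]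
  show "torus_aut n v (t \<otimes>\<^bsub>torus n\<^esub> u) = torus_aut n v t \<otimes>\<^bsub>Algebra_Aut (skew_veronese (- 1) n v)\<^esub> torus_aut n v u"
  proof (rule acts_by_unique[OF v conjunct1[OF TU] _ conjunct2[OF TU] product[unfolded id_o]])
    show "torus_aut n v t \<otimes>\<^bsub>Algebra_Aut (skew_veronese (- 1) n v)\<^esub> torus_aut n v u \<in> algebra_auto (skew_veronese (- 1) n v)"
      using T U by (simp add: Algebra_Aut_mult compose_algebra_auto)
  qed (simp add: torus_weight_mult[OF n])
next
  fix t :: "nat \<Rightarrow> 'k" assume "t \<in> carrier (torus n)"
  then show "torus_aut n v t \<in> carrier (Algebra_Aut (skew_veronese (- 1) n v))"
    by (simp add: torus_aut[OF v n])
qed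

section \<open>Permutations of the variables\<close>

text \<open>
  Permuting the letters in the free algebra avoids any bookkeeping of signs: composition of
  permutations is plain functoriality there.
\<close>

definition word_map :: "(nat \<Rightarrow> nat) \<Rightarrow> (nat word \<Rightarrow>\<^sub>0 'k) \<Rightarrow> nat word \<Rightarrow>\<^sub>0 'k::field" where
  "word_map \<sigma> f = (\<Sum>w\<in>Poly_Mapping.keys f. Poly_Mapping.single (Word (map \<sigma> (letters w))) (Poly_Mapping.lookup f w))"

lemma word_map_add: "word_map \<sigma> (f + g) = word_map \<sigma> f + word_map \<sigma> g"
  unfolding word_map_def
  by (rule setsum_keys_plus_distrib[where f = "\<lambda>w a. Poly_Mapping.single (Word (map \<sigma> (letters w))) a"])
    (simp_all add: single_add)

lemma word_map_single: "word_map \<sigma> (Poly_Mapping.single w a) = Poly_Mapping.single (Word (map \<sigma> (letters w))) a"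
  by (simp add: word_map_def)

lemma word_map_zero [simp]: "word_map \<sigma> 0 = 0"
  by (simp add: word_map_def)

lemma word_map_minus: "word_map \<sigma> (f - g) = word_map \<sigma> f - word_map \<sigma> g"
  using word_map_add[of \<sigma> "f - g" g] by simp

lemma word_map_mult: "word_map \<sigma> (f * g) = word_map \<sigma> f * word_map \<sigma> g"
proof (induction f rule: poly_mapping_induct_single)
  case (single u a)
  show ?case
  proof (induction g rule: poly_mapping_induct_single)
    case (single w b)
    show ?case by (simp add: mult_single word_map_single plus_word_def)
  qed (simp_all add: distrib_left word_map_add)
qed (simp_all add: distrib_right word_map_add)

lemma word_map_compose: "word_map \<sigma> (word_map \<tau> f) = word_map (\<sigma> \<circ> \<tau>) f"
  by (induction f rule: poly_mapping_induct_single) (simp_all add: word_map_single word_map_add comp_def)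

lemma word_map_id: "word_map id f = f"
  by (induction f rule: poly_mapping_induct_single) (simp_all add: word_map_single word_map_add)

lemma word_map_closed:
  assumes "\<sigma> permutes {1..n}" "f \<in> carrier (free_algebra {1..n})"
  shows "word_map \<sigma> f \<in> carrier (free_algebra {1..n})"
proof -
  have keys: "Poly_Mapping.keys (word_map \<sigma> f) \<subseteq> (\<lambda>w. Word (map \<sigma> (letters w))) ` Poly_Mapping.keys f"
    unfolding word_map_def by (rule order_trans[OF keys_sum]) (auto split: if_splits)
  have "set (letters w) \<subseteq> {1..n}" if "w \<in> Poly_Mapping.keys (word_map \<sigma> f)" for w
  proof -
    obtain u where u: "u \<in> Poly_Mapping.keys f" and w: "w = Word (map \<sigma> (letters u))"
      using keys \<open>w \<in> _\<close> by blast
    have "set (letters u) \<subseteq> {1..n}" using assms(2) u by simp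
    then have "\<sigma> ` set (letters u) \<subseteq> \<sigma> ` {1..n}" by (rule image_mono)
    then show ?thesis unfolding w by (simp only: word.sel set_map permutes_image[OF assms(1)])
  qed
  then show ?thesis unfolding free_algebra_sel by blast
qed

text \<open>
  The relations \<open>x\<^sub>j x\<^sub>i = -x\<^sub>i x\<^sub>j\<close> are symmetric in \<open>i\<close> and \<open>j\<close>, so permuting the letters maps the defining
  ideal to itself. For general \<open>q\<close> it would replace \<open>q\<close> by its inverse in some of the relations.
\<close>

lemma word_map_skew_ideal:
  assumes \<sigma>: "\<sigma> permutes {1..n}" and f: "f \<in> skew_ideal (- 1) n"
  shows "normal_form (- 1) (word_map \<sigma> f) = (0 :: nat multiset \<Rightarrow>\<^sub>0 'k::field)"
proof -
  let ?J = "{f \<in> carrier (free_algebra {1..n}). normal_form (- 1) (word_map \<sigma> f) = (0 :: nat multiset \<Rightarrow>\<^sub>0 'k)}"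
  have "skew_ideal (- 1) n \<subseteq> ?J"
  proof (rule skew_ideal_minimal)
    show "ideal ?J (free_algebra {1..n})"
      by (rule free_algebra_idealI)
        (auto simp: word_map_add word_map_mult normal_form_add normal_form_mult
          intro: free_algebra_add_closed free_algebra_mult_closed
          simp del: free_algebra_sel(1), simp)
    have "normal_form (- 1) (word_map \<sigma> r) = 0" if "r \<in> skew_relators (- 1) n" for r :: "nat word \<Rightarrow>\<^sub>0 'k"
    proof -
      obtain i j where r: "r = Poly_Mapping.single (Word [j, i]) 1 - Poly_Mapping.single (Word [i, j]) (- 1)"
        and ij: "i < j"
        using \<open>r \<in> _\<close> by (auto simp: skew_relators_def skew_relator_eq)
      \<comment> \<open>Exactly one of the two words is out of order after the permutation, whichever it is.\<close>
      have "\<sigma> i \<noteq> \<sigma> j" using ij permutes_inj[OF \<sigma>] by (metis injD less_irrefl)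
      then have sign: "(- 1) ^ inversions [\<sigma> j, \<sigma> i] + (- 1) ^ inversions [\<sigma> i, \<sigma> j] = (0 :: 'k)"
        by (cases "\<sigma> i < \<sigma> j") auto
      have "normal_form (- 1) (word_map \<sigma> r) =
          Poly_Mapping.single {#\<sigma> j, \<sigma> i#} ((- 1) ^ inversions [\<sigma> j, \<sigma> i])
          - Poly_Mapping.single {#\<sigma> i, \<sigma> j#} ((- 1) ^ inversions [\<sigma> i, \<sigma> j] * - 1)"
        by (simp add: r word_map_minus word_map_single normal_form_minus normal_form_single
            del: inversions.simps)
      also have "\<dots> = Poly_Mapping.single {#\<sigma> i, \<sigma> j#}
          ((- 1) ^ inversions [\<sigma> j, \<sigma> i] - (- 1) ^ inversions [\<sigma> i, \<sigma> j] * - 1)"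
        unfolding single_diff add_mset_commute[of "\<sigma> j" "\<sigma> i"] ..
      also have "(- 1) ^ inversions [\<sigma> j, \<sigma> i] - (- 1) ^ inversions [\<sigma> i, \<sigma> j] * - 1 = (0 :: 'k)"
        using sign by (simp del: inversions.simps)
      finally show ?thesis by simp
    qed
    then show "skew_relators (- 1) n \<subseteq> ?J" using skew_relators_subset by blast
  qed
  with f show ?thesis by blast
qed

definition perm_map :: "(nat \<Rightarrow> nat) \<Rightarrow> (nat multiset \<Rightarrow>\<^sub>0 'k) \<Rightarrow> nat multiset \<Rightarrow>\<^sub>0 'k::field" where
  "perm_map \<sigma> p = normal_form (- 1) (word_map \<sigma> (sorted_rep p))"

text \<open>
  Well-definedness of the permutation action on the quotient.
\<close>

lemma perm_map_normal_form:
  assumes "\<sigma> permutes {1..n}" "f \<in> carrier (free_algebra {1..n})"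
  shows "perm_map \<sigma> (normal_form (- 1) f) = normal_form (- 1) (word_map \<sigma> f)"
  using word_map_skew_ideal[OF assms(1) normal_form_congruence[OF assms(2), of "- 1"]]
  by (simp add: perm_map_def word_map_minus normal_form_minus)

lemma perm_map_add: "perm_map \<sigma> (p + r) = perm_map \<sigma> p + perm_map \<sigma> r"
  by (simp add: perm_map_def sorted_rep_add word_map_add normal_form_add)

lemma perm_map_single:
  "perm_map \<sigma> (Poly_Mapping.single M a) = Poly_Mapping.single (image_mset \<sigma> M)
     ((- 1) ^ inversions (map \<sigma> (sorted_list_of_multiset M)) * a)"
  by (simp add: perm_map_def sorted_rep_single word_map_single normal_form_single)

lemma perm_map_mult:
  assumes "\<sigma> permutes {1..n}" "p \<in> veronese_span n 1" "r \<in> veronese_span n 1"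
  shows "perm_map \<sigma> (qmul (- 1) p r) = qmul (- 1) (perm_map \<sigma> p) (perm_map \<sigma> r)"
proof -
  have "perm_map \<sigma> (qmul (- 1) p r) = perm_map \<sigma> (normal_form (- 1) (sorted_rep p * sorted_rep r))"
    by (simp add: normal_form_mult)
  also have "\<dots> = normal_form (- 1) (word_map \<sigma> (sorted_rep p * sorted_rep r))"
    by (intro perm_map_normal_form[OF assms(1)] free_algebra_mult_closed sorted_rep_closed assms)
  finally show ?thesis by (simp add: word_map_mult normal_form_mult perm_map_def)
qed

lemma perm_map_compose:
  assumes "\<sigma> permutes {1..n}" "\<tau> permutes {1..n}" "p \<in> veronese_span n 1"
  shows "perm_map \<sigma> (perm_map \<tau> p) = perm_map (\<sigma> \<circ> \<tau>) p"
proof -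
  have "perm_map \<sigma> (perm_map \<tau> p) = normal_form (- 1) (word_map \<sigma> (word_map \<tau> (sorted_rep p)))"
    unfolding perm_map_def[of \<tau>]
    by (intro perm_map_normal_form[OF assms(1)] word_map_closed assms sorted_rep_closed)
  then show ?thesis by (simp add: word_map_compose perm_map_def)
qed

lemma perm_map_id: "perm_map id p = p"
  by (simp add: perm_map_def word_map_id)

lemma perm_map_closed:
  assumes \<sigma>: "\<sigma> permutes {1..n}" and p: "p \<in> veronese_span n v"
  shows "perm_map \<sigma> p \<in> veronese_span n v"
proof -
  from p have "Poly_Mapping.keys p \<subseteq> veronese_exponents n v" by (simp add: veronese_span_def)
  then show ?thesis
  proof (induction p rule: poly_mapping_induct_keys)
    case (single M a)
    then show ?case
      unfolding perm_map_single by (intro veronese_span_single image_mset_support[OF \<sigma>])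
  next
    case (add f g)
    then show ?case by (simp add: perm_map_add veronese_span_add)
  next
    case zero
    show ?case by (simp add: perm_map_def)
  qed
qed

lemma perm_map_aut:
  assumes v: "v > 0" and \<sigma>: "\<sigma> permutes {1..n}"
  shows "coordinate_aut (- 1) n v (perm_map \<sigma>) \<in> algebra_auto (skew_veronese (- 1 :: 'k::field) n v)"
proof (rule coordinate_aut_algebra_auto[where \<Psi> = "perm_map (inv_into UNIV \<sigma>)"])
  note \<sigma>' = permutes_inv[OF \<sigma>]
  fix p r :: "nat multiset \<Rightarrow>\<^sub>0 'k" and c :: 'k
  assume p: "p \<in> veronese_span n v"
  show "perm_map \<sigma> p \<in> veronese_span n v" by (rule perm_map_closed[OF \<sigma> p])
  show "perm_map (inv_into UNIV \<sigma>) p \<in> veronese_span n v" by (rule perm_map_closed[OF \<sigma>' p])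
  have p1: "p \<in> veronese_span n 1" using p veronese_span_subset by blast
  show "perm_map (inv_into UNIV \<sigma>) (perm_map \<sigma> p) = p"
    unfolding perm_map_compose[OF \<sigma>' \<sigma> p1] permutes_inv_o(2)[OF \<sigma>] by (rule perm_map_id)
  show "perm_map \<sigma> (perm_map (inv_into UNIV \<sigma>) p) = p"
    unfolding perm_map_compose[OF \<sigma> \<sigma>' p1] permutes_inv_o(1)[OF \<sigma>] by (rule perm_map_id)
  assume r: "r \<in> veronese_span n v"
  then have r1: "r \<in> veronese_span n 1" using veronese_span_subset by blast
  show "perm_map \<sigma> (p + r) = perm_map \<sigma> p + perm_map \<sigma> r" by (rule perm_map_add)
  show "perm_map \<sigma> (qmul (- 1) p r) = qmul (- 1) (perm_map \<sigma> p) (perm_map \<sigma> r)"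
    by (rule perm_map_mult[OF \<sigma> p1 r1])
qed (simp_all add: v perm_map_single)

text \<open>
  Up to a power of \<open>q\<close>, a monomial is the product of one of its variables and a smaller monomial.
\<close>

lemma algebra_auto_eq_on_generators:
  fixes \<phi> \<psi> :: "(nat word \<Rightarrow>\<^sub>0 'k::field) set \<Rightarrow> (nat word \<Rightarrow>\<^sub>0 'k) set"
  assumes q: "q \<noteq> 0" and \<phi>: "\<phi> \<in> algebra_auto (skew_poly q n)" and \<psi>: "\<psi> \<in> algebra_auto (skew_poly q n)"
    and eq: "\<And>i. i \<in> {1..n} \<Longrightarrow> \<phi> (skew_gen q n i) = \<psi> (skew_gen q n i)"
  shows "\<phi> = \<psi>"
proof (rule algebra_auto_eqI[OF zero_less_one])
  show A: "\<phi> \<in> algebra_auto (skew_veronese q n 1)" "\<psi> \<in> algebra_auto (skew_veronese q n 1)"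
    unfolding skew_veronese_1 by (fact \<phi> \<psi>)+
  interpret closed_algebra_operations "skew_veronese q n 1"
    by (rule closed_algebra_operations_veronese[OF zero_less_one])
  note D = algebra_autoD[OF A(1)] and E = algebra_autoD[OF A(2)]
  fix M assume "M \<in> veronese_exponents n 1"
  then show "\<phi> (skew_elem q n (xmon M)) = \<psi> (skew_elem q n (xmon M))"
  proof (induction M)
    case empty
    have one: "skew_elem q n (xmon {#}) = \<one>\<^bsub>skew_veronese q n 1\<^esub>"
      unfolding skew_veronese_sel skew_elem_one ..
    show ?case unfolding one D(3) E(3) ..
  next
    case (add i M)
    then have i: "i \<in> {1..n}" and M: "M \<in> veronese_exponents n 1" by (auto simp: veronese_exponents_def)
    have i': "{#i#} \<in> veronese_exponents n 1" using i by (simp add: veronese_exponents_def)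
    define a where "a = 1 / q ^ crossings {#i#} M"
    have "xmon (add_mset i M) = qmul q (Poly_Mapping.single {#i#} (a * 1)) (xmon M)"
      using q by (simp add: qmul_single a_def)
    then have split: "skew_elem q n (xmon (add_mset i M)) =
        (a \<odot>\<^bsub>skew_veronese q n 1\<^esub> skew_gen q n i) \<otimes>\<^bsub>skew_veronese q n 1\<^esub> skew_elem q n (xmon M)"
      unfolding skew_gen_eq[OF i] skew_elem_single_scale[OF i', symmetric]
        veronese_elem_ops(2)[OF veronese_span_single[OF i'] veronese_span_single[OF M]] by simp
    have gen: "skew_gen q n i \<in> carrier (skew_veronese q n 1)"
      unfolding skew_gen_eq[OF i] by (intro skew_elem_closed veronese_span_single i') simp
    have mon: "skew_elem q n (xmon M) \<in> carrier (skew_veronese q n 1)"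
      by (intro skew_elem_closed veronese_span_single M) simp
    show ?case
      unfolding split D(5)[OF smult_closed[OF gen] mon] E(5)[OF smult_closed[OF gen] mon]
        D(7)[OF gen] E(7)[OF gen] eq[OF i] add.IH[OF M] ..
  qed
qed

text \<open>
  The permutation action is an automorphism of the whole algebra, which is the case \<open>v = 1\<close>, and the only
  one with the prescribed values on the generators. On the Veronese subring it is given by the same
  formula in coordinates.
\<close>

lemma perm_aut_eq:
  assumes v: "v > 0" and \<sigma>: "\<sigma> permutes {1..n}"
  shows "perm_aut n v \<sigma> = coordinate_aut (- 1 :: 'k::field) n v (perm_map \<sigma>)"
proof -
  let ?\<psi> = "coordinate_aut (- 1 :: 'k) n 1 (perm_map \<sigma>)"
  have gen: "?\<psi> (skew_gen (- 1) n i) = skew_gen (- 1) n (\<sigma> i)" if i: "i \<in> {1..n}" for i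
  proof -
    have "{#i#} \<in> veronese_exponents n 1" using i by (simp add: veronese_exponents_def)
    moreover have "\<sigma> i \<in> {1..n}" using permutes_in_image[OF \<sigma>] i by simp
    ultimately show ?thesis
      by (simp only: skew_gen_eq i coordinate_aut_elem[OF zero_less_one veronese_span_single])
        (simp add: perm_map_single)
  qed
  have auto: "?\<psi> \<in> algebra_auto (skew_poly (- 1) n)"
    using perm_map_aut[OF zero_less_one \<sigma>] unfolding skew_veronese_1 .
  have "(THE \<psi>. \<psi> \<in> algebra_auto (skew_poly (- 1 :: 'k) n) \<and>
        (\<forall>i\<in>{1..n}. \<psi> (skew_gen (- 1) n i) = skew_gen (- 1) n (\<sigma> i))) = ?\<psi>"
  proof (rule the_equality)
    show "?\<psi> \<in> algebra_auto (skew_poly (- 1) n) \<and>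
        (\<forall>i\<in>{1..n}. ?\<psi> (skew_gen (- 1) n i) = skew_gen (- 1) n (\<sigma> i))"
      using gen auto by blast
    fix \<psi> assume \<psi>: "\<psi> \<in> algebra_auto (skew_poly (- 1 :: 'k) n) \<and>
        (\<forall>i\<in>{1..n}. \<psi> (skew_gen (- 1) n i) = skew_gen (- 1) n (\<sigma> i))"
    show "\<psi> = ?\<psi>"
      by (rule algebra_auto_eq_on_generators[of "- 1"]) (use \<psi> gen auto in auto)
  qed
  then have eq: "perm_aut n v \<sigma> = restrict ?\<psi> (carrier (skew_veronese (- 1) n v))"
    unfolding perm_aut_def by simp
  show ?thesis
  proof (rule extensionalityI[of _ "carrier (skew_veronese (- 1 :: 'k) n v)"])
    fix y assume "y \<in> carrier (skew_veronese (- 1 :: 'k) n v)"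
    then obtain p where p: "y = skew_elem (- 1) n p" "p \<in> veronese_span n v"
      unfolding carrier_skew_veronese[OF v] by blast
    then have "p \<in> veronese_span n 1" using veronese_span_subset by blast
    then show "perm_aut n v \<sigma> y = coordinate_aut (- 1) n v (perm_map \<sigma>) y"
      using p by (simp add: eq skew_elem_closed[OF v] coordinate_aut_elem v)
  next
    show "perm_aut n v \<sigma> \<in> extensional (carrier (skew_veronese (- 1 :: 'k) n v))"
      unfolding eq by (rule restrict_extensional)
    show "coordinate_aut (- 1) n v (perm_map \<sigma>) \<in> extensional (carrier (skew_veronese (- 1 :: 'k) n v))"
      unfolding coordinate_aut_def by (rule restrict_extensional)
  qed
qed

lemma perm_aut:
  assumes v: "v > 0" and \<sigma>: "\<sigma> permutes {1..n}"
  shows "perm_aut n v \<sigma> \<in> algebra_auto (skew_veronese (- 1 :: 'k::field) n v)"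
    and "acts_by (- 1 :: 'k) n v (perm_aut n v \<sigma>) \<sigma>
      (\<lambda>M. (- 1) ^ inversions (map \<sigma> (sorted_list_of_multiset M)))"
proof -
  show "perm_aut n v \<sigma> \<in> algebra_auto (skew_veronese (- 1 :: 'k) n v)"
    unfolding perm_aut_eq[OF v \<sigma>] by (rule perm_map_aut[OF v \<sigma>])
  show "acts_by (- 1 :: 'k) n v (perm_aut n v \<sigma>) \<sigma>
      (\<lambda>M. (- 1) ^ inversions (map \<sigma> (sorted_list_of_multiset M)))"
    unfolding perm_aut_eq[OF v \<sigma>] acts_by_def
    by (simp add: coordinate_aut_elem[OF v veronese_span_single] perm_map_single)
qed

lemma perm_aut_hom:
  assumes v: "v > 0"
  shows "perm_aut n v \<in> hom (sym_group n) (Algebra_Aut (skew_veronese (- 1 :: 'k::field) n v))"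
proof (rule homI)
  fix \<sigma> assume "\<sigma> \<in> carrier (sym_group n)"
  then show "perm_aut n v \<sigma> \<in> carrier (Algebra_Aut (skew_veronese (- 1 :: 'k) n v))"
    using perm_aut(1)[OF v] by (simp add: sym_group_carrier)
next
  fix \<sigma> \<tau> assume "\<sigma> \<in> carrier (sym_group n)" "\<tau> \<in> carrier (sym_group n)"
  then have \<sigma>: "\<sigma> permutes {1..n}" and \<tau>: "\<tau> permutes {1..n}" by (simp_all add: sym_group_carrier)
  interpret closed_algebra_operations "skew_veronese (- 1 :: 'k) n v"
    by (rule closed_algebra_operations_veronese[OF v])
  show "perm_aut n v (\<sigma> \<otimes>\<^bsub>sym_group n\<^esub> \<tau>) =
      perm_aut n v \<sigma> \<otimes>\<^bsub>Algebra_Aut (skew_veronese (- 1 :: 'k) n v)\<^esub> perm_aut n v \<tau>"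
    unfolding sym_group_mult Algebra_Aut_mult[OF perm_aut(1)[OF v \<sigma>] perm_aut(1)[OF v \<tau>]]
  proof (rule extensionalityI[of _ "carrier (skew_veronese (- 1 :: 'k) n v)"])
    fix y assume "y \<in> carrier (skew_veronese (- 1 :: 'k) n v)"
    then obtain p where p: "y = skew_elem (- 1) n p" "p \<in> veronese_span n v"
      unfolding carrier_skew_veronese[OF v] by blast
    then have p1: "p \<in> veronese_span n 1" using veronese_span_subset by blast
    show "perm_aut n v (\<sigma> \<circ> \<tau>) y = compose (carrier (skew_veronese (- 1) n v)) (perm_aut n v \<sigma>) (perm_aut n v \<tau>) y"
      unfolding p(1) compose_eq[OF skew_elem_closed[OF v p(2)]]
        perm_aut_eq[OF v permutes_compose[OF \<tau> \<sigma>]] perm_aut_eq[OF v \<sigma>] perm_aut_eq[OF v \<tau>]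
        coordinate_aut_elem[OF v p(2)] coordinate_aut_elem[OF v perm_map_closed[OF \<tau> p(2)]]
        perm_map_compose[OF \<sigma> \<tau> p1] ..
  qed (simp_all add: perm_aut_eq[OF v permutes_compose[OF \<tau> \<sigma>]] coordinate_aut_def)
qed

section \<open>The automorphism group\<close>

text \<open>
  The permutation is visible on the monomials \<open>x\<^sub>i\<^sup>v\<close>.
\<close>

lemma acts_by_perm_unique:
  assumes v: "v > 0" and "acts_by q n v g \<sigma> c" "acts_by q n v g \<sigma>' c'"
    and \<sigma>: "\<sigma> permutes {1..n}" and \<sigma>': "\<sigma>' permutes {1..n}"
    and nz: "\<And>M. M \<in> veronese_exponents n v \<Longrightarrow> c M \<noteq> 0"
  shows "\<sigma> = \<sigma>'"
proof
  fix i
  show "\<sigma> i = \<sigma>' i"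
  proof (cases "i \<in> {1..n}")
    case True
    let ?M = "replicate_mset v i"
    have M: "?M \<in> veronese_exponents n v" by (rule replicate_in_support[OF True])
    have "skew_elem q n (Poly_Mapping.single (image_mset \<sigma> ?M) (c ?M)) =
        skew_elem q n (Poly_Mapping.single (image_mset \<sigma>' ?M) (c' ?M))"
      using assms(2,3) M unfolding acts_by_def by metis
    then have "Poly_Mapping.single (image_mset \<sigma> ?M) (c ?M) = Poly_Mapping.single (image_mset \<sigma>' ?M) (c' ?M)"
      by (rule iffD1[OF skew_elem_inject[OF veronese_span_single[OF image_mset_support[OF \<sigma> M]]
            veronese_span_single[OF image_mset_support[OF \<sigma>' M]]]])
    then have "image_mset \<sigma> ?M = image_mset \<sigma>' ?M"
      using nz[OF M] by (metis keys_single singleton_inject insert_not_empty)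
    then show ?thesis using v by (simp add: replicate_mset_eq_iff)
  next
    case False
    then show ?thesis using \<sigma> \<sigma>' by (metis permutes_not_in)
  qed
qed

theorem theorem0p1:
  fixes n v :: nat
  assumes "CHAR('k::field) \<noteq> 2" and "n \<ge> 2" and "v > 0"
    and "even n \<longleftrightarrow> odd v"
  shows "Algebra_Aut (skew_veronese (-1 :: 'k) n v)
    \<cong> semidirect (sym_group n) (torus n :: (nat \<Rightarrow> 'k) monoid) (conj_action n v)"
proof -
  note n = assms(2) and v = assms(3)
  let ?A = "skew_veronese (- 1 :: 'k) n v"
  let ?G = "Algebra_Aut ?A"
  interpret closed_algebra_operations ?A by (rule closed_algebra_operations_veronese[OF v])
  interpret G: group ?G by (rule group_Algebra_Aut)
  interpret H: group "sym_group n" by (rule sym_group_is_group)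
  interpret P: group_hom "sym_group n" ?G "perm_aut n v"
    by unfold_locales (rule perm_aut_hom[OF v])
  have T: "torus_aut n v t \<in> algebra_auto ?A" "acts_by (- 1) n v (torus_aut n v t) id (torus_weight n v t)"
    if "t \<in> carrier (torus n)" for t
    using torus_aut[OF v n that] by blast+
  have diag: "\<exists>t\<in>carrier (torus n). g = torus_aut n v t"
    if "g \<in> carrier ?G" "acts_by (- 1) n v g id c" for g c
    using acts_by_id_torus[OF v n _ that(2)] that(1) by simp
  have perms: "\<sigma> permutes {1..n}" "inv\<^bsub>sym_group n\<^esub> \<sigma> permutes {1..n}" "\<sigma> \<circ> inv\<^bsub>sym_group n\<^esub> \<sigma> = id"
    if "\<sigma> \<in> carrier (sym_group n)" for \<sigma>
    using that H.inv_closed[OF that] H.r_inv[OF that]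
    by (simp_all add: sym_group_carrier sym_group_mult sym_group_one)
  have conj: "\<exists>!t'. t' \<in> carrier (torus n) \<and> torus_aut n v t' =
      perm_aut n v \<sigma> \<otimes>\<^bsub>?G\<^esub> torus_aut n v t \<otimes>\<^bsub>?G\<^esub> inv\<^bsub>?G\<^esub> (perm_aut n v \<sigma>)"
    if \<sigma>: "\<sigma> \<in> carrier (sym_group n)" and t: "t \<in> carrier (torus n)" for \<sigma> and t :: "nat \<Rightarrow> 'k"
  proof -
    let ?g = "perm_aut n v \<sigma> \<otimes>\<^bsub>?G\<^esub> torus_aut n v t \<otimes>\<^bsub>?G\<^esub> inv\<^bsub>?G\<^esub> (perm_aut n v \<sigma>)"
    note p = perms[OF \<sigma>]
    have inv: "inv\<^bsub>?G\<^esub> (perm_aut n v \<sigma>) = perm_aut n v (inv\<^bsub>sym_group n\<^esub> \<sigma>)"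
      using P.hom_inv[OF \<sigma>] by simp
    note PT = acts_by_compose[OF v perm_aut(1)[OF v p(1)] perm_aut(2)[OF v p(1)] p(1) T[OF t] permutes_id]
    have PT_auto: "perm_aut n v \<sigma> \<otimes>\<^bsub>?G\<^esub> torus_aut n v t \<in> algebra_auto ?A"
      using G.m_closed[of "perm_aut n v \<sigma>" "torus_aut n v t"] perm_aut(1)[OF v p(1)] T(1)[OF t] by simp
    have \<sigma>id: "\<sigma> \<circ> id permutes {1..n}" using p(1) by simp
    \<comment> \<open>Conjugation preserves diagonality, because the two permutations cancel.\<close>
    have "\<exists>c. acts_by (- 1) n v ?g id c"
      using acts_by_compose[OF v PT_auto PT \<sigma>id perm_aut(1)[OF v p(2)] perm_aut(2)[OF v p(2)] p(2)]
      unfolding inv comp_id p(3) by blast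
    moreover have "?g \<in> carrier ?G"
      using T(1)[OF t] perm_aut(1)[OF v p(1)] by (intro G.m_closed G.inv_closed) simp_all
    ultimately obtain t' where "t' \<in> carrier (torus n)" "?g = torus_aut n v t'" using diag by blast
    then show ?thesis using torus_aut_inject[OF v n] by metis
  qed
  have action: "conj_action n v \<sigma> t \<in> carrier (torus n) \<and> torus_aut n v (conj_action n v \<sigma> t) =
      perm_aut n v \<sigma> \<otimes>\<^bsub>?G\<^esub> torus_aut n v t \<otimes>\<^bsub>?G\<^esub> inv\<^bsub>?G\<^esub> (perm_aut n v \<sigma>)"
    if "\<sigma> \<in> carrier (sym_group n)" "t \<in> carrier (torus n)" for \<sigma> and t :: "nat \<Rightarrow> 'k"
    unfolding conj_action_def Let_def by (rule theI'[OF conj[OF that]])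
  show ?thesis
  proof (rule iso_semidirect[OF G.group_axioms H.group_axioms torus_aut_hom[OF v n] perm_aut_hom[OF v]])
    fix g assume g: "g \<in> carrier ?G"
    then obtain \<sigma> c where \<sigma>: "\<sigma> permutes {1..n}" "acts_by (- 1) n v g \<sigma> c"
      using algebra_auto_acts_by[OF assms(1) n v assms(4) g[unfolded carrier_Algebra_Aut]] by blast
    then have \<sigma>H: "\<sigma> \<in> carrier (sym_group n)" by (simp add: sym_group_carrier)
    note p = perms[OF \<sigma>H]
    let ?\<sigma>' = "inv\<^bsub>sym_group n\<^esub> \<sigma>"
    have g': "g \<in> algebra_auto ?A" using g by simp
    \<comment> \<open>Undoing the permutation leaves a diagonal automorphism, that is, a point of the torus.\<close>
    have "acts_by (- 1) n v (g \<otimes>\<^bsub>?G\<^esub> perm_aut n v ?\<sigma>') id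
        (\<lambda>M. (- 1) ^ inversions (map ?\<sigma>' (sorted_list_of_multiset M)) * c (image_mset ?\<sigma>' M))"
      using acts_by_compose[OF v g' \<sigma>(2,1) perm_aut(1)[OF v p(2)] perm_aut(2)[OF v p(2)] p(2)]
      unfolding p(3) .
    moreover have "g \<otimes>\<^bsub>?G\<^esub> perm_aut n v ?\<sigma>' \<in> carrier ?G"
      using g perm_aut(1)[OF v p(2)] by (intro G.m_closed) simp_all
    ultimately obtain t where t: "t \<in> carrier (torus n)" "g \<otimes>\<^bsub>?G\<^esub> perm_aut n v ?\<sigma>' = torus_aut n v t"
      using diag by blast
    have "torus_aut n v t \<otimes>\<^bsub>?G\<^esub> perm_aut n v \<sigma> = g \<otimes>\<^bsub>?G\<^esub> (inv\<^bsub>?G\<^esub> (perm_aut n v \<sigma>) \<otimes>\<^bsub>?G\<^esub> perm_aut n v \<sigma>)"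
      unfolding t(2)[symmetric] P.hom_inv[OF \<sigma>H]
      by (rule G.m_assoc[OF g G.inv_closed[OF P.hom_closed[OF \<sigma>H]] P.hom_closed[OF \<sigma>H]])
    also have "\<dots> = g" using g P.hom_closed[OF \<sigma>H] by simp
    finally show "\<exists>t\<in>carrier (torus n). \<exists>\<sigma>\<in>carrier (sym_group n). g = torus_aut n v t \<otimes>\<^bsub>?G\<^esub> perm_aut n v \<sigma>"
      using t(1) \<sigma>H by metis
  next
    fix t \<sigma> t' \<sigma>'
    assume t: "t \<in> carrier (torus n :: (nat \<Rightarrow> 'k) monoid)" and \<sigma>: "\<sigma> \<in> carrier (sym_group n)"
      and t': "t' \<in> carrier (torus n :: (nat \<Rightarrow> 'k) monoid)" and \<sigma>': "\<sigma>' \<in> carrier (sym_group n)"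
      and eq: "torus_aut n v t \<otimes>\<^bsub>?G\<^esub> perm_aut n v \<sigma> = torus_aut n v t' \<otimes>\<^bsub>?G\<^esub> perm_aut n v \<sigma>'"
    note p = perms(1)[OF \<sigma>] perms(1)[OF \<sigma>']
    have "\<sigma> = \<sigma>'"
      by (rule acts_by_perm_unique[OF v
          acts_by_compose[OF v T[OF t] permutes_id perm_aut[OF v p(1)] p(1), unfolded id_o]
          acts_by_compose[OF v T[OF t'] permutes_id perm_aut[OF v p(2)] p(2), unfolded id_o, folded eq] p])
        (simp add: torus_weight_nonzero[OF n t])
    moreover have "torus_aut n v t = torus_aut n v t'"
      using eq P.hom_closed[OF \<sigma>] T(1)[OF t] T(1)[OF t'] unfolding \<open>\<sigma> = \<sigma>'\<close>[symmetric] by simp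
    then have "t = t'" by (rule torus_aut_inject[OF v n t t'])
    ultimately show "t = t' \<and> \<sigma> = \<sigma>'" by blast
  next
    fix t u :: "nat \<Rightarrow> 'k" assume "t \<in> carrier (torus n)" "u \<in> carrier (torus n)"
    then show "t \<otimes>\<^bsub>torus n\<^esub> u \<in> carrier (torus n)" by (auto simp: torus_mult mem_torus_iff)
  qed (use action in blast)+
qed

end
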